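(* Let $\Omega$ be a substitution tiling space with substitution $\sigma$ and let $p:\tilde\Omega\to\Omega$ be a finite, regular covering map. Then $\tilde\Omega$ is a substitution tiling space with a substitution $\tilde\sigma:\tilde\Omega\to\tilde\Omega$ such that $p\circ\tilde\sigma=\sigma^n\circ p$ for some positive integer $n$.
   Context: Tilings are of $\mathbb{R}^d$ by (possibly labeled) tiles that are closed topological balls with disjoint interiors; tiling spaces are hulls of repetitive tilings with finite local complexity: $\Omega$ is the set of all tilings all of whose patches occur, up to translation, in a given tiling, with two tilings close if they agree on a large ball around the origin up to a small translation. Finite local complexity: up to translation there are finitely many patches of each bounded diameter. Repetitive: each patch recurs in every ball of some radius depending on the patch. A substitution tiling space is such a space $\Omega$ generated by an inflate-and-subdivide rule $\sigma$ that replaces each tile by a patch (a supertile). The substitution acts on $\Omega$ as a homeomorphism $\sigma:\Omega\to\Omega$, and $\Omega=\varprojlim(\Gamma,\sigma)$ for a single finite connected CW complex $\Gamma$ (the possibly collared Anderson–Putnam complex) with the self-map induced by the substitution. Covers are connected; a cover is regular if its group of deck transformations acts transitively on fibers, and finite if its fibers are finite. Covers related by a homeomorphism lifting the identity on $\Omega$ are regarded as equivalent, and $\tilde\Omega$ is considered up to this equivalence; up to equivalence, $\tilde\Omega$ is a space of tilings obtained from the tilings of $\Omega$ by adding labels from the group of deck transformations. *)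

theory Defs
  imports "HOL-Analysis.Analysis"
begin

section \<open>Tiles, patches and tilings\<close>

type_synonym ('a, 'l) tile = "'a set \<times> 'l"

definition ball_tile :: "('a::euclidean_space, 'l) tile \<Rightarrow> bool" where
  "ball_tile t \<longleftrightarrow> fst t homeomorphic (cball 0 1 :: 'a set)"

definition disjoint_interiors :: "('a::euclidean_space, 'l) tile set \<Rightarrow> bool" where
  "disjoint_interiors P \<longleftrightarrow> pairwise (\<lambda>s t. interior (fst s) \<inter> interior (fst t) = {}) P"

definition support :: "('a, 'l) tile set \<Rightarrow> 'a set" where
  "support P = (\<Union>t\<in>P. fst t)"

definition is_patch :: "('a::euclidean_space, 'l) tile set \<Rightarrow> bool" where
  "is_patch P \<longleftrightarrow> finite P \<and> (\<forall>t\<in>P. ball_tile t) \<and> disjoint_interiors P"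

definition is_tiling :: "('a::euclidean_space, 'l) tile set \<Rightarrow> bool" where
  "is_tiling T \<longleftrightarrow> (\<forall>t\<in>T. ball_tile t) \<and> disjoint_interiors T \<and> support T = UNIV"

definition translate_tile :: "'a::euclidean_space \<Rightarrow> ('a, 'l) tile \<Rightarrow> ('a, 'l) tile" where
  "translate_tile v t = ((+) v ` fst t, snd t)"

definition translate :: "'a::euclidean_space \<Rightarrow> ('a, 'l) tile set \<Rightarrow> ('a, 'l) tile set" where
  "translate v P = translate_tile v ` P"

text \<open>The tiling by unit cubes witnesses that the type of tilings below is inhabited.\<close>

definition unit_cube :: "('a::euclidean_space \<Rightarrow> int) \<Rightarrow> 'a set" where
  "unit_cube k = cbox (\<Sum>i\<in>Basis. of_int (k i) *\<^sub>R i) (\<Sum>i\<in>Basis. (of_int (k i) + 1) *\<^sub>R i)"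

lemma is_tiling_unit_cubes:
  "is_tiling ((\<lambda>k. (unit_cube k, undefined)) ` UNIV :: ('a::euclidean_space, 'l) tile set)"
proof -
  have int_ne: "interior (unit_cube k) \<noteq> {}" for k :: "'a \<Rightarrow> int"
    by (auto simp: unit_cube_def interior_cbox box_ne_empty)
  have ball: "unit_cube k homeomorphic (cball 0 1 :: 'a set)" for k :: "'a \<Rightarrow> int"
  proof (rule homeomorphic_convex_compact_cball)
    show "convex (unit_cube k)" "compact (unit_cube k)"
      by (auto simp: unit_cube_def)
  qed (use int_ne in auto)
  have disj: "unit_cube k = unit_cube l"
    if meet: "interior (unit_cube k) \<inter> interior (unit_cube l) \<noteq> {}" for k l :: "'a \<Rightarrow> int"
  proof -
    obtain x where x: "x \<in> interior (unit_cube k)" "x \<in> interior (unit_cube l)"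
      using meet by blast
    have "k i = l i" if i: "i \<in> Basis" for i
    proof -
      have "of_int (k i) < x \<bullet> i \<and> x \<bullet> i < of_int (k i) + 1"
        "of_int (l i) < x \<bullet> i \<and> x \<bullet> i < of_int (l i) + 1"
        using x i by (auto simp: unit_cube_def interior_cbox mem_box)
      then show ?thesis by linarith
    qed
    then show ?thesis by (simp add: unit_cube_def)
  qed
  have cover: "x \<in> unit_cube (\<lambda>i. \<lfloor>x \<bullet> i\<rfloor>)" for x :: 'a
  proof -
    have "x \<bullet> i \<le> of_int \<lfloor>x \<bullet> i\<rfloor> + 1" for i
      by linarith
    then show ?thesis by (auto simp: unit_cube_def mem_box)
  qed
  show ?thesis
    unfolding is_tiling_def disjoint_interiors_def support_def ball_tile_def
    using ball disj cover by (fastforce simp: pairwise_def)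
qed

typedef (overloaded) ('a::euclidean_space, 'l) tiling =
    "{T :: ('a, 'l) tile set. is_tiling T}"
  morphisms tiles Tiling
  using is_tiling_unit_cubes by blast

definition central_patch :: "real \<Rightarrow> ('a::euclidean_space, 'l) tile set \<Rightarrow> ('a, 'l) tile set" where
  "central_patch r P = {t \<in> P. fst t \<inter> ball 0 r \<noteq> {}}"

definition close :: "real \<Rightarrow> ('a::euclidean_space, 'l) tiling \<Rightarrow> ('a, 'l) tiling \<Rightarrow> bool" where
  "close e T T' \<longleftrightarrow>
     (\<exists>v. norm v < e \<and>
          central_patch (1 / e) (tiles T') = central_patch (1 / e) (translate v (tiles T)))"

lemma close_mono:
  assumes "close d T T'" "0 < d" "d \<le> e"
  shows "close e T T'"
proof -
  have "central_patch (1 / e) P = central_patch (1 / e) (central_patch (1 / d) P)"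
    for P :: "('a, 'b) tile set"
  proof -
    have "ball 0 (1 / e) \<subseteq> ball (0::'a) (1 / d)"
      using assms by (intro subset_ball frac_le) auto
    then show ?thesis by (auto simp: central_patch_def)
  qed
  then show ?thesis
    using assms unfolding close_def by (metis order_less_le_trans)
qed

instantiation tiling :: (euclidean_space, type) topological_space
begin

definition open_tiling :: "('a, 'b) tiling set \<Rightarrow> bool" where
  "open_tiling U \<longleftrightarrow> (\<forall>T\<in>U. \<exists>e>0. \<forall>T'. close e T T' \<longrightarrow> T' \<in> U)"

instance
proof
  show "open (UNIV :: ('a, 'b) tiling set)"
    by (auto simp: open_tiling_def intro: exI[of _ 1])
next
  fix U V :: "('a, 'b) tiling set"
  assume U: "open U" and V: "open V"
  show "open (U \<inter> V)"
    unfolding open_tiling_def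
  proof
    fix T assume "T \<in> U \<inter> V"
    then have "T \<in> U" "T \<in> V" by auto
    then obtain d e where "d > 0" "\<forall>T'. close d T T' \<longrightarrow> T' \<in> U"
        and "e > 0" "\<forall>T'. close e T T' \<longrightarrow> T' \<in> V"
      using U V unfolding open_tiling_def by meson
    then show "\<exists>e>0. \<forall>T'. close e T T' \<longrightarrow> T' \<in> U \<inter> V"
      by (intro exI[of _ "min d e"]) (auto dest: close_mono[of "min d e" _ _ d] close_mono[of "min d e" _ _ e])
  qed
next
  fix K :: "('a, 'b) tiling set set"
  assume "\<forall>U\<in>K. open U"
  then show "open (\<Union>K)"
    unfolding open_tiling_def by (meson UnionE UnionI)
qed

end


section \<open>Tiling spaces\<close>

text \<open>A bound on the diameter of patches does not by itself bound the size of the tiles, so the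
  usual requirement that there are only finitely many tiles up to translation is stated
  separately.\<close>

definition finite_local_complexity :: "('a::euclidean_space, 'l) tiling \<Rightarrow> bool" where
  "finite_local_complexity T \<longleftrightarrow>
     finite ((\<lambda>t. range (\<lambda>v. translate_tile v t)) ` tiles T) \<and>
     (\<forall>r. finite ((\<lambda>P. range (\<lambda>v. translate v P)) `
            {P. P \<subseteq> tiles T \<and> finite P \<and> diameter (support P) \<le> r}))"

definition repetitive :: "('a::euclidean_space, 'l) tiling \<Rightarrow> bool" where
  "repetitive T \<longleftrightarrow>
     (\<forall>P. P \<subseteq> tiles T \<and> finite P \<longrightarrow>
        (\<exists>r>0. \<forall>x. \<exists>v. translate v P \<subseteq> tiles T \<and> support (translate v P) \<subseteq> ball x r))"

definition tiling_hull :: "('a::euclidean_space, 'l) tiling \<Rightarrow> ('a, 'l) tiling set" where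
  "tiling_hull T =
     {T'. \<forall>P. P \<subseteq> tiles T' \<and> finite P \<longrightarrow> (\<exists>v. translate v P \<subseteq> tiles T)}"

definition tiling_space :: "('a::euclidean_space, 'l) tiling set \<Rightarrow> bool" where
  "tiling_space \<Omega> \<longleftrightarrow>
     (\<exists>T. finite_local_complexity T \<and> repetitive T \<and> \<Omega> = tiling_hull T)"


section \<open>Substitutions\<close>

definition inflation :: "('a::euclidean_space \<Rightarrow> 'a) \<Rightarrow> bool" where
  "inflation L \<longleftrightarrow> linear L \<and> (\<exists>c>1. \<forall>x. norm (L x) \<ge> c * norm x)"

definition tiles_of_space :: "('a::euclidean_space, 'l) tiling set \<Rightarrow> ('a, 'l) tile set" where
  "tiles_of_space \<Omega> = (\<Union>T\<in>\<Omega>. tiles T)"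

definition subdivide ::
    "(('a, 'l) tile \<Rightarrow> ('a, 'l) tile set) \<Rightarrow> ('a, 'l) tile set \<Rightarrow> ('a, 'l) tile set" where
  "subdivide \<omega> P = (\<Union>t\<in>P. \<omega> t)"

definition inflate_and_subdivide_rule ::
    "('a::euclidean_space \<Rightarrow> 'a) \<Rightarrow> ('a, 'l) tile set \<Rightarrow>
     (('a, 'l) tile \<Rightarrow> ('a, 'l) tile set) \<Rightarrow> bool" where
  "inflate_and_subdivide_rule L A \<omega> \<longleftrightarrow>
     inflation L \<and>
     (\<forall>t\<in>A. is_patch (\<omega> t) \<and> support (\<omega> t) = L ` fst t \<and>
             (\<forall>v. \<omega> (translate_tile v t) = translate (L v) (\<omega> t)))"

text \<open>\<open>\<Omega>\<close> is generated by the rule: it consists of the tilings all of whose patches occur in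
  iterated supertiles.\<close>

definition generated_by ::
    "(('a::euclidean_space, 'l) tile \<Rightarrow> ('a, 'l) tile set) \<Rightarrow> ('a, 'l) tiling set \<Rightarrow> bool" where
  "generated_by \<omega> \<Omega> \<longleftrightarrow>
     \<Omega> = {T. \<forall>P. P \<subseteq> tiles T \<and> finite P \<longrightarrow>
              (\<exists>t\<in>tiles_of_space \<Omega>. \<exists>k v. translate v P \<subseteq> (subdivide \<omega> ^^ k) {t})}"

definition substitution_tiling_space ::
    "('a::euclidean_space \<Rightarrow> 'a) \<Rightarrow> ('a, 'l) tiling set \<Rightarrow>
     (('a, 'l) tiling \<Rightarrow> ('a, 'l) tiling) \<Rightarrow> bool" where
  "substitution_tiling_space L \<Omega> \<sigma> \<longleftrightarrow>
     tiling_space \<Omega> \<and>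
     (\<exists>\<omega>. inflate_and_subdivide_rule L (tiles_of_space \<Omega>) \<omega> \<and>
          generated_by \<omega> \<Omega> \<and>
          (\<forall>T\<in>\<Omega>. tiles (\<sigma> T) = subdivide \<omega> (tiles T))) \<and>
     (\<exists>\<sigma>'. homeomorphism \<Omega> \<Omega> \<sigma> \<sigma>')"


section \<open>Finite regular covers\<close>

text \<open>Deck transformations are normalised to be \<open>undefined\<close> outside the covering space, so that
  distinct elements of this set are distinct as maps of the covering space.\<close>

definition deck_transformations ::
    "'c::topological_space set \<Rightarrow> ('c \<Rightarrow> 'b) \<Rightarrow> ('c \<Rightarrow> 'c) set" where
  "deck_transformations C p =
     {g \<in> extensional C. (\<exists>g'. homeomorphism C C g g') \<and> (\<forall>x\<in>C. p (g x) = p x)}"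

definition finite_regular_cover ::
    "'c::topological_space set \<Rightarrow> ('c \<Rightarrow> 'b) \<Rightarrow> 'b::topological_space set \<Rightarrow> bool" where
  "finite_regular_cover C p S \<longleftrightarrow>
     covering_space C p S \<and> connected C \<and>
     (\<forall>y\<in>S. finite {x\<in>C. p x = y}) \<and>
     (\<forall>x\<in>C. \<forall>y\<in>C. p x = p y \<longrightarrow> (\<exists>g\<in>deck_transformations C p. g x = y))"


section \<open>Labelling tilings by deck transformations\<close>

text \<open>The collar of a tile consists of the tiles meeting it. The collar type of a tile is the
  translation class of the pair of the tile and its collar.\<close>

type_synonym ('a, 'l) collar_type = "(('a, 'l) tile \<times> ('a, 'l) tile set) set"

definition collar :: "('a, 'l) tile set \<Rightarrow> ('a, 'l) tile \<Rightarrow> ('a, 'l) tile set" where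
  "collar P t = {s \<in> P. fst s \<inter> fst t \<noteq> {}}"

definition collar_type ::
    "('a::euclidean_space, 'l) tile set \<Rightarrow> ('a, 'l) tile \<Rightarrow> ('a, 'l) collar_type" where
  "collar_type P t = range (\<lambda>v. (translate_tile v t, translate v (collar P t)))"

text \<open>\<open>T'\<close> arises from \<open>T\<close> by adding to the label of each tile its collar type and an element of
  \<open>D\<close>. Collaring does not change the tiling space, but it is needed for a substitution
  of labelled tiles to be a function of single tiles: the labels inside a supertile may depend on
  the neighbours of the original tile.\<close>

definition adds_labels ::
    "'g set \<Rightarrow> ('a::euclidean_space, 'l) tiling \<Rightarrow>
     ('a, 'l \<times> ('a, 'l) collar_type \<times> 'g) tiling \<Rightarrow> bool" where
  "adds_labels D T T' \<longleftrightarrow>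
     (\<lambda>(S, l, c, g). (S, l)) ` tiles T' = tiles T \<and>
     (\<forall>(S, l, c, g) \<in> tiles T'. c = collar_type (tiles T) (S, l) \<and> g \<in> D)"

end

theory Submission
  imports Defs "HOL-Library.Diagonal_Subsequence"
begin

text \<open>The cover has a translation flow lifting the translations of tilings, and by compactness points
  of the cover over tilings that agree on a large ball can be compared canonically. Substitution
  expands patches, so the cover pulled back along a large power \<open>\<sigma> ^^ k\<close> is described by transition
  data that depend only on the translation class of two touching tiles with their collars. There are
  finitely many such classes and finitely many deck transformations, so the pullbacks along two
  powers \<open>k < m\<close> have the same data and are isomorphic; hence \<open>\<sigma> ^^ (m - k)\<close> lifts to the cover.
  Comparing points over a high power of the substitution also yields labels of collared tiles by deck
  transformations, for which the labels inside a supertile are determined by the labelled tile. The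
  labelled tilings form a tiling space because the flow on the cover is minimal.\<close>

section \<open>Translations of tiles and tilings\<close>

text \<open>A hull is in general neither path connected nor locally connected, so
  \<open>\<sigma>\<close> cannot be lifted by a criterion on fundamental groups. The paths at hand
  are translations within an orbit, and they give the flow on the cover. Points over different
  orbits are compared by \<open>near\<close>, which asks for agreement of the tilings on a ball of
  one fixed radius. Since \<open>\<sigma>\<close> is invertible on \<Omega>, the pullback along
  \<open>\<sigma> ^^ k\<close> is the same space \<open>C\<close> with projection
  \<open>base k\<close>. An isomorphism of the pullbacks along \<open>k < m\<close> is therefore a
  self-homeomorphism \<open>F\<close> of \<open>C\<close>, and
  \<open>base m (F x) = base k x\<close> says exactly that \<open>F\<close> covers
  \<open>\<sigma> ^^ (m - k)\<close>. Comparisons along a tile must survive both the flow and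
  \<open>F\<close>, and each demands agreement on a ball of its own radius, \<open>R2\<close> and
  \<open>R3\<close>. A collar only fixes a neighbourhood of width \<open>eps\<close>, so labels are
  read after enough iterations of \<open>F\<close> for this width to be inflated past both radii.
  Collar types enter the labels because deck transformations attached to tiles with different
  collars have no common reference point.\<close>

lemma fst_translate_tile [simp]: "fst (translate_tile v t) = (+) v ` fst t"
  by (simp add: translate_tile_def)

lemma snd_translate_tile [simp]: "snd (translate_tile v t) = snd t"
  by (simp add: translate_tile_def)

lemma translate_tile_0 [simp]: "translate_tile 0 t = t"
  by (simp add: translate_tile_def)

lemma translate_tile_add [simp]: "translate_tile v (translate_tile w t) = translate_tile (v + w) t"
  by (simp add: translate_tile_def image_image add.assoc)

lemma translate_0 [simp]: "translate 0 P = P"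
  by (simp add: translate_def image_def)

lemma translate_add [simp]: "translate v (translate w P) = translate (v + w) P"
  by (simp add: translate_def image_image)

lemma mem_translate: "t \<in> translate v P \<longleftrightarrow> translate_tile (- v) t \<in> P"
proof
  show "translate_tile (- v) t \<in> P" if "t \<in> translate v P"
    using that by (auto simp: translate_def)
  show "t \<in> translate v P" if "translate_tile (- v) t \<in> P"
    using imageI[OF that, of "translate_tile v"] by (simp add: translate_def)
qed

lemma inj_translate_tile: "inj (translate_tile v)"
  by (rule inj_on_inverseI[of _ "translate_tile (- v)"]) simp

lemma translate_subset_iff: "translate v P \<subseteq> Q \<longleftrightarrow> P \<subseteq> translate (- v) Q"
proof -
  have "translate v P \<subseteq> Q \<longleftrightarrow> (\<forall>t\<in>P. translate_tile v t \<in> Q)"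
    by (auto simp: translate_def)
  also have "\<dots> \<longleftrightarrow> P \<subseteq> translate (- v) Q"
    by (auto simp only: mem_translate subset_iff minus_minus)
  finally show ?thesis .
qed

lemma finite_translate [simp]: "finite (translate v P) \<longleftrightarrow> finite P"
  unfolding translate_def by (meson finite_image_iff inj_on_subset inj_translate_tile subset_UNIV)

lemma support_translate: "support (translate v P) = (+) v ` support P"
  by (auto simp: support_def translate_def)

lemma support_mono: "P \<subseteq> Q \<Longrightarrow> support P \<subseteq> support Q"
  by (auto simp: support_def)

lemma plus_image_ball: "(+) v ` ball x r = ball (v + x :: 'a::euclidean_space) r"
  by (simp add: ball_translation add.commute)

lemma ball_tile_translate [simp]: "ball_tile (translate_tile v t) = ball_tile t"
proof -
  have "fst t homeomorphic (+) v ` fst t"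
    by (rule homeomorphic_translation)
  then show ?thesis
    unfolding ball_tile_def by (simp, meson homeomorphic_sym homeomorphic_trans)
qed

lemma ball_tile_compact: "ball_tile t \<Longrightarrow> compact (fst t)"
  unfolding ball_tile_def using homeomorphic_compactness compact_cball by blast

lemma ball_tile_closed: "ball_tile t \<Longrightarrow> closed (fst t)"
  by (simp add: ball_tile_compact compact_imp_closed)

lemma ball_tile_connected: "ball_tile t \<Longrightarrow> connected (fst t)"
  unfolding ball_tile_def using homeomorphic_connectedness connected_cball by blast

text \<open>Invariance of domain makes the image of the open unit ball open, hence part of the
  interior, and that image is dense in the tile.\<close>

lemma ball_tile_closure_interior:
  fixes t :: "('a::euclidean_space, 'l) tile"
  assumes "ball_tile t"
  shows "closure (interior (fst t)) = fst t"
proof -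
  have "(cball 0 1 :: 'a set) homeomorphic fst t"
    using assms unfolding ball_tile_def by (rule homeomorphic_sym[THEN iffD1])
  then obtain f g where fg: "homeomorphism (cball 0 1 :: 'a set) (fst t) f g"
    unfolding homeomorphic_def by (elim exE that)
  have "open (f ` ball 0 1)"
  proof (rule invariance_of_domain)
    show "continuous_on (ball 0 1) f"
      using fg ball_subset_cball by (rule continuous_on_subset[OF homeomorphism_cont1])
    show "inj_on f (ball 0 1)"
      using fg ball_subset_cball unfolding homeomorphism_def
      by (intro inj_on_inverseI[of _ g]) auto
  qed auto
  moreover have "f ` ball 0 1 \<subseteq> fst t"
    using fg unfolding homeomorphism_def by fastforce
  ultimately have sub: "f ` ball 0 1 \<subseteq> interior (fst t)"
    by (simp add: interior_maximal)
  have "fst t = f ` closure (ball 0 1)"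
    using fg by (simp add: homeomorphism_def)
  also have "\<dots> \<subseteq> closure (f ` ball 0 1)"
    by (rule image_closure_subset[OF _ closed_closure closure_subset])
      (use fg in \<open>simp add: homeomorphism_def\<close>)
  also have "\<dots> \<subseteq> closure (interior (fst t))"
    by (rule closure_mono[OF sub])
  finally have "fst t \<subseteq> closure (interior (fst t))" .
  moreover have "closure (interior (fst t)) \<subseteq> fst t"
    by (simp add: assms ball_tile_closed closure_minimal interior_subset)
  ultimately show ?thesis by auto
qed

lemma ball_tile_nonempty: "ball_tile t \<Longrightarrow> fst t \<noteq> {}"
  unfolding ball_tile_def using homeomorphic_empty(2) by fastforce

lemma ball_tile_interior_nonempty: "ball_tile t \<Longrightarrow> interior (fst t) \<noteq> {}"
  by (metis ball_tile_closure_interior ball_tile_nonempty closure_empty)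

text \<open>A point of \<open>S\<close> that maximises the inner product with \<open>v\<close> would
  be moved by \<open>v\<close> to a point with a larger one, unless \<open>v = 0\<close>.\<close>

lemma compact_translation_trivial:
  fixes S :: "'a::euclidean_space set"
  assumes "compact S" "S \<noteq> {}" "(+) v ` S = S"
  shows "v = 0"
proof -
  have "continuous_on S (\<lambda>y. y \<bullet> v)"
    by (intro continuous_intros)
  from continuous_attains_sup[OF assms(1,2) this]
  obtain x where x: "x \<in> S" "\<And>y. y \<in> S \<Longrightarrow> y \<bullet> v \<le> x \<bullet> v"
    by blast
  have "v + x \<in> S"
    using x assms by blast
  then have "v \<bullet> v \<le> 0"
    using x(2)[of "v + x"] by (simp add: inner_left_distrib)
  then show ?thesis
    by (metis inner_gt_zero_iff not_le)
qed

text \<open>Comparisons of points over translated tiles rely on this to recover the translation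
  vector from the tiles.\<close>

lemma translate_tile_eq_iff:
  assumes "ball_tile t"
  shows "translate_tile v t = translate_tile w t \<longleftrightarrow> v = w"
proof
  assume "translate_tile v t = translate_tile w t"
  then have "translate_tile (- w) (translate_tile v t) = t"
    by simp
  then have "(+) (v - w) ` fst t = fst t"
    by (metis fst_translate_tile translate_tile_add uminus_add_conv_diff)
  from compact_translation_trivial[OF ball_tile_compact[OF assms] ball_tile_nonempty[OF assms] this]
  show "v = w" by simp
qed simp

lemma is_tiling_translate:
  assumes "is_tiling T"
  shows "is_tiling (translate v T)"
proof -
  have "disjoint_interiors (translate v T)"
    unfolding disjoint_interiors_def
  proof (rule pairwiseI)
    fix s t assume "s \<in> translate v T" "t \<in> translate v T" "s \<noteq> t"
    then obtain s' t' where st: "s' \<in> T" "t' \<in> T" "s = translate_tile v s'" "t = translate_tile v t'" "s' \<noteq> t'"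
      by (auto simp: translate_def)
    then have "interior (fst s') \<inter> interior (fst t') = {}"
      using assms unfolding is_tiling_def disjoint_interiors_def by (auto dest: pairwiseD)
    then show "interior (fst s) \<inter> interior (fst t) = {}"
      using st by (simp add: interior_translation flip: image_Int)
  qed
  moreover have "support (translate v T) = UNIV"
    using assms unfolding is_tiling_def support_translate by (simp add: surj_plus)
  ultimately show ?thesis
    using assms unfolding is_tiling_def by (auto simp: translate_def)
qed

definition tr :: "'a::euclidean_space \<Rightarrow> ('a, 'l) tiling \<Rightarrow> ('a, 'l) tiling" where
  "tr v T = Tiling (translate v (tiles T))"

lemma is_tiling_tiles [simp]: "is_tiling (tiles T)"
  using tiles by auto

lemma tiles_tr: "tiles (tr v T) = translate v (tiles T)"
  unfolding tr_def by (rule Tiling_inverse) (simp add: is_tiling_translate)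

lemma tr_0 [simp]: "tr 0 T = T"
  by (simp add: tiles_tr tiles_inject[symmetric])

lemma tr_tr [simp]: "tr v (tr w T) = tr (v + w) T"
  by (simp add: tiles_tr tiles_inject[symmetric])

lemma mem_tiles_tr: "t \<in> tiles (tr v T) \<longleftrightarrow> translate_tile (- v) t \<in> tiles T"
  by (simp add: tiles_tr mem_translate)

lemma translate_tile_mem_tr [simp]: "translate_tile v t \<in> tiles (tr v T) \<longleftrightarrow> t \<in> tiles T"
  by (simp add: mem_tiles_tr)

lemma tiles_ball_tile: "t \<in> tiles T \<Longrightarrow> ball_tile t"
  using is_tiling_tiles[of T] by (auto simp: is_tiling_def)

lemma tiles_cover: "\<exists>t\<in>tiles T. x \<in> fst t"
  using is_tiling_tiles[of T] by (auto simp: is_tiling_def support_def set_eq_iff)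

lemma tiles_eqI:
  assumes "s \<in> tiles T" "t \<in> tiles T" "interior (fst s) \<inter> interior (fst t) \<noteq> {}"
  shows "s = t"
  using assms is_tiling_tiles[of T] unfolding is_tiling_def disjoint_interiors_def
  by (auto dest: pairwiseD)

lemma interior_finite_Union_empty:
  fixes \<F> :: "'a::euclidean_space set set"
  assumes "finite \<F>" "\<And>S. S \<in> \<F> \<Longrightarrow> closed S" "\<And>S. S \<in> \<F> \<Longrightarrow> interior S = {}"
  shows "interior (\<Union>\<F>) = {}"
  using assms
proof (induction \<F>)
  case (insert S \<F>)
  then have "interior (S \<union> \<Union>\<F>) = interior S"
    by (intro interior_closed_Un_empty_interior) auto
  then show ?case using insert by simp
qed auto

text \<open>A tile is the closure of its interior, so it cannot meet \<open>U\<close> only in a boundary point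
  shared with \<open>Q\<close>.\<close>

lemma tile_mem_cover:
  assumes "s \<in> tiles T" "Q \<subseteq> tiles T" "finite Q" "open U" "U \<subseteq> support Q" "fst s \<inter> U \<noteq> {}"
  shows "s \<in> Q"
proof (rule ccontr)
  assume "s \<notin> Q"
  have bs: "ball_tile s" using assms(1) by (rule tiles_ball_tile)
  define V where "V = interior (fst s) \<inter> U"
  have "V \<noteq> {}"
    using open_Int_closure_eq_empty[OF assms(4), of "interior (fst s)"] assms(6)
    unfolding ball_tile_closure_interior[OF bs] V_def by (simp add: Int_commute)
  have "open V" unfolding V_def using assms(4) by (simp add: open_Int)
  \<comment> \<open>Interior points of the tiles in \<open>Q\<close> stay outside \<open>V\<close>,
    so the traces of these tiles on \<open>closure V\<close> are closed with empty interior;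
    finitely many of them cannot cover the nonempty open set \<open>V\<close>.\<close>
  have "interior (\<Union>((\<lambda>q. fst q \<inter> closure V) ` Q)) = {}"
  proof (rule interior_finite_Union_empty)
    fix S assume "S \<in> (\<lambda>q. fst q \<inter> closure V) ` Q"
    then obtain q where q: "q \<in> Q" "S = fst q \<inter> closure V" by auto
    have "q \<in> tiles T" using q(1) assms(2) by blast
    then have "closed (fst q)" by (intro ball_tile_closed tiles_ball_tile)
    then show "closed S" unfolding q(2) by (rule closed_Int) simp
    have "interior (fst q) \<inter> interior (fst s) = {}"
      using tiles_eqI[OF \<open>q \<in> tiles T\<close> assms(1)] q(1) \<open>s \<notin> Q\<close> by blast
    then have "interior (fst q) \<inter> V = {}"
      unfolding V_def by blast
    then have "interior (fst q) \<inter> closure V = {}"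
      by (simp add: open_Int_closure_eq_empty)
    then show "interior S = {}"
      unfolding q(2) interior_Int using interior_subset[of "closure V"] by blast
  qed (use assms(3) in simp)
  moreover have "V \<subseteq> \<Union>((\<lambda>q. fst q \<inter> closure V) ` Q)"
  proof
    fix x assume x: "x \<in> V"
    then have "x \<in> support Q" using assms(5) unfolding V_def by blast
    then obtain q where "q \<in> Q" "x \<in> fst q"
      unfolding support_def by blast
    moreover have "x \<in> closure V"
      using x closure_subset by (rule rev_subsetD)
    ultimately show "x \<in> \<Union>((\<lambda>q. fst q \<inter> closure V) ` Q)"
      by blast
  qed
  then have "V \<subseteq> interior (\<Union>((\<lambda>q. fst q \<inter> closure V) ` Q))"
    using \<open>open V\<close> by (rule interior_maximal)
  ultimately show False
    using \<open>V \<noteq> {}\<close> by simp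
qed

section \<open>Central patches and agreement on balls around the origin\<close>

abbreviation cp :: "real \<Rightarrow> ('a::euclidean_space, 'l) tiling \<Rightarrow> ('a, 'l) tile set" where
  "cp r T \<equiv> central_patch r (tiles T)"

lemma cp_mono:
  fixes T T' :: "('a::euclidean_space, 'b) tiling"
  shows "cp r T = cp r T' \<Longrightarrow> r' \<le> r \<Longrightarrow> cp r' T = cp r' T'"
proof -
  assume e: "cp r T = cp r T'" and "r' \<le> r"
  then have "ball 0 r' \<subseteq> ball (0::'a) r" by (simp add: subset_ball)
  then have "cp r' S = {t \<in> cp r S. fst t \<inter> ball 0 r' \<noteq> {}}" for S :: "('a, 'b) tiling"
    unfolding central_patch_def by blast
  with e show ?thesis by simp
qed

lemma cp_subset: "cp r T \<subseteq> tiles T"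
  by (auto simp: central_patch_def)

lemma cp_support: "ball 0 r \<subseteq> support (cp r T)"
  using tiles_cover[of T] by (fastforce simp: central_patch_def support_def)

lemma cp_tr:
  assumes "cp r T = cp r T'" "r' + norm v \<le> r"
  shows "cp r' (tr v T) = cp r' (tr v T')"
proof -
  have "t \<in> cp r' (tr v S')" if e: "cp r S = cp r S'" and t: "t \<in> cp r' (tr v S)" for t and S S' :: "('a,'b) tiling"
  proof -
    have 1: "translate_tile (- v) t \<in> tiles S" "fst t \<inter> ball 0 r' \<noteq> {}"
      using t by (auto simp: central_patch_def mem_tiles_tr)
    then obtain x where x: "x \<in> fst t" "norm x < r'" by auto
    have "norm (x - v) < r"
      using x assms(2) norm_triangle_ineq4[of x v] by linarith
    then have "- v + x \<in> fst (translate_tile (-v) t) \<inter> ball 0 r"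
      using x by auto
    then have "translate_tile (- v) t \<in> cp r S"
      using 1 unfolding central_patch_def by blast
    then have "translate_tile (- v) t \<in> tiles S'"
      using e cp_subset by blast
    then show ?thesis
      using 1 by (auto simp: central_patch_def mem_tiles_tr)
  qed
  from this[OF assms(1)] this[OF assms(1)[symmetric]] show ?thesis by blast
qed

text \<open>The patch of \<open>T\<close> already covers the ball, which leaves no room for further
  tiles of \<open>T'\<close>; hence one inclusion is enough.\<close>

lemma cp_eqI:
  assumes "cp r T \<subseteq> tiles T'" "finite (cp r T)"
  shows "cp r T = cp r T'"
proof -
  have "s \<in> cp r T" if "s \<in> cp r T'" for s
    using tile_mem_cover[of s T' "cp r T" "ball 0 r"] assms that cp_support[of r T]
    by (auto simp: central_patch_def)
  then show ?thesis
    using assms by (auto simp: central_patch_def)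
qed

lemma mem_cp: "t \<in> tiles T \<Longrightarrow> x \<in> fst t \<Longrightarrow> norm x < r \<Longrightarrow> t \<in> cp r T"
  by (auto simp: central_patch_def)

section \<open>Convergence of tilings\<close>

text \<open>Translates by vectors that differ by less than an inradius have overlapping interiors.
  This makes the small shift between two nearly agreeing tilings unique.\<close>

lemma tile_translates_eq:
  assumes "ball a \<rho> \<subseteq> fst t" "translate_tile v t \<in> tiles T" "translate_tile w t \<in> tiles T"
    "norm (v - w) < \<rho>"
  shows "v = w"
proof -
  have "ball a \<rho> \<subseteq> interior (fst t)"
    using assms(1) by (simp add: interior_maximal)
  then have sub: "(+) u ` ball a \<rho> \<subseteq> interior (fst (translate_tile u t))" for u
    unfolding fst_translate_tile interior_translation by (rule image_mono)
  have \<rho>: "0 < \<rho>" using assms(4) norm_ge_zero by (rule le_less_trans[rotated])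
  have "v + a \<in> (+) v ` ball a \<rho>" using \<rho> by (intro imageI) simp
  moreover have "v + a \<in> (+) w ` ball a \<rho>"
    unfolding plus_image_ball using assms(4) by (simp add: dist_norm norm_minus_commute)
  ultimately have "interior (fst (translate_tile v t)) \<inter> interior (fst (translate_tile w t)) \<noteq> {}"
    using sub by blast
  then have "translate_tile v t = translate_tile w t"
    by (rule tiles_eqI[OF assms(2,3)])
  moreover have "ball_tile t"
    using assms(2) tiles_ball_tile ball_tile_translate by blast
  ultimately show ?thesis by (simp add: translate_tile_eq_iff)
qed

text \<open>In \<open>close\<close> the shift may depend on the scale. Here one sequence of shifts
  serves all radii, and it can be applied to individual tiles, collars and patches.\<close>

definition conv :: "(nat \<Rightarrow> ('a::euclidean_space, 'l) tiling) \<Rightarrow> ('a, 'l) tiling \<Rightarrow> (nat \<Rightarrow> 'a) \<Rightarrow> bool" where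
  "conv X T v \<longleftrightarrow> v \<longlonglongrightarrow> 0 \<and> (\<forall>r. \<forall>\<^sub>F n in sequentially. cp r (X n) = cp r (tr (v n) T))"

lemma close_eq: "close e T T' \<longleftrightarrow> (\<exists>v. norm v < e \<and> cp (1/e) T' = cp (1/e) (tr v T))"
  by (simp add: close_def tiles_tr)

lemma close_refl: "e > 0 \<Longrightarrow> close e T T"
  unfolding close_eq by (rule exI[of _ 0]) simp

lemma close_trans:
  assumes "close a T T'" "close b T' T''" "0 < a" "0 < b" "a + b \<le> c" "1 / c \<le> 1 / a - b" "1 / c \<le> 1 / b"
  shows "close c T T''"
proof -
  obtain v w where vw: "norm v < a" "cp (1/a) T' = cp (1/a) (tr v T)" "norm w < b" "cp (1/b) T'' = cp (1/b) (tr w T')"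
    using assms(1,2) unfolding close_eq by blast
  have "cp (1/c) T'' = cp (1/c) (tr w T')"
    using vw(4) assms(7) by (rule cp_mono)
  also have "\<dots> = cp (1/c) (tr w (tr v T))"
    using vw(2) by (rule cp_tr) (use vw(3) assms(6) in linarith)
  finally have "cp (1/c) T'' = cp (1/c) (tr (w + v) T)" by simp
  moreover have "norm (w + v) < c"
    using vw assms(5) norm_triangle_ineq[of w v] by linarith
  ultimately show ?thesis unfolding close_eq by blast
qed

text \<open>\<open>close\<close> behaves only like a quasi-metric: the second shift moves the ball
  on which the first agreement is known, so radius is lost. Below \<open>1/2\<close> a factor 2
  makes up for it.\<close>

lemma close_trans':
  assumes "close a T T'" "close b T' T''" "0 < a" "0 < b" "a \<le> 1/2" "b \<le> 1/2"
  shows "close (2 * (a + b)) T T''"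
proof (rule close_trans[OF assms(1-4)])
  have "1 / (2 * (a + b)) \<le> 1 / (2 * a)" "1 / (2 * (a + b)) \<le> 1 / b"
    using assms by (auto intro!: divide_left_mono)
  moreover have "b \<le> 1 / (2 * a)"
    using assms mult_mono[of a "1/2" b "1/2"] by (simp add: field_simps)
  moreover have "1 / a - 1 / (2 * a) = 1 / (2 * a)"
    using assms by (simp add: field_simps)
  ultimately show "1 / (2 * (a + b)) \<le> 1 / a - b" "1 / (2 * (a + b)) \<le> 1 / b"
    by linarith+
qed (use assms in auto)

lemma close_sym:
  assumes "close a T T'" "0 < a" "a \<le> 1/2"
  shows "close (2 * a) T' T"
proof -
  obtain v where v: "norm v < a" "cp (1/a) T' = cp (1/a) (tr v T)"
    using assms(1) unfolding close_eq by blast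
  have "a \<le> 1 / (2 * a)"
    using assms mult_mono[of a "1/2" a "1/2"] by (simp add: field_simps)
  moreover have "1 / a - 1 / (2 * a) = 1 / (2 * a)"
    using assms by (simp add: field_simps)
  ultimately have "1 / (2 * a) + norm (- v) \<le> 1 / a"
    using v by simp
  from cp_tr[OF v(2) this] show ?thesis
    unfolding close_eq using v(1) assms by (intro exI[of _ "- v"]) auto
qed

text \<open>Openness only asks for a \<open>close\<close>-ball around each point of the set, and
  such a ball need not be open itself. The union of the balls at scales strictly below
  \<open>e\<close> has the slack to absorb a change of centre.\<close>

lemma open_nhd_close:
  fixes T :: "('a::euclidean_space, 'l) tiling"
  assumes "e > 0"
  obtains U where "open U" "T \<in> U" "\<And>T'. T' \<in> U \<Longrightarrow> close e T T'"
proof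
  define U where "U = {T'. \<exists>d. 0 < d \<and> d < e \<and> close d T T'}"
  show "open U"
    unfolding open_tiling_def
  proof
    fix T' assume "T' \<in> U"
    then obtain d where d: "0 < d" "d < e" "close d T T'" unfolding U_def by blast
    define c where "c = (d + e) / 2"
    have c: "d < c" "c < e" "0 < c" using d by (auto simp: c_def)
    have "1 / c < 1 / d" using c d by (intro divide_strict_left_mono) auto
    define b where "b = min (min (c - d) c) (1 / d - 1 / c)"
    have b: "0 < b" "b \<le> c - d" "b \<le> 1/d - 1/c" "b \<le> c"
      using c \<open>1 / c < 1 / d\<close> by (auto simp: b_def)
    have "T'' \<in> U" if "close b T' T''" for T''
    proof -
      have "close c T T''"
        by (rule close_trans[OF d(3) that]) (use b c d in \<open>auto intro: divide_left_mono\<close>)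
      then show ?thesis unfolding U_def using c by blast
    qed
    then show "\<exists>e>0. \<forall>T''. close e T' T'' \<longrightarrow> T'' \<in> U" using b by blast
  qed
  show "T \<in> U" unfolding U_def using assms close_refl[of "e/2" T] by (intro CollectI exI[of _ "e/2"]) auto
  show "close e T T'" if "T' \<in> U" for T'
    using that close_mono unfolding U_def by fastforce
qed

lemma eventually_close:
  assumes "X \<longlonglongrightarrow> T" "e > 0"
  shows "\<forall>\<^sub>F n in sequentially. close e T (X n)"
proof -
  obtain U where "open U" "T \<in> U" "\<And>T'. T' \<in> U \<Longrightarrow> close e T T'"
    using open_nhd_close[OF assms(2)] by metis
  with topological_tendstoD[OF assms(1)] show ?thesis
    by (metis (mono_tags, lifting) eventually_mono)
qed

lemma tendsto_closeI:
  assumes "\<And>e. e > 0 \<Longrightarrow> \<forall>\<^sub>F n in sequentially. close e T (X n)"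
  shows "X \<longlonglongrightarrow> T"
proof (rule topological_tendstoI)
  fix U assume "open U" "T \<in> U"
  then obtain e where "e > 0" "\<And>T'. close e T T' \<Longrightarrow> T' \<in> U"
    unfolding open_tiling_def by blast
  with assms[of e] show "\<forall>\<^sub>F n in sequentially. X n \<in> U"
    by (auto elim: eventually_mono)
qed

lemma conv_imp_tendsto:
  assumes "conv X T v" shows "X \<longlonglongrightarrow> T"
proof (rule tendsto_closeI)
  fix e :: real assume e: "e > 0"
  then have "\<forall>\<^sub>F n in sequentially. norm (v n) < e"
    using assms unfolding conv_def tendsto_iff by simp
  moreover have "\<forall>\<^sub>F n in sequentially. cp (1/e) (X n) = cp (1/e) (tr (v n) T)"
    using assms unfolding conv_def by blast
  ultimately show "\<forall>\<^sub>F n in sequentially. close e T (X n)"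
    by eventually_elim (auto simp: close_eq)
qed

text \<open>Below the scale \<open>e0\<close> the shift is unique, since it is read off from a tile
  at the origin. So the shifts found at finer scales all agree with the one chosen at scale
  \<open>e0\<close>.\<close>

lemma tendsto_imp_conv:
  fixes T :: "('a::euclidean_space, 'l) tiling"
  assumes X: "X \<longlonglongrightarrow> T" shows "\<exists>v. conv X T v"
proof -
  obtain t where t: "t \<in> tiles T" "0 \<in> fst t" using tiles_cover by blast
  obtain a \<rho> where a: "ball a \<rho> \<subseteq> fst t" "\<rho> > 0"
    using ball_tile_interior_nonempty[OF tiles_ball_tile[OF t(1)]] mem_interior by blast
  \<comment> \<open>The bound \<open>\<rho>/2\<close> keeps two admissible shifts within the
    inradius of each other; the bound \<open>1/2\<close> keeps the shifted tile at the origin within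
    the ball of radius \<open>1 / e0\<close> that is compared.\<close>
  define e0 where "e0 = min (1/2) (\<rho>/2)"
  have e0: "e0 > 0" "e0 \<le> 1/2" "e0 \<le> \<rho>/2" using a by (auto simp: e0_def)
  define good where "good e n v \<longleftrightarrow> norm v < e \<and> cp (1/e) (X n) = cp (1/e) (tr v T)" for e n v
  have ev: "\<forall>\<^sub>F n in sequentially. \<exists>v. good e n v" if "e > 0" for e
    using eventually_close[OF X that] by (auto simp: close_eq good_def)
  have mono: "good e' n v" if "good e n v" "0 < e" "e \<le> e'" for e e' n v
  proof -
    have "1 / e' \<le> 1 / e" using that by (simp add: frac_le)
    with that show ?thesis
      unfolding good_def using cp_mono[of "1/e" "X n" "tr v T" "1/e'"] by linarith
  qed
  have uniq: "v = w" if "good e0 n v" "good e0 n w" for n v w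
  proof (rule tile_translates_eq[OF a(1), where T = "X n"])
    have *: "translate_tile u t \<in> tiles (X n)" if "good e0 n u" for u
    proof -
      have "translate_tile u t \<in> tiles (tr u T)" using t by simp
      moreover have "u + 0 \<in> fst (translate_tile u t)" using t by force
      moreover have "norm (u + 0) < 1 / e0"
        using that e0 mult_mono[of e0 "1/2" e0 "1/2"] by (simp add: good_def field_simps) (smt (verit) mult_less_cancel_left_disj)
      ultimately have "translate_tile u t \<in> cp (1/e0) (tr u T)" by (rule mem_cp)
      then show ?thesis using that cp_subset unfolding good_def by blast
    qed
    show "translate_tile v t \<in> tiles (X n)" "translate_tile w t \<in> tiles (X n)" using * that by auto
    show "norm (v - w) < \<rho>" using that e0 norm_triangle_ineq4[of v w] unfolding good_def by linarith
  qed
  define v where "v n = (SOME v. good e0 n v)" for n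
  have good_v: "\<forall>\<^sub>F n in sequentially. good e n (v n)" if "e > 0" for e
  proof -
    have "\<forall>\<^sub>F n in sequentially. \<exists>v. good (min e e0) n v" using ev that e0 by simp
    then show ?thesis
    proof eventually_elim
      case (elim n)
      then obtain w where w: "good (min e e0) n w" by blast
      then have "good e0 n w" using mono that e0 by (metis min.cobounded2 min_less_iff_conj)
      then have "v n = w" unfolding v_def using uniq by (metis someI)
      then show ?case using w mono that e0 by (metis min.cobounded1 min_less_iff_conj)
    qed
  qed
  have "conv X T v"
    unfolding conv_def
  proof
    show "v \<longlonglongrightarrow> 0"
    proof (rule tendstoI)
      fix e :: real assume "0 < e"
      from good_v[OF this] show "\<forall>\<^sub>F n in sequentially. dist (v n) 0 < e"
        by eventually_elim (simp add: good_def)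
    qed
    show "\<forall>r. \<forall>\<^sub>F n in sequentially. cp r (X n) = cp r (tr (v n) T)"
    proof
      fix r :: real
      define e where "e = 1 / max r 1"
      have "e > 0" "r \<le> 1 / e" by (auto simp: e_def)
      from good_v[OF this(1)] show "\<forall>\<^sub>F n in sequentially. cp r (X n) = cp r (tr (v n) T)"
      proof eventually_elim
        case (elim n)
        then have "cp (1/e) (X n) = cp (1/e) (tr (v n) T)" by (simp add: good_def)
        then show ?case using \<open>r \<le> 1 / e\<close> by (rule cp_mono)
      qed
    qed
  qed
  then show ?thesis by blast
qed


lemma conv_small:
  assumes "conv X T v" "e > 0"
  shows "\<forall>\<^sub>F n in sequentially. norm (v n) < e"
  using assms unfolding conv_def tendsto_iff by simp

lemma conv_agree:
  "conv X T v \<Longrightarrow> \<forall>\<^sub>F n in sequentially. cp r (X n) = cp r (tr (v n) T)"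
  by (simp add: conv_def)

lemma conv_tile:
  assumes "conv X T v" "t \<in> tiles T"
  shows "\<forall>\<^sub>F n in sequentially. translate_tile (v n) t \<in> tiles (X n)"
proof -
  obtain x where x: "x \<in> fst t" using ball_tile_nonempty[OF tiles_ball_tile[OF assms(2)]] by blast
  show ?thesis
    using conv_small[OF assms(1) zero_less_one] conv_agree[OF assms(1), of "norm x + 2"]
  proof eventually_elim
    case (elim n)
    have "translate_tile (v n) t \<in> tiles (tr (v n) T)" using assms(2) by simp
    moreover have "v n + x \<in> fst (translate_tile (v n) t)" using x by simp
    moreover have "norm (v n + x) < norm x + 2"
      using elim(1) norm_triangle_ineq[of "v n" x] by linarith
    ultimately have "translate_tile (v n) t \<in> cp (norm x + 2) (tr (v n) T)" by (rule mem_cp)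
    then show ?case using elim(2) cp_subset by blast
  qed
qed

lemma conv_patch:
  assumes "conv X T v" "P \<subseteq> tiles T" "finite P"
  shows "\<forall>\<^sub>F n in sequentially. translate (v n) P \<subseteq> tiles (X n)"
proof -
  have "\<forall>\<^sub>F n in sequentially. \<forall>t\<in>P. translate_tile (v n) t \<in> tiles (X n)"
    using assms conv_tile[OF assms(1)] by (intro eventually_ball_finite) auto
  then show ?thesis
    by eventually_elim (auto simp: translate_def)
qed

lemma conv_back:
  assumes "conv X T v"
  shows "\<forall>\<^sub>F n in sequentially. \<forall>t\<in>cp r (X n). translate_tile (- v n) t \<in> cp (r + 1) T"
  using conv_small[OF assms(1) zero_less_one] conv_agree[OF assms(1), of r]
proof eventually_elim
  case (elim n)
  show ?case
  proof
    fix t assume "t \<in> cp r (X n)"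
    then have t: "translate_tile (- v n) t \<in> tiles T" "fst t \<inter> ball 0 r \<noteq> {}"
      using elim(2) by (auto simp: central_patch_def mem_tiles_tr)
    then obtain x where x: "x \<in> fst t" "norm x < r" by auto
    show "translate_tile (- v n) t \<in> cp (r + 1) T"
      using t(1)
    proof (rule mem_cp)
      show "- v n + x \<in> fst (translate_tile (- v n) t)" using x by simp
      show "norm (- v n + x) < r + 1"
        using elim(1) x norm_triangle_ineq[of "- v n" x] by simp
    qed
  qed
qed

lemma conv_tr:
  assumes "conv X T v" "u \<longlonglongrightarrow> w"
  shows "conv (\<lambda>n. tr (u n) (X n)) (tr w T) (\<lambda>n. u n - w + v n)"
  unfolding conv_def
proof (intro conjI allI)
  have "(\<lambda>n. u n - w + v n) \<longlonglongrightarrow> w - w + 0"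
    using assms unfolding conv_def by (intro tendsto_intros) auto
  then show "(\<lambda>n. u n - w + v n) \<longlonglongrightarrow> 0" by simp
  fix r
  have "\<forall>\<^sub>F n in sequentially. norm (u n - w) < 1"
    using assms(2) tendstoD[of u w sequentially 1] by (simp add: dist_norm)
  then show "\<forall>\<^sub>F n in sequentially. cp r (tr (u n) (X n)) = cp r (tr (u n - w + v n) (tr w T))"
    using conv_agree[OF assms(1), of "r + norm w + 1"]
  proof eventually_elim
    case (elim n)
    have "norm (u n) \<le> norm w + 1"
      using elim(1) norm_triangle_ineq[of "u n - w" w] by simp
    then have "cp r (tr (u n) (X n)) = cp r (tr (u n) (tr (v n) T))"
      by (intro cp_tr[OF elim(2)]) simp
    then show ?case by simp
  qed
qed

lemma tendsto_tr:
  assumes "X \<longlonglongrightarrow> T" "u \<longlonglongrightarrow> w"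
  shows "(\<lambda>n. tr (u n) (X n)) \<longlonglongrightarrow> tr w T"
  using tendsto_imp_conv[OF assms(1)] conv_tr[OF _ assms(2)] conv_imp_tendsto by blast

lemma conv_agree_conv:
  assumes "conv X T v" "\<And>r. \<forall>\<^sub>F n in sequentially. cp r (X n) = cp r (Y n)"
  shows "conv Y T v"
  unfolding conv_def
proof (intro conjI allI)
  show "v \<longlonglongrightarrow> 0" using assms(1) by (simp add: conv_def)
  show "\<forall>\<^sub>F n in sequentially. cp r (Y n) = cp r (tr (v n) T)" for r
    using conv_agree[OF assms(1), of r] assms(2)[of r] by eventually_elim simp
qed

text \<open>The difference of the two shifts tends to 0 and eventually carries each tile of
  \<open>T'\<close> to a tile of \<open>T\<close>. By uniqueness of small shifts it is eventually
  constant, hence eventually 0.\<close>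

lemma tiling_LIMSEQ_unique_subset:
  assumes "conv X T v" "conv X T' w"
  shows "tiles T' \<subseteq> tiles T"
proof -
  define u where "u n = w n - v n" for n
  have mem: "\<forall>\<^sub>F n in sequentially. translate_tile (u n) t \<in> tiles T" if "t \<in> tiles T'" for t
  proof -
    obtain x where x: "x \<in> fst t" using ball_tile_nonempty[OF tiles_ball_tile[OF \<open>t \<in> tiles T'\<close>]] by blast
    show ?thesis
      using conv_small[OF assms(2) zero_less_one] conv_tile[OF assms(2) that] conv_back[OF assms(1), of "norm x + 1"]
    proof eventually_elim
      case (elim n)
      have "translate_tile (w n) t \<in> cp (norm x + 1) (X n)"
        using elim(2)
      proof (rule mem_cp)
        show "w n + x \<in> fst (translate_tile (w n) t)" using x by simp
        show "norm (w n + x) < norm x + 1"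
          using elim(1) norm_triangle_ineq[of "w n" x] by linarith
      qed
      with elim(3) have "translate_tile (- v n) (translate_tile (w n) t) \<in> tiles T"
        using cp_subset by blast
      then show ?case by (simp add: u_def)
    qed
  qed
  have u0: "u \<longlonglongrightarrow> 0"
    using assms tendsto_diff[of w 0 sequentially v 0] by (simp add: u_def[abs_def] conv_def)
  obtain t where t: "t \<in> tiles T'" using tiles_cover by blast
  obtain a \<rho> where a: "ball a \<rho> \<subseteq> fst t" "\<rho> > 0"
    using ball_tile_interior_nonempty[OF tiles_ball_tile[OF t]] mem_interior by blast
  have "\<forall>\<^sub>F n in sequentially. norm (u n) < \<rho> / 2"
    using a(2) tendstoD[OF u0, of "\<rho>/2"] by simp
  then have "\<forall>\<^sub>F n in sequentially. norm (u n) < \<rho> / 2 \<and> translate_tile (u n) t \<in> tiles T"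
    using mem[OF t] by eventually_elim simp
  then obtain N where N: "\<And>n. n \<ge> N \<Longrightarrow> norm (u n) < \<rho> / 2 \<and> translate_tile (u n) t \<in> tiles T"
    unfolding eventually_sequentially by blast
  have "u n = u N" if "n \<ge> N" for n
  proof (rule tile_translates_eq[OF a(1), where T = T])
    show "norm (u n - u N) < \<rho>"
      using N[OF that] N[of N] norm_triangle_ineq4[of "u n" "u N"] by simp
  qed (use N that in auto)
  then have "\<forall>\<^sub>F n in sequentially. u n = u N"
    unfolding eventually_sequentially by blast
  then have "u \<longlonglongrightarrow> u N"
    by (rule tendsto_eventually)
  then have "u N = 0" using u0 LIMSEQ_unique by blast
  show ?thesis
  proof
    fix s assume "s \<in> tiles T'"
    from mem[OF this] obtain M where M: "\<And>n. n \<ge> M \<Longrightarrow> translate_tile (u n) s \<in> tiles T"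
      unfolding eventually_sequentially by blast
    have "u (max M N) = 0" using \<open>\<And>n. n \<ge> N \<Longrightarrow> u n = u N\<close>[of "max M N"] \<open>u N = 0\<close> by simp
    then show "s \<in> tiles T" using M[of "max M N"] by simp
  qed
qed

lemma tiling_LIMSEQ_unique:
  fixes T T' :: "('a::euclidean_space, 'l) tiling"
  assumes "X \<longlonglongrightarrow> T" "X \<longlonglongrightarrow> T'"
  shows "T = T'"
proof -
  obtain v w where "conv X T v" "conv X T' w"
    using assms tendsto_imp_conv by blast
  then have "tiles T = tiles T'"
    using tiling_LIMSEQ_unique_subset by blast
  then show ?thesis by (simp add: tiles_inject)
qed

text \<open>A substitute for first countability, which is not available as a type class for the tilings
  and the covering space.\<close>

definition seq_nhds :: "'x::topological_space set \<Rightarrow> bool" where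
  "seq_nhds S \<longleftrightarrow> (\<forall>x\<in>S. \<forall>Q. (\<forall>X. X \<longlonglongrightarrow> x \<longrightarrow> (\<forall>n. X n \<in> S) \<longrightarrow> (\<forall>\<^sub>F n in sequentially. Q (X n)))
      \<longrightarrow> (\<exists>A. open A \<and> x \<in> A \<and> (\<forall>y\<in>S \<inter> A. Q y)))"

lemma seq_nhdsD:
  assumes "seq_nhds S" "x \<in> S"
    "\<And>X. X \<longlonglongrightarrow> x \<Longrightarrow> (\<And>n. X n \<in> S) \<Longrightarrow> \<forall>\<^sub>F n in sequentially. Q (X n)"
  obtains A where "open A" "x \<in> A" "\<And>y. y \<in> S \<Longrightarrow> y \<in> A \<Longrightarrow> Q y"
proof -
  have "\<exists>A. open A \<and> x \<in> A \<and> (\<forall>y\<in>S \<inter> A. Q y)"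
    using assms unfolding seq_nhds_def by simp
  with that show thesis by auto
qed

lemma seq_nhds_continuous_on:
  assumes "seq_nhds S" "\<And>x X. x \<in> S \<Longrightarrow> (\<And>n. X n \<in> S) \<Longrightarrow> X \<longlonglongrightarrow> x \<Longrightarrow> (\<lambda>n. f (X n)) \<longlonglongrightarrow> f x"
  shows "continuous_on S f"
  unfolding continuous_on_topological
proof (intro ballI allI impI)
  fix x B assume x: "x \<in> S" and B: "open B" "f x \<in> B"
  show "\<exists>A. open A \<and> x \<in> A \<and> (\<forall>y\<in>S. y \<in> A \<longrightarrow> f y \<in> B)"
  proof (rule seq_nhdsD[OF assms(1) x, where Q = "\<lambda>y. f y \<in> B"])
    fix X assume "X \<longlonglongrightarrow> x" "\<And>n. X n \<in> S"
    from assms(2)[OF x this(2,1)] B show "\<forall>\<^sub>F n in sequentially. f (X n) \<in> B"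
      by (rule topological_tendstoD)
  qed blast
qed

lemma seq_nhds_closure:
  assumes "seq_nhds S" "x \<in> S" "B \<subseteq> S" "x \<in> closure B"
  shows "\<exists>X. (\<forall>n. X n \<in> B) \<and> X \<longlonglongrightarrow> x"
proof (rule ccontr)
  assume neg: "\<not> ?thesis"
  obtain A where A: "open A" "x \<in> A" "\<And>y. y \<in> S \<Longrightarrow> y \<in> A \<Longrightarrow> y \<notin> B"
  proof (rule seq_nhdsD[OF assms(1,2), where Q = "\<lambda>y. y \<notin> B"])
    fix X assume X: "X \<longlonglongrightarrow> x" "\<And>n. X n \<in> S"
    show "\<forall>\<^sub>F n in sequentially. X n \<notin> B"
    proof (rule ccontr)
      assume "\<not> (\<forall>\<^sub>F n in sequentially. X n \<notin> B)"
      then have inf: "infinite {n. X n \<in> B}"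
        by (simp add: cofinite_eq_sequentially[symmetric] eventually_cofinite)
      have lim: "(X \<circ> enumerate {n. X n \<in> B}) \<longlonglongrightarrow> x"
        using X(1) strict_mono_enumerate[OF inf] by (rule LIMSEQ_subseq_LIMSEQ)
      have "(X \<circ> enumerate {n. X n \<in> B}) n \<in> B" for n
        using enumerate_in_set[OF inf, of n] by simp
      with lim neg show False by blast
    qed
  qed (rule that)
  then have "A \<inter> B = {}" using assms(3) by blast
  then have "A \<inter> closure B = {}" using A(1) by (simp add: open_Int_closure_eq_empty)
  then show False using A(2) assms(4) by blast
qed

lemma seq_nhds_tilings: "seq_nhds (S :: ('a::euclidean_space, 'l) tiling set)"
  unfolding seq_nhds_def
proof (intro ballI allI impI, rule ccontr)
  fix T Q
  assume Q: "\<forall>X. X \<longlonglongrightarrow> T \<longrightarrow> (\<forall>n. X n \<in> S) \<longrightarrow> (\<forall>\<^sub>F n in sequentially. Q (X n))"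
    and neg: "\<nexists>A. open A \<and> T \<in> A \<and> (\<forall>y\<in>S \<inter> A. Q y)"
  have "\<exists>T'. T' \<in> S \<and> close (1 / real (Suc n)) T T' \<and> \<not> Q T'" for n
  proof -
    have "1 / real (Suc n) > 0" by simp
    from open_nhd_close[OF this]
    obtain U where U: "open U" "T \<in> U" "\<And>T'. T' \<in> U \<Longrightarrow> close (1 / real (Suc n)) T T'"
      by metis
    show ?thesis
    proof (rule ccontr)
      assume "\<not> ?thesis"
      then have "\<forall>y\<in>S \<inter> U. Q y" using U(3) by blast
      then show False using U(1,2) neg by blast
    qed
  qed
  then obtain X where X: "\<And>n. X n \<in> S \<and> close (1 / real (Suc n)) T (X n) \<and> \<not> Q (X n)"
    by metis
  have "X \<longlonglongrightarrow> T"
  proof (rule tendsto_closeI)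
    fix e :: real assume "e > 0"
    then obtain N where N: "1 / real (Suc N) < e" using nat_approx_posE by blast
    have "close e T (X n)" if "n \<ge> N" for n
    proof (rule close_mono)
      show "close (1 / real (Suc n)) T (X n)" using X by blast
      have "1 / real (Suc n) \<le> 1 / real (Suc N)" using that by (intro divide_left_mono) auto
      then show "1 / real (Suc n) \<le> e" using N by linarith
    qed simp
    then show "\<forall>\<^sub>F n in sequentially. close e T (X n)"
      unfolding eventually_sequentially by blast
  qed
  then have "\<forall>\<^sub>F n in sequentially. Q (X n)" using Q X by blast
  then have "\<forall>\<^sub>F n::nat in sequentially. False" using X by simp
  then show False by simp
qed

section \<open>Compactness of tiling spaces\<close>

lemma constant_subseq:
  assumes "finite S" "\<And>n::nat. f n \<in> S"
  obtains r :: "nat \<Rightarrow> nat" and y where "strict_mono r" "y \<in> S" "\<forall>n. f (r n) = y"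
proof -
  have "finite (range f)"
    using assms by (meson finite_subset image_subsetI)
  from pigeonhole_infinite[OF infinite_UNIV_nat this]
  obtain a :: nat where inf: "infinite {n. f n = f a}" by auto
  have "f (enumerate {n. f n = f a} n) = f a" for n
    using enumerate_in_set[OF inf, of n] by simp
  with strict_mono_enumerate[OF inf] assms(2) show ?thesis
    by (intro that[of "enumerate {n. f n = f a}" "f a"]) auto
qed

lemma seq_compactD:
  assumes "seq_compact S" "\<And>n. X n \<in> S"
  obtains l r where "l \<in> S" "strict_mono (r :: nat \<Rightarrow> nat)" "(X \<circ> r) \<longlonglongrightarrow> l"
  using assms unfolding seq_compact_def by metis

lemma finite_of_fibres:
  assumes "finite (f ` A)" "\<And>x. x \<in> A \<Longrightarrow> finite {y \<in> A. f y = f x}"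
  shows "finite A"
proof -
  have "finite (\<Union>z\<in>f ` A. {y \<in> A. f y = z})"
    using assms by (intro finite_UN_I) auto
  then show ?thesis by (rule rev_finite_subset) auto
qed

lemma supportE:
  assumes "x \<in> support P"
  obtains t where "t \<in> P" "x \<in> fst t"
  using assms unfolding support_def by (elim UN_E) (rule that)

lemma range_translate: "range (\<lambda>u. translate u (translate v P)) = range (\<lambda>u. translate u P)"
proof
  show "range (\<lambda>u. translate u (translate v P)) \<subseteq> range (\<lambda>u. translate u P)"
    by auto
  show "range (\<lambda>u. translate u P) \<subseteq> range (\<lambda>u. translate u (translate v P))"
  proof
    fix Q assume "Q \<in> range (\<lambda>u. translate u P)"
    then obtain u where "Q = translate (u - v) (translate v P)" by auto
    then show "Q \<in> range (\<lambda>u. translate u (translate v P))" by (rule range_eqI)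
  qed
qed

locale flc_hull =
  fixes T0 :: "('a::euclidean_space, 'l) tiling" and \<Omega> :: "('a, 'l) tiling set"
  assumes flc: "finite_local_complexity T0" and Omega_eq: "\<Omega> = tiling_hull T0"
begin

lemma OmegaD:
  assumes "T \<in> \<Omega>" "P \<subseteq> tiles T" "finite P"
  obtains v where "translate v P \<subseteq> tiles T0"
  using assms unfolding Omega_eq tiling_hull_def by blast

lemma OmegaI:
  assumes "\<And>P. P \<subseteq> tiles T \<Longrightarrow> finite P \<Longrightarrow> \<exists>v. translate v P \<subseteq> tiles T0"
  shows "T \<in> \<Omega>"
  using assms unfolding Omega_eq tiling_hull_def by blast

lemma T0_mem: "T0 \<in> \<Omega>"
  by (rule OmegaI) (metis translate_0)

lemma tr_mem [simp]: "tr v T \<in> \<Omega> \<longleftrightarrow> T \<in> \<Omega>"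
proof -
  have *: "tr v T \<in> \<Omega>" if "T \<in> \<Omega>" for v T
  proof (rule OmegaI)
    fix P assume "P \<subseteq> tiles (tr v T)" "finite P"
    then have "translate (- v) P \<subseteq> tiles T" "finite (translate (- v) P)"
      by (simp_all add: translate_subset_iff tiles_tr)
    from OmegaD[OF that this] obtain w where "translate w (translate (- v) P) \<subseteq> tiles T0" .
    then show "\<exists>v. translate v P \<subseteq> tiles T0" by auto
  qed
  show ?thesis
  proof
    assume "tr v T \<in> \<Omega>"
    from *[OF this, of "- v"] show "T \<in> \<Omega>" by simp
  qed (rule *)
qed

lemma tile_in_T0:
  assumes "T \<in> \<Omega>" "t \<in> tiles T"
  obtains v where "translate_tile v t \<in> tiles T0"
proof -
  obtain v where "translate v {t} \<subseteq> tiles T0"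
    using OmegaD[OF assms(1), of "{t}"] assms(2) by auto
  then show thesis using that by (simp add: translate_def)
qed

lemma prototiles:
  "\<exists>K. finite K \<and> K \<subseteq> tiles T0 \<and> (\<forall>T\<in>\<Omega>. \<forall>t\<in>tiles T. \<exists>s\<in>K. \<exists>v. t = translate_tile v s)"
proof -
  let ?c = "\<lambda>t. range (\<lambda>v. translate_tile v t)"
  have "finite (?c ` tiles T0)"
    using flc by (simp add: finite_local_complexity_def)
  from finite_subset_image[OF this subset_refl]
  obtain K where K: "K \<subseteq> tiles T0" "finite K" "?c ` tiles T0 = ?c ` K" by blast
  have "\<exists>s\<in>K. \<exists>v. t = translate_tile v s" if t: "T \<in> \<Omega>" "t \<in> tiles T" for T t
  proof -
    obtain v where "translate_tile v t \<in> tiles T0" using tile_in_T0[OF t] .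
    then have "?c (translate_tile v t) \<in> ?c ` K" using K(3) by blast
    then obtain s where s: "s \<in> K" "?c (translate_tile v t) = ?c s" by auto
    have "translate_tile (- v) (translate_tile v t) \<in> ?c (translate_tile v t)" by blast
    then have "t \<in> ?c s" unfolding s(2)[symmetric] by simp
    with s(1) show ?thesis by blast
  qed
  then show ?thesis
    using K(1,2) by (intro exI[of _ K] conjI ballI) simp_all
qed

lemma tile_bound:
  "\<exists>D>0. \<forall>T\<in>\<Omega>. \<forall>t\<in>tiles T. \<forall>x\<in>fst t. \<forall>y\<in>fst t. norm (x - y) \<le> D"
proof -
  obtain K where K: "finite K" "K \<subseteq> tiles T0"
    "\<forall>T\<in>\<Omega>. \<forall>t\<in>tiles T. \<exists>s\<in>K. \<exists>v. t = translate_tile v s"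
    using prototiles by blast
  have "bounded (\<Union>s\<in>K. fst s)"
    using K by (intro bounded_UN) (auto intro!: compact_imp_bounded ball_tile_compact tiles_ball_tile)
  then obtain B where B: "\<And>x. x \<in> (\<Union>s\<in>K. fst s) \<Longrightarrow> norm x \<le> B"
    unfolding bounded_iff by blast
  show ?thesis
  proof (intro exI[of _ "2 * \<bar>B\<bar> + 1"] conjI ballI)
    show "2 * \<bar>B\<bar> + 1 > 0" by simp
    fix T t x y assume "T \<in> \<Omega>" "t \<in> tiles T" and xy: "x \<in> fst t" "y \<in> fst t"
    then obtain s v where s: "s \<in> K" "t = translate_tile v s" using K(3) by blast
    obtain x' y' where xy': "x' \<in> fst s" "y' \<in> fst s" "x = v + x'" "y = v + y'"
      using xy s(2) by auto
    then have "norm x' \<le> B" "norm y' \<le> B" using B s(1) by auto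
    moreover have "norm (x - y) \<le> norm x' + norm y'"
      using xy' norm_triangle_ineq4[of x' y'] by simp
    ultimately show "norm (x - y) \<le> 2 * \<bar>B\<bar> + 1" by linarith
  qed
qed

lemma tile_inradius:
  "\<exists>\<rho>>0. \<forall>T\<in>\<Omega>. \<forall>t\<in>tiles T. \<exists>a. ball a \<rho> \<subseteq> fst t"
proof -
  obtain K where K: "finite K" "K \<subseteq> tiles T0"
    "\<forall>T\<in>\<Omega>. \<forall>t\<in>tiles T. \<exists>s\<in>K. \<exists>v. t = translate_tile v s"
    using prototiles by blast
  have "\<forall>s\<in>K. \<exists>\<rho>>0. \<exists>a. ball a \<rho> \<subseteq> fst s"
  proof
    fix s assume "s \<in> K"
    then have "interior (fst s) \<noteq> {}"
      using K(2) by (intro ball_tile_interior_nonempty tiles_ball_tile) auto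
    then obtain a where "a \<in> interior (fst s)" by blast
    then show "\<exists>\<rho>>0. \<exists>a. ball a \<rho> \<subseteq> fst s"
      unfolding mem_interior by blast
  qed
  then obtain \<rho> where \<rho>: "\<And>s. s \<in> K \<Longrightarrow> \<rho> s > 0 \<and> (\<exists>a. ball a (\<rho> s) \<subseteq> fst s)"
    by metis
  show ?thesis
  proof (intro exI[of _ "Min (insert 1 (\<rho> ` K))"] conjI ballI)
    show "Min (insert 1 (\<rho> ` K)) > 0" using K(1) \<rho> by simp
    fix T t assume "T \<in> \<Omega>" "t \<in> tiles T"
    then obtain s v where s: "s \<in> K" "t = translate_tile v s" using K(3) by blast
    obtain a where "ball a (\<rho> s) \<subseteq> fst s" using \<rho>[OF s(1)] by blast
    moreover have "Min (insert 1 (\<rho> ` K)) \<le> \<rho> s" using K(1) s(1) by (intro Min_le) auto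
    ultimately have "ball a (Min (insert 1 (\<rho> ` K))) \<subseteq> fst s"
      using subset_ball by blast
    then have "(+) v ` ball a (Min (insert 1 (\<rho> ` K))) \<subseteq> fst t"
      unfolding s(2) fst_translate_tile by (rule image_mono)
    then show "\<exists>a. ball a (Min (insert 1 (\<rho> ` K))) \<subseteq> fst t"
      unfolding plus_image_ball by blast
  qed
qed

text \<open>Each tile contains a ball of one fixed radius \<open>\<rho>\<close>. The centres of
  these balls are uniformly separated, and for tiles meeting a given ball they stay bounded.\<close>

lemma finite_cp [simp]:
  assumes "T \<in> \<Omega>"
  shows "finite (cp r T)"
proof -
  obtain D where D: "D > 0" "\<forall>T\<in>\<Omega>. \<forall>t\<in>tiles T. \<forall>x\<in>fst t. \<forall>y\<in>fst t. norm (x - y) \<le> D"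
    using tile_bound by blast
  obtain \<rho> where \<rho>: "\<rho> > 0" "\<forall>T\<in>\<Omega>. \<forall>t\<in>tiles T. \<exists>a. ball a \<rho> \<subseteq> fst t"
    using tile_inradius by blast
  obtain a where a: "\<And>t. t \<in> tiles T \<Longrightarrow> ball (a t) \<rho> \<subseteq> fst t"
    using \<rho>(2) assms by metis
  have eq: "s = t" if "s \<in> tiles T" "t \<in> tiles T" "dist (a s) (a t) < \<rho>" for s t
  proof (rule tiles_eqI[OF that(1,2)])
    have sub: "ball (a u) \<rho> \<subseteq> interior (fst u)" if "u \<in> tiles T" for u
      using a[OF that] by (intro interior_maximal) auto
    have "a t \<in> ball (a s) \<rho>" "a t \<in> ball (a t) \<rho>" using that(3) \<rho>(1) by auto
    then show "interior (fst s) \<inter> interior (fst t) \<noteq> {}"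
      using sub[OF that(1)] sub[OF that(2)] by blast
  qed
  have "uniform_discrete (a ` cp r T) \<and> bounded (a ` cp r T)"
  proof
    show "uniform_discrete (a ` cp r T)"
      unfolding uniform_discrete_def
    proof (intro exI[of _ \<rho>] conjI ballI impI)
      fix x y assume "x \<in> a ` cp r T" "y \<in> a ` cp r T" "dist x y < \<rho>"
      then obtain s t where "s \<in> cp r T" "t \<in> cp r T" "x = a s" "y = a t" "dist (a s) (a t) < \<rho>"
        by auto
      then show "x = y" using eq[of s t] cp_subset[of r T] by auto
    qed (rule \<rho>(1))
    show "bounded (a ` cp r T)"
      unfolding bounded_iff
    proof (intro exI[of _ "r + D"] ballI)
      fix x assume "x \<in> a ` cp r T"
      then obtain t where t: "t \<in> tiles T" "fst t \<inter> ball 0 r \<noteq> {}" "x = a t"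
        by (auto simp: central_patch_def)
      then obtain y where y: "y \<in> fst t" "norm y < r" by auto
      have "x \<in> fst t" using a[OF t(1)] \<rho>(1) t(3) by auto
      then have "norm (x - y) \<le> D" using D(2) assms t(1) y by blast
      then show "norm x \<le> r + D" using y norm_triangle_ineq2[of x y] by linarith
    qed
  qed
  then have "finite (a ` cp r T)" by (simp add: uniform_discrete_finite_iff)
  moreover have "inj_on a (cp r T)"
  proof (rule inj_onI)
    fix s t assume "s \<in> cp r T" "t \<in> cp r T" "a s = a t"
    then show "s = t" using eq[of s t] \<rho>(1) cp_subset[of r T] by auto
  qed
  ultimately show ?thesis by (rule finite_imageD)
qed

text \<open>Finite local complexity counts patches up to translation. Fixing one tile
  \<open>t\<close> in place removes the translations and leaves finitely many actual
  patches.\<close>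

lemma finite_patches_at:
  shows "finite {cp r T | T. T \<in> \<Omega> \<and> t \<in> tiles T}"
proof (cases "\<exists>T\<in>\<Omega>. t \<in> tiles T")
  case True
  then have bt: "ball_tile t" using tiles_ball_tile by blast
  then obtain y where y: "y \<in> fst t" using ball_tile_nonempty by blast
  obtain D where D: "D > 0" "\<forall>T\<in>\<Omega>. \<forall>t\<in>tiles T. \<forall>x\<in>fst t. \<forall>y\<in>fst t. norm (x - y) \<le> D"
    using tile_bound by blast
  let ?c = "\<lambda>P. range (\<lambda>v. translate v P)"
  \<comment> \<open>Inserting \<open>t\<close> makes every patch of the family contain
    \<open>t\<close>, even when \<open>t\<close> does not meet the ball of radius
    \<open>r\<close>.\<close>
  define A where "A = {insert t (cp r T) | T. T \<in> \<Omega> \<and> t \<in> tiles T}"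
  define B where "B = \<bar>r\<bar> + norm y + D"
  have "?c ` A \<subseteq> ?c ` {P. P \<subseteq> tiles T0 \<and> finite P \<and> diameter (support P) \<le> 2 * B}"
  proof
    fix c assume "c \<in> ?c ` A"
    then obtain T where T: "T \<in> \<Omega>" "t \<in> tiles T" "c = ?c (insert t (cp r T))" unfolding A_def by auto
    let ?P = "insert t (cp r T)"
    have P: "?P \<subseteq> tiles T" "finite ?P" using T cp_subset by auto
    obtain v where v: "translate v ?P \<subseteq> tiles T0" using OmegaD[OF T(1) P] .
    have le: "norm x \<le> B" if "x \<in> support ?P" for x
    proof -
      from \<open>x \<in> support ?P\<close> obtain s where s: "s \<in> ?P" "x \<in> fst s" by (rule supportE)
      have "\<exists>z\<in>fst s. norm z \<le> \<bar>r\<bar> + norm y"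
      proof (cases "s = t")
        case True then show ?thesis using y by (intro bexI[of _ y]) auto
      next
        case False
        then obtain z where "z \<in> fst s" "norm z < r" using s by (auto simp: central_patch_def)
        then show ?thesis by (intro bexI[of _ z]) (use norm_ge_zero[of y] in linarith, auto)
      qed
      then obtain z where z: "z \<in> fst s" "norm z \<le> \<bar>r\<bar> + norm y" by blast
      have "norm (x - z) \<le> D" using D(2) T(1) s z P(1) by blast
      then show ?thesis unfolding B_def using z norm_triangle_ineq2[of x z] by linarith
    qed
    have "diameter (support (translate v ?P)) \<le> 2 * B"
    proof (rule diameter_le)
      show "support (translate v ?P) \<noteq> {} \<or> 0 \<le> 2 * B" unfolding B_def using D(1) by simp
      fix x x' assume "x \<in> support (translate v ?P)" "x' \<in> support (translate v ?P)"
      then obtain z z' where "z \<in> support ?P" "x = v + z" "z' \<in> support ?P" "x' = v + z'"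
        unfolding support_translate by (elim imageE) (rule that)
      then show "norm (x - x') \<le> 2 * B"
        using le[of z] le[of z'] norm_triangle_ineq4[of z z'] by simp
    qed
    moreover have "c = ?c (translate v ?P)"
      unfolding T(3) by (rule range_translate[symmetric])
    ultimately show "c \<in> ?c ` {P. P \<subseteq> tiles T0 \<and> finite P \<and> diameter (support P) \<le> 2 * B}"
      using v P(2) by (intro image_eqI[of _ _ "translate v ?P"] CollectI conjI) simp_all
  qed
  moreover have "finite (?c ` {P. P \<subseteq> tiles T0 \<and> finite P \<and> diameter (support P) \<le> 2 * B})"
    using flc by (simp add: finite_local_complexity_def)
  ultimately have "finite (?c ` A)" by (rule finite_subset)
  then have "finite A"
  proof (rule finite_of_fibres)
    fix P assume P: "P \<in> A"
    then have fP: "finite P" unfolding A_def by auto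
    \<comment> \<open>A translate of \<open>P\<close> that contains \<open>t\<close> is determined
      by the tile of \<open>P\<close> that is moved to \<open>t\<close>, and \<open>P\<close> is
      finite.\<close>
    have "{P' \<in> A. ?c P' = ?c P} \<subseteq> (\<lambda>s. translate (THE v. translate_tile v s = t) P) ` P"
    proof
      fix P' assume "P' \<in> {P' \<in> A. ?c P' = ?c P}"
      then have P': "P' \<in> A" "?c P' = ?c P" by auto
      have "translate 0 P' \<in> ?c P'" by blast
      then obtain v where v: "P' = translate v P" unfolding P'(2) by auto
      have "t \<in> P'" using P'(1) unfolding A_def by blast
      then have s: "translate_tile (- v) t \<in> P" unfolding v mem_translate .
      have "(THE u. translate_tile u (translate_tile (- v) t) = t) = v"
      proof (rule the_equality)
        fix u assume "translate_tile u (translate_tile (- v) t) = t"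
        then have "translate_tile (u - v) t = translate_tile 0 t" by simp
        then have "u - v = 0" by (simp only: translate_tile_eq_iff[OF bt])
        then show "u = v" by simp
      qed simp
      then show "P' \<in> (\<lambda>s. translate (THE v. translate_tile v s = t) P) ` P"
        using s v by (intro image_eqI[of _ _ "translate_tile (- v) t"]) auto
    qed
    then show "finite {P' \<in> A. ?c P' = ?c P}" using fP by (meson finite_imageI finite_subset)
  qed
  have "{cp r T | T. T \<in> \<Omega> \<and> t \<in> tiles T} \<subseteq> (\<lambda>P. {s \<in> P. fst s \<inter> ball 0 r \<noteq> {}}) ` A"
  proof
    fix Q assume "Q \<in> {cp r T | T. T \<in> \<Omega> \<and> t \<in> tiles T}"
    then obtain T where T: "Q = cp r T" "T \<in> \<Omega>" "t \<in> tiles T" by blast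
    have "Q = {s \<in> insert t (cp r T). fst s \<inter> ball 0 r \<noteq> {}}"
      unfolding T(1) central_patch_def using T(3) by blast
    moreover have "insert t (cp r T) \<in> A" unfolding A_def using T by blast
    ultimately show "Q \<in> (\<lambda>P. {s \<in> P. fst s \<inter> ball 0 r \<noteq> {}}) ` A" by blast
  qed
  then show ?thesis using \<open>finite A\<close> by (meson finite_imageI finite_subset)
next
  case False
  then have "{cp r T | T. T \<in> \<Omega> \<and> t \<in> tiles T} = {}" by blast
  then show ?thesis by (simp only: finite.emptyI)
qed

text \<open>A diagonal argument: along one subsequence the patch of each radius is eventually
  constant, because only finitely many patches are compatible with \<open>t\<close>. The limit
  collects the tiles that eventually belong to all members.\<close>

lemma seq_compact_Omega_at:
  assumes Y: "\<And>n. Y n \<in> \<Omega>" "\<And>n. t \<in> tiles (Y n)"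
  obtains q T where "strict_mono (q :: nat \<Rightarrow> nat)" "T \<in> \<Omega>" "(Y \<circ> q) \<longlonglongrightarrow> T"
proof -
  define P where "P m q \<longleftrightarrow> (\<exists>Z. \<forall>i. cp (real m) (Y (q i)) = Z)" for m :: nat and q :: "nat \<Rightarrow> nat"
  interpret subseqs P
  proof
    fix m and s :: "nat \<Rightarrow> nat" assume "strict_mono s"
    let ?S = "{cp (real m) T | T. T \<in> \<Omega> \<and> t \<in> tiles T}"
    have mem: "\<And>i. cp (real m) (Y (s i)) \<in> ?S" using Y by blast
    obtain r :: "nat \<Rightarrow> nat" and Z where "strict_mono r" "Z \<in> ?S" "\<forall>i. cp (real m) (Y (s (r i))) = Z"
      using constant_subseq[where f = "\<lambda>i. cp (real m) (Y (s i))", OF finite_patches_at mem] .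
    then show "\<exists>r'. strict_mono r' \<and> P m (s \<circ> r')"
      unfolding P_def o_def by (intro exI[of _ r] conjI exI[of _ Z])
  qed
  define q where "q = diagseq"
  have q: "strict_mono q" unfolding q_def by (rule subseq_diagseq)
  have "\<exists>Z. \<forall>\<^sub>F i in sequentially. cp (real m) (Y (q i)) = Z" for m
  proof -
    have "P m (diagseq \<circ> (+) (Suc m))"
      by (rule diagseq_holds) (auto simp: P_def)
    then obtain Z where Z: "\<And>i. cp (real m) (Y (q (Suc m + i))) = Z"
      unfolding P_def q_def by auto
    have "cp (real m) (Y (q i)) = Z" if "i \<ge> Suc m" for i
      using Z[of "i - Suc m"] that by simp
    then show ?thesis unfolding eventually_sequentially by blast
  qed
  then obtain Z where Z: "\<And>m. \<forall>\<^sub>F i in sequentially. cp (real m) (Y (q i)) = Z m" by metis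
  define TT where "TT = {u. \<forall>\<^sub>F i in sequentially. u \<in> tiles (Y (q i))}"
  have ZTT: "Z m \<subseteq> TT" for m
  proof
    fix u assume "u \<in> Z m"
    from Z[of m] have "\<forall>\<^sub>F i in sequentially. u \<in> tiles (Y (q i))"
    proof eventually_elim
      case (elim i)
      then show ?case using \<open>u \<in> Z m\<close> cp_subset by blast
    qed
    then show "u \<in> TT" by (simp add: TT_def)
  qed
  have TTfin: "\<exists>i. P \<subseteq> tiles (Y (q i))" if "P \<subseteq> TT" "finite P" for P
  proof -
    have "\<forall>\<^sub>F i in sequentially. \<forall>u\<in>P. u \<in> tiles (Y (q i))"
      using that unfolding TT_def by (intro eventually_ball_finite) auto
    then obtain i where "\<forall>u\<in>P. u \<in> tiles (Y (q i))"
      unfolding eventually_sequentially by blast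
    then show ?thesis by blast
  qed
  have "is_tiling TT"
    unfolding is_tiling_def
  proof (intro conjI ballI)
    fix u assume "u \<in> TT"
    then obtain i where "u \<in> tiles (Y (q i))" using TTfin[of "{u}"] by auto
    then show "ball_tile u" by (rule tiles_ball_tile)
  next
    show "disjoint_interiors TT"
      unfolding disjoint_interiors_def
    proof (rule pairwiseI)
      fix s u assume su: "s \<in> TT" "u \<in> TT" "s \<noteq> u"
      then obtain i where "{s, u} \<subseteq> tiles (Y (q i))" using TTfin[of "{s, u}"] by auto
      then show "interior (fst s) \<inter> interior (fst u) = {}"
        using tiles_eqI[of s "Y (q i)" u] su(3) by blast
    qed
  next
    have "x \<in> support TT" for x
    proof -
      obtain m :: nat where m: "norm x < real m" using reals_Archimedean2 by blast
      obtain i where i: "cp (real m) (Y (q i)) = Z m"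
        using Z[of m] unfolding eventually_sequentially by blast
      have "x \<in> ball 0 (real m)" using m by simp
      then have "x \<in> support (cp (real m) (Y (q i)))" using cp_support by (rule rev_subsetD)
      then show ?thesis unfolding i using support_mono[OF ZTT] by blast
    qed
    then show "support TT = UNIV" by blast
  qed
  then obtain T where T: "tiles T = TT" using Tiling_inverse by blast
  have "T \<in> \<Omega>"
  proof (rule OmegaI)
    fix P assume "P \<subseteq> tiles T" "finite P"
    then obtain i where "P \<subseteq> tiles (Y (q i))" using TTfin T by blast
    then show "\<exists>v. translate v P \<subseteq> tiles T0"
      using OmegaD[OF Y(1) _ \<open>finite P\<close>] by blast
  qed
  have cpT: "cp (real m) T = Z m" for m
  proof
    show "cp (real m) T \<subseteq> Z m"
    proof
      fix u assume u: "u \<in> cp (real m) T"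
      then have "\<forall>\<^sub>F i in sequentially. u \<in> tiles (Y (q i))"
        using T by (auto simp: central_patch_def TT_def)
      then have "\<forall>\<^sub>F i in sequentially. u \<in> Z m"
        using Z[of m] by eventually_elim (use u in \<open>auto simp: central_patch_def\<close>)
      then show "u \<in> Z m" by simp
    qed
    obtain i where i: "cp (real m) (Y (q i)) = Z m"
      using Z[of m] unfolding eventually_sequentially by blast
    show "Z m \<subseteq> cp (real m) T"
      using ZTT[of m] i T by (auto simp: central_patch_def)
  qed
  have "conv (Y \<circ> q) T (\<lambda>_. 0)"
    unfolding conv_def
  proof (intro conjI allI)
    fix r :: real
    obtain m :: nat where m: "r \<le> real m" using real_arch_simple by blast
    from Z[of m] show "\<forall>\<^sub>F n in sequentially. cp r ((Y \<circ> q) n) = cp r (tr 0 T)"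
    proof eventually_elim
      case (elim n)
      then have "cp (real m) (Y (q n)) = cp (real m) T" using cpT by simp
      then have "cp r (Y (q n)) = cp r T" using m by (rule cp_mono)
      then show ?case by simp
    qed
  qed simp
  from that[OF q \<open>T \<in> \<Omega>\<close> conv_imp_tendsto[OF this]] show thesis .
qed

text \<open>Up to a subsequence the tile over the origin is a translate of one prototile. Its
  position varies in a compact set, so the tilings can be shifted to share this tile and shifted
  back by a convergent sequence.\<close>

lemma seq_compact_Omega: "seq_compact \<Omega>"
proof (rule seq_compactI)
  fix X :: "nat \<Rightarrow> ('a, 'l) tiling" assume X: "\<forall>n. X n \<in> \<Omega>"
  obtain K where K: "finite K" "K \<subseteq> tiles T0"
    "\<forall>T\<in>\<Omega>. \<forall>t\<in>tiles T. \<exists>s\<in>K. \<exists>v. t = translate_tile v s"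
    using prototiles by blast
  have "\<exists>s v. s \<in> K \<and> translate_tile v s \<in> tiles (X n) \<and> - v \<in> fst s" for n
  proof -
    obtain t where t: "t \<in> tiles (X n)" "0 \<in> fst t" using tiles_cover by blast
    then obtain s v where s: "s \<in> K" "t = translate_tile v s" using K(3) X by blast
    then obtain y where "y \<in> fst s" "0 = v + y" using t(2) by auto
    then have "- v \<in> fst s" by (simp add: add_eq_0_iff)
    then show ?thesis using s t by blast
  qed
  then obtain s w where sw: "\<And>n. s n \<in> K" "\<And>n. translate_tile (w n) (s n) \<in> tiles (X n)" "\<And>n. - w n \<in> fst (s n)"
    by metis
  obtain r1 :: "nat \<Rightarrow> nat" and t where r1: "strict_mono r1" "t \<in> K" "\<forall>n. s (r1 n) = t"
    using constant_subseq[OF K(1) sw(1)] .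
  have "compact (fst t)" using r1(2) K(2) by (intro ball_tile_compact tiles_ball_tile) auto
  then have "seq_compact (fst t)" by (rule compact_imp_seq_compact)
  moreover have "- w (r1 n) \<in> fst t" for n using sw(3)[of "r1 n"] r1(3) by simp
  ultimately obtain l r2 where "l \<in> fst t" and r2: "strict_mono (r2 :: nat \<Rightarrow> nat)" "((\<lambda>n. - w (r1 n)) \<circ> r2) \<longlonglongrightarrow> l"
    by (rule seq_compactD)
  define Y where "Y n = tr (- w (r1 (r2 n))) (X (r1 (r2 n)))" for n
  have Y1: "Y n \<in> \<Omega>" for n using X by (simp add: Y_def)
  have Y2: "t \<in> tiles (Y n)" for n
    using sw(2)[of "r1 (r2 n)"] r1(3) by (simp add: Y_def mem_tiles_tr)
  obtain q T where q: "strict_mono (q :: nat \<Rightarrow> nat)" "T \<in> \<Omega>" "(Y \<circ> q) \<longlonglongrightarrow> T"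
    using seq_compact_Omega_at[OF Y1 Y2] .
  have "(\<lambda>n. w (r1 (r2 n))) \<longlonglongrightarrow> - l"
    using tendsto_minus[OF r2(2)] by simp
  then have "((\<lambda>n. w (r1 (r2 n))) \<circ> q) \<longlonglongrightarrow> - l"
    using q(1) by (rule LIMSEQ_subseq_LIMSEQ)
  from tendsto_tr[OF q(3) this]
  have "(X \<circ> (r1 \<circ> r2 \<circ> q)) \<longlonglongrightarrow> tr (- l) T"
    by (simp add: Y_def o_def)
  moreover have "strict_mono (r1 \<circ> r2 \<circ> q)" using r1(1) r2(1) q(1) by (intro strict_mono_o)
  moreover have "tr (- l) T \<in> \<Omega>" using q(2) by simp
  ultimately show "\<exists>l\<in>\<Omega>. \<exists>r. strict_mono r \<and> (X \<circ> r) \<longlonglongrightarrow> l" by blast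
qed

text \<open>Limits of pairs of disjoint tiles that come arbitrarily close would be disjoint tiles of
  a single tiling with a common point.\<close>

lemma touching_distance:
  "\<exists>\<epsilon>>0. \<forall>T\<in>\<Omega>. \<forall>s\<in>tiles T. \<forall>t\<in>tiles T. \<forall>x\<in>fst s. \<forall>y\<in>fst t. norm (x - y) < \<epsilon> \<longrightarrow> fst s \<inter> fst t \<noteq> {}"
proof (rule ccontr)
  assume neg: "\<not> ?thesis"
  have "\<exists>T s t x y. T \<in> \<Omega> \<and> s \<in> tiles T \<and> t \<in> tiles T \<and> x \<in> fst s \<and> y \<in> fst t \<and>
      norm (x - y) < 1 / real (Suc n) \<and> fst s \<inter> fst t = {}" for n
  proof (rule ccontr)
    assume c: "\<not> ?thesis"
    have "1 / real (Suc n) > 0" by simp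
    with c neg show False by metis
  qed
  then obtain T s t x y where D: "\<And>n. T n \<in> \<Omega>" "\<And>n. s n \<in> tiles (T n)" "\<And>n. t n \<in> tiles (T n)"
    "\<And>n. x n \<in> fst (s n)" "\<And>n. y n \<in> fst (t n)" "\<And>n. norm (x n - y n) < 1 / real (Suc n)"
    "\<And>n. fst (s n) \<inter> fst (t n) = {}"
    by metis
  define Z where "Z n = tr (- x n) (T n)" for n
  have "Z n \<in> \<Omega>" for n using D(1) by (simp add: Z_def)
  from seq_compactD[OF seq_compact_Omega this] obtain U r where
    r: "U \<in> \<Omega>" "strict_mono (r :: nat \<Rightarrow> nat)" "(Z \<circ> r) \<longlonglongrightarrow> U" .
  obtain v where v: "conv (Z \<circ> r) U v" using tendsto_imp_conv[OF r(3)] by blast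
  define a where "a n = translate_tile (- v n - x (r n)) (s (r n))" for n
  define b where "b n = translate_tile (- v n - x (r n)) (t (r n))" for n
  have "\<forall>\<^sub>F n in sequentially. a n \<in> cp 3 U \<and> b n \<in> cp 3 U"
    using conv_back[OF v, of 2]
  proof eventually_elim
    case (elim n)
    have "translate_tile (- x (r n)) (s (r n)) \<in> cp 2 (Z (r n))"
    proof (rule mem_cp)
      show "- x (r n) + x (r n) \<in> fst (translate_tile (- x (r n)) (s (r n)))"
        unfolding fst_translate_tile using D(4) by (rule imageI)
    qed (use D in \<open>simp_all add: Z_def\<close>)
    moreover have "translate_tile (- x (r n)) (t (r n)) \<in> cp 2 (Z (r n))"
    proof (rule mem_cp)
      show "- x (r n) + y (r n) \<in> fst (translate_tile (- x (r n)) (t (r n)))"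
        unfolding fst_translate_tile using D(5) by (rule imageI)
      have "norm (y (r n) - x (r n)) < 1 / real (Suc (r n))" using D(6) by (simp add: norm_minus_commute)
      also have "\<dots> \<le> 1" by simp
      finally show "norm (- x (r n) + y (r n)) < 2" by simp
    qed (use D in \<open>simp_all add: Z_def\<close>)
    ultimately have "translate_tile (- v n) (translate_tile (- x (r n)) (s (r n))) \<in> cp 3 U"
      "translate_tile (- v n) (translate_tile (- x (r n)) (t (r n))) \<in> cp 3 U"
      using elim by (simp_all del: translate_tile_add)
    then show ?case by (simp add: a_def b_def)
  qed
  then obtain N where N: "\<And>n. n \<ge> N \<Longrightarrow> a n \<in> cp 3 U \<and> b n \<in> cp 3 U"
    unfolding eventually_sequentially by blast
  \<comment> \<open>Pulled back to the limit \<open>U\<close>, the two tiles range over a finite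
    patch. Along a subsequence they form one fixed disjoint pair, both members of which turn out to
    contain 0.\<close>
  have fin: "finite (cp 3 U \<times> cp 3 U)" using r(1) by simp
  have "(a (n + N), b (n + N)) \<in> cp 3 U \<times> cp 3 U" for n using N[of "n + N"] by simp
  from constant_subseq[OF fin this] obtain q :: "nat \<Rightarrow> nat" and z
    where q: "strict_mono q" "z \<in> cp 3 U \<times> cp 3 U" "\<forall>n. (a (q n + N), b (q n + N)) = z" .
  obtain A B where AB: "z = (A, B)" by (cases z)
  have eqs: "a (q n + N) = A" "b (q n + N) = B" for n using q(3) AB by auto
  have bt: "ball_tile A" "ball_tile B"
    using q(2) AB cp_subset by (blast intro: tiles_ball_tile)+
  have disj: "fst A \<inter> fst B = {}"
  proof -
    have "fst (a (q 0 + N)) \<inter> fst (b (q 0 + N)) = {}"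
      unfolding a_def b_def fst_translate_tile using D(7) by (simp flip: image_Int)
    then show ?thesis unfolding eqs .
  qed
  define m where "m n = q n + N" for n
  have m: "strict_mono m" using q(1) by (simp add: m_def strict_mono_def)
  have v0: "(\<lambda>n. - v (m n)) \<longlonglongrightarrow> 0"
    using v m LIMSEQ_subseq_LIMSEQ[of v 0 m] tendsto_minus[of "v \<circ> m" 0] by (simp add: conv_def o_def)
  have inA: "- v (m n) \<in> fst A" for n
  proof -
    have "(- v (m n) - x (r (m n))) + x (r (m n)) \<in> fst (a (m n))"
      unfolding a_def fst_translate_tile using D(4) by (rule imageI)
    then show ?thesis using eqs(1)[of n] by (simp add: m_def)
  qed
  have "0 \<in> fst A"
    by (rule closed_sequentially[OF ball_tile_closed[OF bt(1)] inA v0])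
  have yx: "(\<lambda>n. y n - x n) \<longlonglongrightarrow> 0"
  proof (rule LIMSEQ_I)
    fix e :: real assume "e > 0"
    then obtain N where "1 / real (Suc N) < e" using nat_approx_posE by blast
    moreover have "norm (y n - x n - 0) < 1 / real (Suc N)" if "n \<ge> N" for n
    proof -
      have "norm (y n - x n) < 1 / real (Suc n)" using D(6)[of n] by (simp add: norm_minus_commute)
      also have "\<dots> \<le> 1 / real (Suc N)" using that by (intro divide_left_mono) auto
      finally show ?thesis by simp
    qed
    ultimately have "norm (y n - x n - 0) < e" if "n \<ge> N" for n
      using that less_trans by blast
    then show "\<exists>no. \<forall>n\<ge>no. norm (y n - x n - 0) < e" by blast
  qed
  have "strict_mono (r \<circ> m)" using r(2) m by (rule strict_mono_o)
  then have "((\<lambda>n. y n - x n) \<circ> (r \<circ> m)) \<longlonglongrightarrow> 0" using yx by (intro LIMSEQ_subseq_LIMSEQ)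
  from tendsto_add[OF v0 this] have lim: "(\<lambda>n. - v (m n) + (y (r (m n)) - x (r (m n)))) \<longlonglongrightarrow> 0"
    by (simp add: o_def)
  have inB: "- v (m n) + (y (r (m n)) - x (r (m n))) \<in> fst B" for n
  proof -
    have "(- v (m n) - x (r (m n))) + y (r (m n)) \<in> fst (b (m n))"
      unfolding b_def fst_translate_tile using D(5) by (rule imageI)
    then show ?thesis using eqs(2)[of n] by (simp add: m_def algebra_simps)
  qed
  have "0 \<in> fst B"
    by (rule closed_sequentially[OF ball_tile_closed[OF bt(2)] inB lim])
  with \<open>0 \<in> fst A\<close> disj show False by blast
qed

text \<open>With the uniform margin \<open>\<epsilon>\<close> the region covered by the tiles
  satisfying \<open>P\<close> is open and so is its complement; connectedness of Euclidean space
  does the rest. Labels are propagated over a whole tiling in this way.\<close>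

lemma touching_induct:
  assumes T: "T \<in> \<Omega>" and t0: "t0 \<in> tiles T" "P t0" and t: "t \<in> tiles T"
    and step: "\<And>s t. s \<in> tiles T \<Longrightarrow> t \<in> tiles T \<Longrightarrow> P s \<Longrightarrow> fst s \<inter> fst t \<noteq> {} \<Longrightarrow> P t"
  shows "P t"
proof -
  obtain \<epsilon> where \<epsilon>: "\<epsilon> > 0" "\<forall>T\<in>\<Omega>. \<forall>s\<in>tiles T. \<forall>t\<in>tiles T. \<forall>x\<in>fst s. \<forall>y\<in>fst t. norm (x - y) < \<epsilon> \<longrightarrow> fst s \<inter> fst t \<noteq> {}"
    using touching_distance by blast
  define A where "A = {x. \<exists>s\<in>tiles T. x \<in> fst s \<and> P s}"
  have near: "y \<in> A \<longleftrightarrow> x \<in> A" if "dist x y < \<epsilon>" for x y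
  proof -
    have *: "y \<in> A" if xA: "x \<in> A" and d: "norm (x - y) < \<epsilon>" for x y
    proof -
      obtain s where s: "s \<in> tiles T" "x \<in> fst s" "P s" using xA unfolding A_def by blast
      obtain u where u: "u \<in> tiles T" "y \<in> fst u" using tiles_cover by blast
      have "fst s \<inter> fst u \<noteq> {}" using \<epsilon>(2) T s u d by blast
      then have "P u" by (rule step[OF s(1) u(1) s(3)])
      then show ?thesis unfolding A_def using u by blast
    qed
    show ?thesis using *[of x y] *[of y x] that by (auto simp: dist_norm norm_minus_commute)
  qed
  have "open A" "open (- A)"
    unfolding open_dist using \<epsilon>(1) near by (metis ComplD ComplI dist_commute)+
  then have "A = {} \<or> A = UNIV" using clopen[of A] by (simp add: closed_def)
  moreover obtain x where "x \<in> fst t0" using ball_tile_nonempty[OF tiles_ball_tile[OF t0(1)]] by blast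
  then have "x \<in> A" unfolding A_def using t0 by blast
  ultimately have "A = UNIV" by blast
  obtain y where y: "y \<in> fst t" using ball_tile_nonempty[OF tiles_ball_tile[OF t]] by blast
  then obtain s where s: "s \<in> tiles T" "y \<in> fst s" "P s"
    using \<open>A = UNIV\<close> unfolding A_def by blast
  show ?thesis by (rule step[OF s(1) t s(3)]) (use y s in blast)
qed

end

text \<open>A Lebesgue number and a finite subcover at once, from sequential compactness. The metric
  arguments are carried out for \<open>close\<close> itself, which is symmetric and transitive only
  up to constant factors.\<close>

lemma lebesgue_finite:
  fixes S :: "('a::euclidean_space, 'l) tiling set"
  assumes sc: "seq_compact S"
    and cover: "\<And>T. T \<in> S \<Longrightarrow> \<exists>U\<in>\<U>. openin (top_of_set S) U \<and> T \<in> U"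
  shows "\<exists>\<V>\<subseteq>\<U>. finite \<V> \<and> (\<exists>e>0. \<forall>T\<in>S. \<exists>U\<in>\<V>. \<forall>T'\<in>S. close e T T' \<longrightarrow> T' \<in> U)"
proof -
  have loc: "\<exists>U\<in>\<U>. \<exists>e>0. e \<le> 1 \<and> (\<forall>T'\<in>S. close e T T' \<longrightarrow> T' \<in> U)" if "T \<in> S" for T
  proof -
    obtain U where U: "U \<in> \<U>" "openin (top_of_set S) U" "T \<in> U" using cover[OF \<open>T \<in> S\<close>] by blast
    then obtain W where W: "open W" "U = S \<inter> W" by (auto simp: openin_open)
    then obtain e where e: "e > 0" "\<And>T'. close e T T' \<Longrightarrow> T' \<in> W"
      using U(3) unfolding open_tiling_def by blast
    have "close e T T'" if "close (min e 1) T T'" for T'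
      using close_mono[OF that] e(1) by simp
    then have "\<forall>T'\<in>S. close (min e 1) T T' \<longrightarrow> T' \<in> U" using e(2) W(2) by blast
    then show ?thesis using U(1) e(1) by (intro bexI[of _ U] exI[of _ "min e 1"]) auto
  qed
  have "\<exists>e>0. e \<le> 1 \<and> (\<forall>T\<in>S. \<exists>U\<in>\<U>. \<forall>T'\<in>S. close e T T' \<longrightarrow> T' \<in> U)"
  proof (rule ccontr)
    assume neg: "\<not> ?thesis"
    have "\<exists>T\<in>S. \<forall>U\<in>\<U>. \<exists>T'\<in>S. close (1 / real (Suc n)) T T' \<and> T' \<notin> U" for n
    proof (rule ccontr)
      assume "\<not> ?thesis"
      moreover have "1 / real (Suc n) > 0" "1 / real (Suc n) \<le> 1" by simp_all
      ultimately show False using neg by metis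
    qed
    then obtain X where X: "\<And>n. X n \<in> S" "\<And>n U. U \<in> \<U> \<Longrightarrow> \<exists>T'\<in>S. close (1 / real (Suc n)) (X n) T' \<and> T' \<notin> U"
      by metis
    obtain T r where r: "T \<in> S" "strict_mono (r :: nat \<Rightarrow> nat)" "(X \<circ> r) \<longlonglongrightarrow> T"
      using seq_compactD[OF sc X(1)] .
    obtain U e where U: "U \<in> \<U>" "e > 0" "e \<le> 1" "\<forall>T'\<in>S. close e T T' \<longrightarrow> T' \<in> U"
      using loc[OF r(1)] by blast
    have "\<forall>\<^sub>F n in sequentially. close (e/4) T ((X \<circ> r) n)"
      using U(2) by (intro eventually_close[OF r(3)]) simp
    moreover have "\<forall>\<^sub>F n in sequentially. 1 / real (Suc n) < e / 4"
    proof -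
      obtain N where N: "1 / real (Suc N) < e / 4" using U(2) nat_approx_posE[of "e/4"] by auto
      have "1 / real (Suc n) < e / 4" if "n \<ge> N" for n
      proof -
        have "1 / real (Suc n) \<le> 1 / real (Suc N)" using that by (intro divide_left_mono) auto
        then show ?thesis using N by linarith
      qed
      then show ?thesis unfolding eventually_sequentially by blast
    qed
    ultimately have "\<forall>\<^sub>F n in sequentially. close (e/4) T (X (r n)) \<and> 1 / real (Suc n) < e / 4"
      by eventually_elim simp
    then obtain n where n: "close (e/4) T (X (r n))" "1 / real (Suc n) < e / 4"
      unfolding eventually_sequentially by blast
    obtain T' where T': "T' \<in> S" "close (1 / real (Suc (r n))) (X (r n)) T'" "T' \<notin> U"
      using X(2)[OF U(1)] by blast
    have "1 / real (Suc (r n)) \<le> 1 / real (Suc n)"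
      using seq_suble[OF r(2), of n] by (intro divide_left_mono) auto
    then have "close (e/4) (X (r n)) T'"
      using n(2) by (intro close_mono[OF T'(2)]) auto
    from close_trans'[OF n(1) this] U(2,3) have "close e T T'" by simp
    with U(4) T' show False by blast
  qed
  then obtain e where e: "e > 0" "e \<le> 1" "\<forall>T\<in>S. \<exists>U\<in>\<U>. \<forall>T'\<in>S. close e T T' \<longrightarrow> T' \<in> U" by blast
  then obtain V where V: "\<And>T. T \<in> S \<Longrightarrow> V T \<in> \<U>" "\<And>T T'. T \<in> S \<Longrightarrow> T' \<in> S \<Longrightarrow> close e T T' \<Longrightarrow> T' \<in> V T"
    by metis
  \<comment> \<open>The factor 16 suffices: reversing \<open>close d\<close> gives
    \<open>2 * d\<close>, and two further comparisons at scale \<open>d\<close> give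
    \<open>6 * d\<close> and \<open>14 * d\<close>.\<close>
  define d where "d = e / 16"
  have d: "d > 0" "d \<le> 1/16" using e by (auto simp: d_def)
  have "\<exists>F\<subseteq>S. finite F \<and> (\<forall>T\<in>S. \<exists>R\<in>F. \<forall>T'\<in>S. close d T T' \<longrightarrow> T' \<in> V R)"
  proof (rule ccontr)
    assume neg: "\<not> ?thesis"
    have "\<exists>T. T \<in> S \<and> (\<forall>R\<in>F. \<exists>T'\<in>S. close d T T' \<and> T' \<notin> V R)" if "F \<subseteq> S" "finite F" for F
    proof (rule ccontr)
      assume "\<not> ?thesis"
      then have "\<forall>T\<in>S. \<exists>R\<in>F. \<forall>T'\<in>S. close d T T' \<longrightarrow> T' \<in> V R" by blast
      with neg that show False by blast
    qed
    then obtain nx where nx: "\<And>F. F \<subseteq> S \<Longrightarrow> finite F \<Longrightarrow> nx F \<in> S"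
      "\<And>F R. F \<subseteq> S \<Longrightarrow> finite F \<Longrightarrow> R \<in> F \<Longrightarrow> \<exists>T'\<in>S. close d (nx F) T' \<and> T' \<notin> V R"
      by metis
    \<comment> \<open>A greedy choice: the \<open>d\<close>-ball around each new point is contained
      in no \<open>V R\<close> for an earlier point \<open>R\<close>. Two late terms of a convergent
      subsequence contradict this.\<close>
    define G where "G = rec_nat {} (\<lambda>_ F. insert (nx F) F)"
    have G_Suc: "G (Suc n) = insert (nx (G n)) (G n)" for n by (simp add: G_def)
    have G: "G n \<subseteq> S \<and> finite (G n)" for n
      by (induction n) (use nx(1) in \<open>auto simp: G_def\<close>)
    define X where "X n = nx (G n)" for n
    have XS: "X n \<in> S" for n using G nx(1) by (simp add: X_def)
    have mem: "X i \<in> G j" if "i < j" for i j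
      using that by (induction j) (auto simp: G_Suc X_def less_Suc_eq)
    obtain T r where r: "T \<in> S" "strict_mono (r :: nat \<Rightarrow> nat)" "(X \<circ> r) \<longlonglongrightarrow> T"
      using seq_compactD[OF sc XS] .
    obtain N where N: "\<And>n. n \<ge> N \<Longrightarrow> close d T (X (r n))"
      using eventually_close[OF r(3) d(1)] unfolding eventually_sequentially by auto
    have "X (r N) \<in> G (r (Suc N))" using r(2) by (intro mem) (simp add: strict_mono_Suc_iff)
    then obtain T' where T': "T' \<in> S" "close d (X (r (Suc N))) T'" "T' \<notin> V (X (r N))"
      using nx(2) G unfolding X_def by blast
    have "close (2 * d) (X (r N)) T" using N[of N] d by (intro close_sym) auto
    from close_trans'[OF this N[of "Suc N"]] d have "close (6 * d) (X (r N)) (X (r (Suc N)))" by simp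
    from close_trans'[OF this T'(2)] d have "close (14 * d) (X (r N)) T'" by simp
    then have "close e (X (r N)) T'" by (rule close_mono) (use e(1) in \<open>simp_all add: d_def\<close>)
    then have "T' \<in> V (X (r N))" using V(2) XS T'(1) by blast
    with T'(3) show False by blast
  qed
  then obtain F where F: "F \<subseteq> S" "finite F" "\<forall>T\<in>S. \<exists>R\<in>F. \<forall>T'\<in>S. close d T T' \<longrightarrow> T' \<in> V R" by blast
  show ?thesis
  proof (intro exI[of _ "V ` F"] conjI exI[of _ d] ballI)
    fix T assume "T \<in> S"
    then obtain R where "R \<in> F" "\<forall>T'\<in>S. close d T T' \<longrightarrow> T' \<in> V R" using F(3) by blast
    then show "\<exists>U\<in>V ` F. \<forall>T'\<in>S. close d T T' \<longrightarrow> T' \<in> U" by blast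
  qed (use F V d in auto)
qed

section \<open>Minimality of the translation action on a repetitive hull\<close>

locale repetitive_hull = flc_hull +
  assumes rep: "repetitive T0"
begin

text \<open>A large patch of \<open>T2\<close> occurs in \<open>T0\<close>, where it covers a ball
  that by repetitivity contains a copy of \<open>P\<close>. The tiles inside that ball must belong
  to the large patch.\<close>

lemma patch_recurs:
  assumes T1: "T1 \<in> \<Omega>" and T2: "T2 \<in> \<Omega>" and P: "P \<subseteq> tiles T1" "finite P"
  shows "\<exists>v. translate v P \<subseteq> tiles T2"
proof -
  obtain a where a: "translate a P \<subseteq> tiles T0" using OmegaD[OF T1 P] .
  have "\<exists>r>0. \<forall>x. \<exists>v. translate v (translate a P) \<subseteq> tiles T0 \<and> support (translate v (translate a P)) \<subseteq> ball x r"
    using rep a P(2) unfolding repetitive_def by (metis finite_translate)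
  then obtain r where r: "\<forall>x. \<exists>v. translate (v + a) P \<subseteq> tiles T0 \<and> support (translate (v + a) P) \<subseteq> ball x r"
    by auto
  have fin: "finite (cp r T2)" using T2 by simp
  obtain b where b: "translate b (cp r T2) \<subseteq> tiles T0" using OmegaD[OF T2 cp_subset fin] .
  obtain v where v: "translate (v + a) P \<subseteq> tiles T0" "support (translate (v + a) P) \<subseteq> ball b r"
    using r by blast
  have cov: "ball b r \<subseteq> support (translate b (cp r T2))"
    using image_mono[OF cp_support, of "(+) b"] by (simp add: support_translate plus_image_ball)
  have "translate (v + a) P \<subseteq> translate b (cp r T2)"
  proof
    fix s assume s: "s \<in> translate (v + a) P"
    then have sT: "s \<in> tiles T0" using v(1) by blast
    have "fst s \<subseteq> ball b r" using s v(2) unfolding support_def by blast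
    then have "fst s \<inter> ball b r \<noteq> {}" using ball_tile_nonempty[OF tiles_ball_tile[OF sT]] by blast
    then show "s \<in> translate b (cp r T2)"
      using fin by (intro tile_mem_cover[OF sT b _ _ cov]) simp_all
  qed
  then have "translate (- b) (translate (v + a) P) \<subseteq> cp r T2"
    by (simp add: translate_subset_iff del: translate_add)
  then show ?thesis using cp_subset by (intro exI[of _ "- b + (v + a)"]) auto
qed

lemma cp_recurs:
  assumes "T1 \<in> \<Omega>" "T2 \<in> \<Omega>"
  shows "\<exists>v. cp r (tr v T2) = cp r T1"
proof -
  have fin: "finite (cp r T1)" using assms by simp
  obtain v where "translate v (cp r T1) \<subseteq> tiles T2"
    using patch_recurs[OF assms cp_subset fin] by blast
  then have "cp r T1 \<subseteq> tiles (tr (- v) T2)" by (simp add: translate_subset_iff tiles_tr)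
  from cp_eqI[OF this fin] show ?thesis by metis
qed

lemma minimal:
  assumes "T1 \<in> \<Omega>" "T2 \<in> \<Omega>"
  shows "\<exists>v. (\<lambda>n. tr (v n) T2) \<longlonglongrightarrow> T1"
proof -
  obtain v where v: "\<And>n. cp (real n) (tr (v n) T2) = cp (real n) T1"
    using cp_recurs[OF assms, of "real _"] by metis
  have "conv (\<lambda>n. tr (v n) T2) T1 (\<lambda>_. 0)"
    unfolding conv_def
  proof (intro conjI allI)
    fix r :: real
    obtain m :: nat where m: "r \<le> real m" using real_arch_simple by blast
    have "cp r (tr (v n) T2) = cp r (tr 0 T1)" if "n \<ge> m" for n
    proof -
      have "r \<le> real n" using m that by linarith
      from cp_mono[OF v this] show ?thesis by simp
    qed
    then show "\<forall>\<^sub>F n in sequentially. cp r (tr (v n) T2) = cp r (tr 0 T1)"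
      unfolding eventually_sequentially by blast
  qed simp
  then show ?thesis using conv_imp_tendsto by blast
qed

end


section \<open>Substitutions\<close>

lemma collar_translate: "collar (translate v P) (translate_tile v t) = translate v (collar P t)"
proof -
  have "s \<in> collar (translate v P) (translate_tile v t) \<longleftrightarrow> translate_tile (- v) s \<in> collar P t" for s
  proof -
    have "fst s \<inter> (+) v ` fst t \<noteq> {} \<longleftrightarrow> (+) (- v) ` fst s \<inter> fst t \<noteq> {}"
    proof -
      have "fst s \<inter> (+) v ` fst t = (+) v ` ((+) (- v) ` fst s \<inter> fst t)"
        by (subst image_Int) (simp_all add: image_image)
      then show ?thesis by simp
    qed
    then show ?thesis by (simp add: collar_def mem_translate)
  qed
  then show ?thesis by (auto simp only: mem_translate set_eq_iff)
qed

lemma collar_subset: "collar P t \<subseteq> P"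
  by (auto simp: collar_def)

lemma collar_tr: "collar (tiles (tr v T)) (translate_tile v t) = translate v (collar (tiles T) t)"
  by (simp add: tiles_tr collar_translate)

lemma subdivide_UN: "subdivide \<omega> (\<Union>i\<in>I. P i) = (\<Union>i\<in>I. subdivide \<omega> (P i))"
  by (simp add: subdivide_def)

locale substitution_hull = repetitive_hull T0 \<Omega>
  for T0 :: "('a::euclidean_space, 'b) tiling" and \<Omega> +
  fixes L :: "'a \<Rightarrow> 'a" and \<sigma> \<sigma>i :: "('a, 'b) tiling \<Rightarrow> ('a, 'b) tiling" and \<omega> :: "('a, 'b) tile \<Rightarrow> ('a, 'b) tile set"
  assumes subdiv: "inflate_and_subdivide_rule L (tiles_of_space \<Omega>) \<omega>"
    and tiles_sigma: "\<And>T. T \<in> \<Omega> \<Longrightarrow> tiles (\<sigma> T) = subdivide \<omega> (tiles T)"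
    and homeo_sigma: "homeomorphism \<Omega> \<Omega> \<sigma> \<sigma>i"
begin

definition sup_tile :: "nat \<Rightarrow> ('a, 'b) tile \<Rightarrow> ('a, 'b) tile set" where
  "sup_tile k t = (subdivide \<omega> ^^ k) {t}"

lemma linear_L: "linear L"
  using subdiv by (simp add: inflate_and_subdivide_rule_def inflation_def)

definition lam :: real where
  "lam = (SOME c. c > 1 \<and> (\<forall>x. norm (L x) \<ge> c * norm x))"

lemma lam: "lam > 1" "norm (L x) \<ge> lam * norm x"
proof -
  have "\<exists>c. c > 1 \<and> (\<forall>x. norm (L x) \<ge> c * norm x)"
    using subdiv by (auto simp: inflate_and_subdivide_rule_def inflation_def)
  from someI_ex[OF this] show "lam > 1" "norm (L x) \<ge> lam * norm x"
    unfolding lam_def by blast+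
qed

lemma linear_Lk: "linear (L ^^ k)"
proof (induction k)
  case 0
  then show ?case using linear_id by (simp add: id_def)
next
  case (Suc k)
  then show ?case using linear_compose[OF Suc linear_L] by (simp add: o_def)
qed

lemma norm_Lk: "norm ((L ^^ k) x) \<ge> lam ^ k * norm x"
proof (induction k)
  case (Suc k)
  have "lam ^ Suc k * norm x = lam * (lam ^ k * norm x)" by simp
  also have "\<dots> \<le> lam * norm ((L ^^ k) x)" using Suc lam(1) by (intro mult_left_mono) auto
  also have "\<dots> \<le> norm (L ((L ^^ k) x))" by (rule lam(2))
  finally show ?case by simp
qed simp

lemma lam_pow_ge_1: "lam ^ k \<ge> 1"
  using lam(1) by (simp add: one_le_power)

lemma Lk_add: "(L ^^ k) (x + y) = (L ^^ k) x + (L ^^ k) y"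
  by (rule linear_add[OF linear_Lk])

lemma Lk_minus: "(L ^^ k) (- x) = - (L ^^ k) x"
  by (rule linear_neg[OF linear_Lk])

lemma Lk_diff: "(L ^^ k) (x - y) = (L ^^ k) x - (L ^^ k) y"
  by (rule linear_diff[OF linear_Lk])

lemma Lk_0: "(L ^^ k) 0 = 0"
  by (rule linear_0[OF linear_Lk])

lemma inj_Lk: "inj (L ^^ k)"
proof (rule injI)
  fix x y assume "(L ^^ k) x = (L ^^ k) y"
  then have "norm ((L ^^ k) (x - y)) = 0" by (simp add: Lk_diff)
  moreover have "norm (x - y) \<le> lam ^ k * norm (x - y)"
    using mult_right_mono[OF lam_pow_ge_1, of "norm (x - y)" k] by simp
  ultimately have "norm (x - y) \<le> 0" using norm_Lk[of k "x - y"] by linarith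
  then show "x = y" by simp
qed

lemma bij_Lk: "bij (L ^^ k)"
  using inj_Lk linear_injective_imp_surjective[OF linear_Lk inj_Lk] by (simp add: bij_def)

lemma tendsto_Lk: "u \<longlonglongrightarrow> v \<Longrightarrow> (\<lambda>n. (L ^^ k) (u n)) \<longlonglongrightarrow> (L ^^ k) v"
  by (rule bounded_linear.tendsto[OF linear_conv_bounded_linear[THEN iffD1, OF linear_Lk]])

lemma in_tiles_of_space: "T \<in> \<Omega> \<Longrightarrow> t \<in> tiles T \<Longrightarrow> t \<in> tiles_of_space \<Omega>"
  by (auto simp: tiles_of_space_def)

lemma sigma_mem [simp]: "T \<in> \<Omega> \<Longrightarrow> \<sigma> T \<in> \<Omega>"
  using homeo_sigma by (auto simp: homeomorphism_def)

lemma sigma_pow_mem [simp]: "T \<in> \<Omega> \<Longrightarrow> (\<sigma> ^^ k) T \<in> \<Omega>"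
  by (induction k) auto

lemma sigmai_mem [simp]: "T \<in> \<Omega> \<Longrightarrow> \<sigma>i T \<in> \<Omega>"
  using homeo_sigma by (auto simp: homeomorphism_def)

lemma sigmai_pow_mem [simp]: "T \<in> \<Omega> \<Longrightarrow> (\<sigma>i ^^ k) T \<in> \<Omega>"
  by (induction k) auto

lemma sigmai_sigma_pow [simp]: "T \<in> \<Omega> \<Longrightarrow> (\<sigma>i ^^ k) ((\<sigma> ^^ k) T) = T"
proof (induction k arbitrary: T)
  case (Suc k)
  have "(\<sigma>i ^^ Suc k) ((\<sigma> ^^ Suc k) T) = (\<sigma>i ^^ k) (\<sigma>i (\<sigma> ((\<sigma> ^^ k) T)))"
    by (simp add: funpow_swap1)
  also have "\<sigma>i (\<sigma> ((\<sigma> ^^ k) T)) = (\<sigma> ^^ k) T"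
    using homeo_sigma Suc.prems by (simp add: homeomorphism_def)
  finally show ?case using Suc by simp
qed simp

lemma sigma_sigmai_pow [simp]: "T \<in> \<Omega> \<Longrightarrow> (\<sigma> ^^ k) ((\<sigma>i ^^ k) T) = T"
proof (induction k arbitrary: T)
  case (Suc k)
  have "(\<sigma> ^^ Suc k) ((\<sigma>i ^^ Suc k) T) = (\<sigma> ^^ k) (\<sigma> (\<sigma>i ((\<sigma>i ^^ k) T)))"
    by (simp add: funpow_swap1)
  also have "\<sigma> (\<sigma>i ((\<sigma>i ^^ k) T)) = (\<sigma>i ^^ k) T"
    using homeo_sigma Suc.prems by (simp add: homeomorphism_def)
  finally show ?case using Suc by simp
qed simp

lemma tiles_sigma_pow: "T \<in> \<Omega> \<Longrightarrow> tiles ((\<sigma> ^^ k) T) = (subdivide \<omega> ^^ k) (tiles T)"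
  by (induction k) (simp_all add: tiles_sigma)

lemma subdivide_pow_UN: "(subdivide \<omega> ^^ k) P = (\<Union>t\<in>P. sup_tile k t)"
  by (induction k) (simp_all add: sup_tile_def subdivide_UN)

lemma tiles_sigma_pow_UN: "T \<in> \<Omega> \<Longrightarrow> tiles ((\<sigma> ^^ k) T) = (\<Union>t\<in>tiles T. sup_tile k t)"
  by (simp add: tiles_sigma_pow subdivide_pow_UN)

lemma sup_tile_subset: "T \<in> \<Omega> \<Longrightarrow> t \<in> tiles T \<Longrightarrow> sup_tile k t \<subseteq> tiles ((\<sigma> ^^ k) T)"
  by (auto simp: tiles_sigma_pow_UN)

lemma sup_tile_Suc: "sup_tile (Suc k) t = (\<Union>s\<in>sup_tile k t. \<omega> s)"
  by (simp add: sup_tile_def subdivide_def)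

lemma sup_tile_0: "sup_tile 0 t = {t}"
  by (simp add: sup_tile_def)

lemma sup_tile_props:
  assumes T: "T \<in> \<Omega>" "t \<in> tiles T"
  shows "finite (sup_tile k t) \<and> support (sup_tile k t) = (L ^^ k) ` fst t \<and>
    (\<forall>v. sup_tile k (translate_tile v t) = translate ((L ^^ k) v) (sup_tile k t))"
proof (induction k)
  case 0
  then show ?case by (simp add: sup_tile_0 support_def translate_def)
next
  case (Suc k)
  have A: "s \<in> tiles_of_space \<Omega>" if "s \<in> sup_tile k t" for s
    using that sup_tile_subset[OF T] in_tiles_of_space[OF sigma_pow_mem[OF T(1)]] by blast
  have rule: "finite (\<omega> s)" "support (\<omega> s) = L ` fst s" "\<omega> (translate_tile v s) = translate (L v) (\<omega> s)"
    if "s \<in> sup_tile k t" for s v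
    using A[OF that] subdiv by (auto simp: inflate_and_subdivide_rule_def is_patch_def)
  have "finite (sup_tile (Suc k) t)" using Suc rule by (simp add: sup_tile_Suc)
  moreover have "support (sup_tile (Suc k) t) = (L ^^ Suc k) ` fst t"
  proof -
    have "support (sup_tile (Suc k) t) = (\<Union>s\<in>sup_tile k t. support (\<omega> s))"
      by (simp add: sup_tile_Suc support_def)
    also have "\<dots> = (\<Union>s\<in>sup_tile k t. L ` fst s)" using rule by simp
    also have "\<dots> = L ` support (sup_tile k t)" by (simp add: support_def image_UN)
    also have "\<dots> = L ` (L ^^ k) ` fst t" using Suc by simp
    finally show ?thesis by (simp add: image_comp)
  qed
  moreover have "sup_tile (Suc k) (translate_tile v t) = translate ((L ^^ Suc k) v) (sup_tile (Suc k) t)" for v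
  proof -
    have "sup_tile (Suc k) (translate_tile v t) = (\<Union>s\<in>translate_tile ((L ^^ k) v) ` sup_tile k t. \<omega> s)"
      using Suc by (simp add: sup_tile_Suc translate_def)
    also have "\<dots> = (\<Union>s\<in>sup_tile k t. translate (L ((L ^^ k) v)) (\<omega> s))"
      using rule by simp
    also have "\<dots> = translate ((L ^^ Suc k) v) (sup_tile (Suc k) t)"
      by (simp add: sup_tile_Suc translate_def image_UN)
    finally show ?thesis .
  qed
  ultimately show ?case by blast
qed

lemmas finite_sup_tile = sup_tile_props[THEN conjunct1]
lemmas support_sup_tile = sup_tile_props[THEN conjunct2, THEN conjunct1]
lemmas sup_tile_translate = sup_tile_props[THEN conjunct2, THEN conjunct2, rule_format]

lemma sup_tile_sub: "T \<in> \<Omega> \<Longrightarrow> t \<in> tiles T \<Longrightarrow> u \<in> sup_tile k t \<Longrightarrow> fst u \<subseteq> (L ^^ k) ` fst t"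
  using support_sup_tile[of T t k] by (auto simp: support_def)

lemma sigma_pow_tr:
  assumes "T \<in> \<Omega>"
  shows "(\<sigma> ^^ k) (tr v T) = tr ((L ^^ k) v) ((\<sigma> ^^ k) T)"
proof -
  have "tiles ((\<sigma> ^^ k) (tr v T)) = (\<Union>t\<in>translate_tile v ` tiles T. sup_tile k t)"
    using assms by (simp add: tiles_sigma_pow_UN tiles_tr translate_def)
  also have "\<dots> = (\<Union>t\<in>tiles T. translate ((L ^^ k) v) (sup_tile k t))"
    using assms by (simp add: sup_tile_translate)
  also have "\<dots> = tiles (tr ((L ^^ k) v) ((\<sigma> ^^ k) T))"
    using assms by (simp add: tiles_sigma_pow_UN tiles_tr translate_def image_UN)
  finally show ?thesis by (simp add: tiles_inject)
qed

lemma sigmai_pow_tr: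
  assumes "T \<in> \<Omega>"
  shows "(\<sigma>i ^^ k) (tr ((L ^^ k) v) T) = tr v ((\<sigma>i ^^ k) T)"
proof -
  have "(\<sigma> ^^ k) (tr v ((\<sigma>i ^^ k) T)) = tr ((L ^^ k) v) T"
    using assms by (simp add: sigma_pow_tr)
  then have "(\<sigma>i ^^ k) (tr ((L ^^ k) v) T) = (\<sigma>i ^^ k) ((\<sigma> ^^ k) (tr v ((\<sigma>i ^^ k) T)))" by simp
  also have "\<dots> = tr v ((\<sigma>i ^^ k) T)" using assms by (intro sigmai_sigma_pow) simp
  finally show ?thesis .
qed

text \<open>The interior of \<open>u\<close> lies in the inflated interiors of both tiles. This
  locates a tile of the inflated tiling in a supertile by its support alone.\<close>

lemma sup_tile_unique:
  assumes T: "T \<in> \<Omega>" "s \<in> tiles T" "t \<in> tiles T" and u: "u \<in> sup_tile k s" and su: "fst u \<subseteq> (L ^^ k) ` fst t"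
  shows "s = t"
proof (rule tiles_eqI[OF T(2,3)])
  have "u \<in> tiles ((\<sigma> ^^ k) T)" using sup_tile_subset[OF T(1,2)] u by blast
  then have "interior (fst u) \<noteq> {}" by (intro ball_tile_interior_nonempty tiles_ball_tile)
  then obtain x where x: "x \<in> interior (fst u)" by blast
  have int: "interior ((L ^^ k) ` S) = (L ^^ k) ` interior S" for S
    by (rule interior_bijective_linear_image[OF linear_Lk bij_Lk])
  have "x \<in> (L ^^ k) ` interior (fst s)" "x \<in> (L ^^ k) ` interior (fst t)"
    using x interior_mono[OF sup_tile_sub[OF T(1,2) u]] interior_mono[OF su] unfolding int by blast+
  then have "x \<in> (L ^^ k) ` (interior (fst s) \<inter> interior (fst t))"
    by (simp add: image_Int[OF inj_Lk])
  then show "interior (fst s) \<inter> interior (fst t) \<noteq> {}" by blast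
qed

definition eps :: real where
  "eps = (SOME \<epsilon>. \<epsilon> > 0 \<and> (\<forall>T\<in>\<Omega>. \<forall>s\<in>tiles T. \<forall>t\<in>tiles T. \<forall>x\<in>fst s. \<forall>y\<in>fst t. norm (x - y) < \<epsilon> \<longrightarrow> fst s \<inter> fst t \<noteq> {}))"

lemma eps: "eps > 0"
  "T \<in> \<Omega> \<Longrightarrow> s \<in> tiles T \<Longrightarrow> t \<in> tiles T \<Longrightarrow> x \<in> fst s \<Longrightarrow> y \<in> fst t \<Longrightarrow> norm (x - y) < eps \<Longrightarrow> fst s \<inter> fst t \<noteq> {}"
  using someI_ex[OF touching_distance] unfolding eps_def[symmetric] by blast+

text \<open>The collar of a tile contains a neighbourhood of the tile of a fixed radius, which the
  substitution expands.\<close>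

lemma cp_sigma_pow_collar:
  assumes T: "T1 \<in> \<Omega>" "T2 \<in> \<Omega>" and t: "t \<in> tiles T1" "t \<in> tiles T2"
    and col: "collar (tiles T1) t = collar (tiles T2) t"
    and y: "y \<in> (L ^^ k) ` fst t" and r: "r \<le> lam ^ k * eps"
  shows "cp r (tr (- y) ((\<sigma> ^^ k) T1)) = cp r (tr (- y) ((\<sigma> ^^ k) T2))"
proof -
  have *: "u \<in> cp r (tr (- y) ((\<sigma> ^^ k) S2))"
    if S: "S1 \<in> \<Omega>" "S2 \<in> \<Omega>" "t \<in> tiles S1" "collar (tiles S1) t = collar (tiles S2) t"
      and u: "u \<in> cp r (tr (- y) ((\<sigma> ^^ k) S1))" for S1 S2 u
  proof -
    have u1: "translate_tile y u \<in> tiles ((\<sigma> ^^ k) S1)" and meet: "fst u \<inter> ball 0 r \<noteq> {}"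
      using u by (auto simp: central_patch_def mem_tiles_tr)
    from u1 obtain s where s: "s \<in> tiles S1" "translate_tile y u \<in> sup_tile k s"
      using S(1) by (auto simp: tiles_sigma_pow_UN)
    from meet obtain z where z: "z \<in> fst u" "norm z < r" by auto
    have "y + z \<in> fst (translate_tile y u)" using z(1) by simp
    then obtain z' where z': "z' \<in> fst s" "y + z = (L ^^ k) z'"
      using sup_tile_sub[OF S(1) s] by blast
    obtain y' where y': "y' \<in> fst t" "y = (L ^^ k) y'" using y by blast
    have "lam ^ k * norm (z' - y') \<le> norm ((L ^^ k) (z' - y'))" by (rule norm_Lk)
    also have "(L ^^ k) (z' - y') = z" using z'(2) y'(2) by (simp add: Lk_diff algebra_simps)
    also have "norm z < lam ^ k * eps" using z(2) r by linarith
    finally have "norm (z' - y') < eps"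
      using lam_pow_ge_1[of k] by (simp add: mult_less_cancel_left_pos)
    then have "s \<in> collar (tiles S1) t"
      using eps(2)[OF S(1) s(1) S(3) z'(1) y'(1)] s(1) by (simp add: collar_def)
    then have "s \<in> tiles S2" using S(4) collar_subset by blast
    then have "translate_tile y u \<in> tiles ((\<sigma> ^^ k) S2)"
      using sup_tile_subset[OF S(2)] s(2) by blast
    then show ?thesis using meet by (simp add: central_patch_def mem_tiles_tr)
  qed
  show ?thesis
    using *[OF T t(1) col] *[OF T(2,1) t(2) col[symmetric]] by blast
qed

text \<open>Supertiles that touch come from tiles that touch, because \<open>L ^^ k\<close> is
  injective; so the collar of \<open>t\<close> determines the collars of the tiles inside its
  supertile.\<close>

lemma collar_sigma_pow:
  assumes T: "T1 \<in> \<Omega>" "T2 \<in> \<Omega>" and t: "t \<in> tiles T1" "t \<in> tiles T2"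
    and col: "collar (tiles T1) t = collar (tiles T2) t" and u: "u \<in> sup_tile k t"
  shows "collar (tiles ((\<sigma> ^^ k) T1)) u = collar (tiles ((\<sigma> ^^ k) T2)) u"
proof -
  have *: "w \<in> collar (tiles ((\<sigma> ^^ k) S2)) u"
    if S: "S1 \<in> \<Omega>" "S2 \<in> \<Omega>" "t \<in> tiles S1" "collar (tiles S1) t = collar (tiles S2) t"
      and w: "w \<in> collar (tiles ((\<sigma> ^^ k) S1)) u" for S1 S2 w
  proof -
    have w1: "w \<in> tiles ((\<sigma> ^^ k) S1)" and meet: "fst w \<inter> fst u \<noteq> {}"
      using w by (auto simp: collar_def)
    obtain s where s: "s \<in> tiles S1" "w \<in> sup_tile k s"
      using w1 S(1) by (auto simp: tiles_sigma_pow_UN)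
    have "(L ^^ k) ` fst s \<inter> (L ^^ k) ` fst t \<noteq> {}"
      using meet sup_tile_sub[OF S(1) s] sup_tile_sub[OF S(1,3) u] by blast
    then have "fst s \<inter> fst t \<noteq> {}" by (simp flip: image_Int[OF inj_Lk])
    then have "s \<in> tiles S2" using s(1) S(4) unfolding collar_def by blast
    then have "w \<in> tiles ((\<sigma> ^^ k) S2)" using sup_tile_subset[OF S(2)] s(2) by blast
    then show ?thesis using meet by (simp add: collar_def)
  qed
  show ?thesis
    using *[OF T t(1) col] *[OF T(2,1) t(2) col[symmetric]] by blast
qed

text \<open>A tile of the substituted tiling that meets the ball comes from a tile that already
  meets it, since \<open>L ^^ k\<close> does not shrink norms.\<close>

lemma cp_sigma_pow:
  assumes T: "T1 \<in> \<Omega>" "T2 \<in> \<Omega>" and e: "cp r T1 = cp r T2"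
  shows "cp r ((\<sigma> ^^ k) T1) = cp r ((\<sigma> ^^ k) T2)"
proof -
  have *: "u \<in> cp r ((\<sigma> ^^ k) S2)"
    if S: "S1 \<in> \<Omega>" "S2 \<in> \<Omega>" "cp r S1 = cp r S2" and u: "u \<in> cp r ((\<sigma> ^^ k) S1)" for S1 S2 u
  proof -
    have u1: "u \<in> tiles ((\<sigma> ^^ k) S1)" and meet: "fst u \<inter> ball 0 r \<noteq> {}"
      using u by (auto simp: central_patch_def)
    obtain s where s: "s \<in> tiles S1" "u \<in> sup_tile k s"
      using u1 S(1) by (auto simp: tiles_sigma_pow_UN)
    obtain z where z: "z \<in> fst u" "norm z < r" using meet by auto
    obtain z' where z': "z' \<in> fst s" "z = (L ^^ k) z'" using sup_tile_sub[OF S(1) s] z(1) by blast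
    have "norm z' \<le> lam ^ k * norm z'"
      using mult_right_mono[OF lam_pow_ge_1, of "norm z'" k] by simp
    also have "\<dots> \<le> norm z" unfolding z'(2) by (rule norm_Lk)
    finally have "norm z' < r" using z(2) by linarith
    then have "s \<in> cp r S1" using s(1) z'(1) by (intro mem_cp)
    then have "s \<in> tiles S2" using S(3) cp_subset by blast
    then have "u \<in> tiles ((\<sigma> ^^ k) S2)" using sup_tile_subset[OF S(2)] s(2) by blast
    then show ?thesis using meet by (simp add: central_patch_def)
  qed
  show ?thesis using *[OF T e] *[OF T(2,1) e[symmetric]] by blast
qed

lemma tendsto_sigma_pow:
  assumes "X \<longlonglongrightarrow> T" "\<And>n. X n \<in> \<Omega>" "T \<in> \<Omega>"
  shows "(\<lambda>n. (\<sigma> ^^ k) (X n)) \<longlonglongrightarrow> (\<sigma> ^^ k) T"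
proof (induction k)
  case (Suc k)
  have "continuous_on \<Omega> \<sigma>" using homeo_sigma by (simp add: homeomorphism_def)
  from continuous_on_tendsto_compose[OF this Suc] show ?case using assms by simp
qed (use assms in simp)

lemma tendsto_sigmai_pow:
  assumes "X \<longlonglongrightarrow> T" "\<And>n. X n \<in> \<Omega>" "T \<in> \<Omega>"
  shows "(\<lambda>n. (\<sigma>i ^^ k) (X n)) \<longlonglongrightarrow> (\<sigma>i ^^ k) T"
proof (induction k)
  case (Suc k)
  have "continuous_on \<Omega> \<sigma>i" using homeo_sigma by (simp add: homeomorphism_def)
  from continuous_on_tendsto_compose[OF this Suc] show ?case using assms by simp
qed (use assms in simp)

end

section \<open>Finite regular covers of tiling spaces\<close>

lemma seq_nhds_first_countable: "seq_nhds (S :: 'x::first_countable_topology set)"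
  unfolding seq_nhds_def
proof (intro ballI allI impI)
  fix x Q assume x: "x \<in> S"
    and Q: "\<forall>X. X \<longlonglongrightarrow> x \<longrightarrow> (\<forall>n. X n \<in> S) \<longrightarrow> (\<forall>\<^sub>F n in sequentially. Q (X n))"
  have "eventually Q (inf (nhds x) (principal S))"
    by (rule sequentially_imp_eventually_nhds_within) (use Q in blast)
  then show "\<exists>A. open A \<and> x \<in> A \<and> (\<forall>y\<in>S \<inter> A. Q y)"
    unfolding eventually_inf_principal eventually_nhds by blast
qed

text \<open>The form in which connectedness is used below: for uniqueness of lifted segments and of
  deck transformations, for spreading \<open>near\<close>, and for density of orbits.\<close>

lemma seq_nhds_connected_const:
  assumes S: "seq_nhds S" "connected S"
    and loc: "\<And>x X. x \<in> S \<Longrightarrow> (\<And>n. X n \<in> S) \<Longrightarrow> X \<longlonglongrightarrow> x \<Longrightarrow> \<forall>\<^sub>F n in sequentially. P (X n) = P x"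
    and "a \<in> S" "b \<in> S"
  shows "P a = P b"
proof -
  have "P a = P b" if "P a = c" for c
  proof -
    have "P b = c"
    proof (rule connected_induction_simple[OF S(2) assms(4,5), where P = "\<lambda>x. P x = c"])
      fix x assume x: "x \<in> S"
      obtain A where A: "open A" "x \<in> A" "\<And>y. y \<in> S \<Longrightarrow> y \<in> A \<Longrightarrow> P y = P x"
      proof (rule seq_nhdsD[OF S(1) x, where Q = "\<lambda>y. P y = P x"])
        fix X assume "X \<longlonglongrightarrow> x" "\<And>n. X n \<in> S"
        then show "\<forall>\<^sub>F n in sequentially. P (X n) = P x" using loc[OF x] by blast
      qed (rule that)
      show "\<exists>T. openin (top_of_set S) T \<and> x \<in> T \<and> (\<forall>x\<in>T. \<forall>y\<in>T. P x = c \<longrightarrow> P y = c)"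
      proof (intro exI[of _ "S \<inter> A"] conjI ballI impI)
        fix u w assume "u \<in> S \<inter> A" "w \<in> S \<inter> A" "P u = c"
        then have "P u = P x" "P w = P x" using A(3) by blast+
        with \<open>P u = c\<close> show "P w = c" by (rule_tac trans[OF \<open>P w = P x\<close>]) (rule trans[OF \<open>P u = P x\<close>[symmetric]])
      qed (use A(1,2) x in \<open>auto simp: openin_open\<close>)
    qed (rule that)
    with that show ?thesis by simp
  qed
  then show ?thesis by blast
qed

lemma tendsto_by_subseq:
  fixes X :: "nat \<Rightarrow> 'x::topological_space"
  assumes "\<And>r. strict_mono (r :: nat \<Rightarrow> nat) \<Longrightarrow> \<exists>s. strict_mono (s :: nat \<Rightarrow> nat) \<and> (X \<circ> r \<circ> s) \<longlonglongrightarrow> x"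
  shows "X \<longlonglongrightarrow> x"
proof (rule topological_tendstoI, rule ccontr)
  fix B assume B: "open B" "x \<in> B" and neg: "\<not> (\<forall>\<^sub>F n in sequentially. X n \<in> B)"
  have inf: "infinite {n. X n \<notin> B}"
    using neg by (simp add: cofinite_eq_sequentially[symmetric] eventually_cofinite)
  define r where "r = enumerate {n. X n \<notin> B}"
  have r: "strict_mono r" "\<And>n. X (r n) \<notin> B"
    using strict_mono_enumerate[OF inf] enumerate_in_set[OF inf] by (auto simp: r_def)
  obtain s where s: "(X \<circ> r \<circ> s) \<longlonglongrightarrow> x" using assms[OF r(1)] by blast
  have "\<forall>\<^sub>F n in sequentially. X (r (s n)) \<in> B"
    using topological_tendstoD[OF s B] by simp
  then show False using r(2) by simp
qed

lemma tendsto_mem_openin: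
  assumes "openin (top_of_set S) U" "x \<in> U" "X \<longlonglongrightarrow> x" "\<And>n. X n \<in> S"
  shows "\<forall>\<^sub>F n in sequentially. X n \<in> U"
proof -
  obtain W where W: "open W" "U = S \<inter> W" using assms(1) by (auto simp: openin_open)
  with topological_tendstoD[OF assms(3), of W] assms(2,4) show ?thesis by auto
qed

locale tiling_cover = repetitive_hull T0 \<Omega>
  for T0 :: "('a::euclidean_space, 'l) tiling" and \<Omega> +
  fixes C :: "'c::topological_space set" and p :: "'c \<Rightarrow> ('a, 'l) tiling"
  assumes cov: "finite_regular_cover C p \<Omega>"
begin

lemma covering: "covering_space C p \<Omega>"
  using cov by (simp add: finite_regular_cover_def)

lemma cont_p: "continuous_on C p"
  using covering by (rule covering_space_imp_continuous)

lemma p_mem [simp]: "x \<in> C \<Longrightarrow> p x \<in> \<Omega>"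
  using covering_space_imp_surjective[OF covering] by blast

lemma fibre_ex: "T \<in> \<Omega> \<Longrightarrow> \<exists>x\<in>C. p x = T"
  using covering_space_imp_surjective[OF covering] by blast

lemma tendsto_p: "X \<longlonglongrightarrow> x \<Longrightarrow> x \<in> C \<Longrightarrow> (\<And>n. X n \<in> C) \<Longrightarrow> (\<lambda>n. p (X n)) \<longlonglongrightarrow> p x"
  by (rule continuous_on_tendsto_compose[OF cont_p]) simp_all

text \<open>A sheet of the covering, described by injectivity and openness of \<open>p\<close>
  alone. No evenly covered image is fixed, so the property passes easily to images under deck
  transformations.\<close>

definition slice :: "'c set \<Rightarrow> bool" where
  "slice V \<longleftrightarrow> openin (top_of_set C) V \<and> inj_on p V \<and>
     (\<forall>W. openin (top_of_set C) W \<longrightarrow> W \<subseteq> V \<longrightarrow> openin (top_of_set \<Omega>) (p ` W))"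

lemma slice_openin: "slice V \<Longrightarrow> openin (top_of_set C) V"
  by (simp add: slice_def)

lemma slice_subset: "slice V \<Longrightarrow> V \<subseteq> C"
  by (auto simp: slice_def dest: openin_imp_subset)

lemma slice_inj: "slice V \<Longrightarrow> x \<in> V \<Longrightarrow> y \<in> V \<Longrightarrow> p x = p y \<Longrightarrow> x = y"
  by (auto simp: slice_def inj_on_def)

lemma slice_image_openin: "slice V \<Longrightarrow> openin (top_of_set \<Omega>) (p ` V)"
  by (simp add: slice_def)

lemma homeomorphism_slice:
  assumes "openin (top_of_set C) V" "openin (top_of_set \<Omega>) U" "homeomorphism V U p q"
  shows "slice V"
  unfolding slice_def
proof (intro conjI allI impI)
  show "inj_on p V" using assms(3) by (auto simp: homeomorphism_def inj_on_def) metis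
  fix W assume W: "openin (top_of_set C) W" "W \<subseteq> V"
  then have "openin (top_of_set V) W"
    using assms(1) by (meson openin_imp_subset openin_subset_trans)
  then have "openin (top_of_set U) (p ` W)"
    by (rule homeomorphism_imp_open_map[OF assms(3)])
  then show "openin (top_of_set \<Omega>) (p ` W)" using assms(2) by (rule openin_trans)
qed (rule assms(1))

lemma slice_ex: "x \<in> C \<Longrightarrow> \<exists>V. slice V \<and> x \<in> V"
  using covering_space_local_homeomorphism[OF covering] homeomorphism_slice by metis

text \<open>Two points of a fibre lie in different sheets over an evenly covered set. Together with
  uniqueness of limits of tilings this separation gives unique limits in \<open>C\<close>.\<close>

lemma slice_disjoint:
  assumes "x \<in> C" "y \<in> C" "p x = p y" "x \<noteq> y"
  shows "\<exists>V W. slice V \<and> slice W \<and> x \<in> V \<and> y \<in> W \<and> V \<inter> W = {}"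
proof -
  have "p x \<in> \<Omega>" using assms(1) by simp
  then obtain U VS where U: "p x \<in> U" "openin (top_of_set \<Omega>) U" "\<Union>VS = C \<inter> p -` U"
    "\<forall>V\<in>VS. openin (top_of_set C) V" "pairwise disjnt VS" "\<forall>V\<in>VS. \<exists>q. homeomorphism V U p q"
    using covering unfolding covering_space_def by (metis (no_types, lifting))
  have "x \<in> \<Union>VS" "y \<in> \<Union>VS" unfolding U(3) using assms U(1) by auto
  then obtain V W where VW: "V \<in> VS" "x \<in> V" "W \<in> VS" "y \<in> W" by blast
  have sl: "slice V" "slice W" using VW U homeomorphism_slice by metis+
  have "V \<noteq> W" using slice_inj[OF sl(1) VW(2)] VW(4) assms(3,4) by blast
  then have "V \<inter> W = {}" using U(5) VW by (simp add: pairwise_def disjnt_def)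
  with sl VW show ?thesis by blast
qed

lemma slice_tendsto:
  assumes "slice V" "y \<in> V" "\<forall>\<^sub>F n in sequentially. Y n \<in> V" "(\<lambda>n. p (Y n)) \<longlonglongrightarrow> p y"
  shows "Y \<longlonglongrightarrow> y"
proof (rule topological_tendstoI)
  fix B assume B: "open B" "y \<in> B"
  have "openin (top_of_set C) (V \<inter> B)"
    using slice_openin[OF assms(1)] B(1) by (rule openin_Int_open)
  then have "openin (top_of_set \<Omega>) (p ` (V \<inter> B))" using assms(1) by (simp add: slice_def)
  then obtain O' where O': "open O'" "p ` (V \<inter> B) = \<Omega> \<inter> O'" by (auto simp: openin_open)
  have "p y \<in> O'" using O'(2) assms(2) B(2) by blast
  from topological_tendstoD[OF assms(4) O'(1) this] assms(3)
  show "\<forall>\<^sub>F n in sequentially. Y n \<in> B"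
  proof eventually_elim
    case (elim n)
    have "Y n \<in> C" using elim(2) slice_subset[OF assms(1)] by blast
    then have "p (Y n) \<in> p ` (V \<inter> B)" unfolding O'(2) using elim(1) by simp
    then obtain w where "w \<in> V" "w \<in> B" "p (Y n) = p w" by auto
    then show ?case using slice_inj[OF assms(1) elim(2)] by metis
  qed
qed

lemma eventually_eq_over:
  assumes "x \<in> C" "\<And>n. X n \<in> C" "\<And>n. Y n \<in> C" "X \<longlonglongrightarrow> x" "Y \<longlonglongrightarrow> x" "\<And>n. p (X n) = p (Y n)"
  shows "\<forall>\<^sub>F n in sequentially. X n = Y n"
proof -
  obtain V where V: "slice V" "x \<in> V" using slice_ex[OF assms(1)] by blast
  have "\<forall>\<^sub>F n in sequentially. X n \<in> V" "\<forall>\<^sub>F n in sequentially. Y n \<in> V"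
    using tendsto_mem_openin[OF slice_openin[OF V(1)] V(2)] assms by blast+
  then show ?thesis
    by eventually_elim (use slice_inj[OF V(1)] assms(6) in blast)
qed

lemma eventually_neq_over:
  assumes "x \<in> C" "y \<in> C" "\<And>n. X n \<in> C" "\<And>n. Y n \<in> C" "X \<longlonglongrightarrow> x" "Y \<longlonglongrightarrow> y" "p x = p y" "x \<noteq> y"
  shows "\<forall>\<^sub>F n in sequentially. X n \<noteq> Y n"
proof -
  obtain V W where VW: "slice V" "slice W" "x \<in> V" "y \<in> W" "V \<inter> W = {}"
    using slice_disjoint[OF assms(1,2,7,8)] by blast
  have "\<forall>\<^sub>F n in sequentially. X n \<in> V" "\<forall>\<^sub>F n in sequentially. Y n \<in> W"
    using tendsto_mem_openin[OF slice_openin[OF VW(1)] VW(3)]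
      tendsto_mem_openin[OF slice_openin[OF VW(2)] VW(4)] assms by blast+
  then show ?thesis
  proof eventually_elim
    case (elim n)
    then show ?case using VW(5) by auto
  qed
qed

lemma LIMSEQ_unique_C:
  assumes "x \<in> C" "y \<in> C" "\<And>n. X n \<in> C" "X \<longlonglongrightarrow> x" "X \<longlonglongrightarrow> y"
  shows "x = y"
proof (rule ccontr)
  assume "x \<noteq> y"
  have "p x = p y"
    using tendsto_p[OF assms(4,1,3)] tendsto_p[OF assms(5,2,3)] by (rule tiling_LIMSEQ_unique)
  have "\<forall>\<^sub>F n in sequentially. X n \<noteq> X n"
    by (rule eventually_neq_over[OF assms(1,2,3,3,4,5) \<open>p x = p y\<close> \<open>x \<noteq> y\<close>])
  then show False by simp
qed

lemma seq_nhds_C: "seq_nhds C"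
  unfolding seq_nhds_def
proof (intro ballI allI impI)
  fix x Q assume x: "x \<in> C"
    and Q: "\<forall>X. X \<longlonglongrightarrow> x \<longrightarrow> (\<forall>n. X n \<in> C) \<longrightarrow> (\<forall>\<^sub>F n in sequentially. Q (X n))"
  obtain V where V: "slice V" "x \<in> V" using slice_ex[OF x] by blast
  have "p x \<in> p ` V" using V(2) by blast
  obtain A where A: "open A" "p x \<in> A" "\<And>T. T \<in> p ` V \<Longrightarrow> T \<in> A \<Longrightarrow> \<forall>y\<in>V. p y = T \<longrightarrow> Q y"
  proof (rule seq_nhdsD[OF seq_nhds_tilings \<open>p x \<in> p ` V\<close>, where Q = "\<lambda>T. \<forall>y\<in>V. p y = T \<longrightarrow> Q y"])
    fix X assume X: "X \<longlonglongrightarrow> p x" "\<And>n. X n \<in> p ` V"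
    have "\<exists>y. y \<in> V \<and> X n = p y" for n using X(2)[of n] by auto
    then obtain Y where Y: "\<And>n. Y n \<in> V" "\<And>n. X n = p (Y n)" by metis
    have "X = (\<lambda>n. p (Y n))" using Y(2) by (rule ext)
    then have "(\<lambda>n. p (Y n)) \<longlonglongrightarrow> p x" using X(1) by simp
    then have "Y \<longlonglongrightarrow> x" using Y(1) by (intro slice_tendsto[OF V]) simp_all
    then have "\<forall>\<^sub>F n in sequentially. Q (Y n)" using Q Y(1) slice_subset[OF V(1)] by blast
    then show "\<forall>\<^sub>F n in sequentially. \<forall>y\<in>V. p y = X n \<longrightarrow> Q y"
      by eventually_elim (use Y slice_inj[OF V(1)] in metis)
  qed (rule that)
  have "openin (top_of_set C) (C \<inter> p -` A)" by (rule continuous_openin_preimage_gen[OF cont_p A(1)])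
  then have "openin (top_of_set C) (V \<inter> (C \<inter> p -` A))" by (rule openin_Int[OF slice_openin[OF V(1)]])
  then obtain B where B: "open B" "V \<inter> (C \<inter> p -` A) = C \<inter> B" by (auto simp: openin_open)
  have "x \<in> B" using B(2) V(2) x A(2) by blast
  moreover have "Q y" if "y \<in> C \<inter> B" for y
  proof -
    have "y \<in> V" "p y \<in> A" using that unfolding B(2)[symmetric] by auto
    then show ?thesis using A(3)[of "p y"] by blast
  qed
  ultimately show "\<exists>A. open A \<and> x \<in> A \<and> (\<forall>y\<in>C \<inter> A. Q y)" using B(1) by blast
qed

section \<open>Deck transformations\<close>

abbreviation G where "G \<equiv> deck_transformations C p"

lemma deck_homeo: "g \<in> G \<Longrightarrow> \<exists>g'. homeomorphism C C g g'"
  by (auto simp: deck_transformations_def)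

lemma deck_mem [simp]: "g \<in> G \<Longrightarrow> x \<in> C \<Longrightarrow> g x \<in> C"
  using deck_homeo[of g] by (auto simp: homeomorphism_def)

lemma deck_p [simp]: "g \<in> G \<Longrightarrow> x \<in> C \<Longrightarrow> p (g x) = p x"
  by (auto simp: deck_transformations_def)

lemma deck_inj: "g \<in> G \<Longrightarrow> x \<in> C \<Longrightarrow> y \<in> C \<Longrightarrow> g x = g y \<Longrightarrow> x = y"
  using deck_homeo[of g] unfolding homeomorphism_def by metis

lemma deck_tendsto:
  assumes "g \<in> G" "X \<longlonglongrightarrow> x" "x \<in> C" "\<And>n. X n \<in> C"
  shows "(\<lambda>n. g (X n)) \<longlonglongrightarrow> g x"
proof -
  have "continuous_on C g" using deck_homeo[OF assms(1)] by (auto simp: homeomorphism_def)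
  from continuous_on_tendsto_compose[OF this assms(2,3)] show ?thesis using assms(4) by simp
qed

lemma deck_transitive: "x \<in> C \<Longrightarrow> y \<in> C \<Longrightarrow> p x = p y \<Longrightarrow> \<exists>g\<in>G. g x = y"
  using cov by (simp add: finite_regular_cover_def)

lemma connected_C: "connected C"
  using cov by (simp add: finite_regular_cover_def)

text \<open>Agreement of \<open>g\<close> and \<open>h\<close> is locally constant on the connected
  space \<open>C\<close>. Outside \<open>C\<close> both are \<open>undefined\<close> by the
  normalisation of deck transformations.\<close>

lemma deck_unique:
  assumes g: "g \<in> G" "h \<in> G" and x: "x \<in> C" "g x = h x"
  shows "g = h"
proof
  fix y
  show "g y = h y"
  proof (cases "y \<in> C")
    case True
    have "(g x = h x) = (g y = h y)"
    proof (rule seq_nhds_connected_const[OF seq_nhds_C connected_C _ x(1) True, where P = "\<lambda>x. g x = h x"])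
      fix z X assume z: "z \<in> C" "\<And>n. X n \<in> C" "X \<longlonglongrightarrow> z"
      note lim = deck_tendsto[OF g(1) z(3,1,2)] deck_tendsto[OF g(2) z(3,1,2)]
      show "\<forall>\<^sub>F n in sequentially. (g (X n) = h (X n)) = (g z = h z)"
      proof (cases "g z = h z")
        case True
        have "\<forall>\<^sub>F n in sequentially. g (X n) = h (X n)"
          by (rule eventually_eq_over[of "g z"]) (use z g lim True in simp_all)
        then show ?thesis by eventually_elim (use True in simp)
      next
        case False
        have "\<forall>\<^sub>F n in sequentially. g (X n) \<noteq> h (X n)"
          by (rule eventually_neq_over[of "g z" "h z"]) (use z g lim False in simp_all)
        then show ?thesis by eventually_elim (use False in simp)
      qed
    qed
    then show ?thesis using x(2) by simp
  next
    case False
    have "g \<in> extensional C" "h \<in> extensional C"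
      using g unfolding deck_transformations_def by simp_all
    then have "g y = undefined" "h y = undefined" using False by (auto intro: extensional_arb)
    then show ?thesis by simp
  qed
qed

lemma C_nonempty: "C \<noteq> {}"
  using fibre_ex[OF T0_mem] by blast

lemma finite_deck: "finite G"
proof -
  obtain x where x: "x \<in> C" using C_nonempty by blast
  have "finite {y \<in> C. p y = p x}" using cov x by (simp add: finite_regular_cover_def)
  moreover have "(\<lambda>g. g x) ` G \<subseteq> {y \<in> C. p y = p x}" using x by auto
  ultimately have "finite ((\<lambda>g. g x) ` G)" by (rule finite_subset[rotated])
  moreover have "inj_on (\<lambda>g. g x) G" using deck_unique x by (intro inj_onI) blast
  ultimately show ?thesis by (rule finite_imageD)
qed

lemma deck_slice:
  assumes "g \<in> G" "slice V"
  shows "slice (g ` V)"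
  unfolding slice_def
proof (intro conjI allI impI)
  obtain g' where g': "homeomorphism C C g g'" using deck_homeo[OF assms(1)] by blast
  show "openin (top_of_set C) (g ` V)"
    using g' slice_openin[OF assms(2)] by (rule homeomorphism_imp_open_map)
  have VC: "V \<subseteq> C" by (rule slice_subset[OF assms(2)])
  show "inj_on p (g ` V)"
  proof (rule inj_onI)
    fix a b assume "a \<in> g ` V" "b \<in> g ` V" "p a = p b"
    then obtain x y where xy: "x \<in> V" "y \<in> V" "a = g x" "b = g y" by blast
    then have "p x = p y" using \<open>p a = p b\<close> VC assms(1) by (simp add: subset_iff)
    then show "a = b" using slice_inj[OF assms(2)] xy by blast
  qed
  fix W assume W: "openin (top_of_set C) W" "W \<subseteq> g ` V"
  have gW: "openin (top_of_set C) (g' ` W)"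
    using homeomorphism_symD[OF g'] W(1) by (rule homeomorphism_imp_open_map)
  have inv: "g' (g x) = x" if "x \<in> V" for x using g' VC that by (auto simp: homeomorphism_def)
  have "g' ` W \<subseteq> V" using W(2) inv by auto
  then have "openin (top_of_set \<Omega>) (p ` g' ` W)" using gW assms(2) by (simp add: slice_def)
  moreover have "p ` g' ` W = p ` W"
  proof -
    have "p (g' w) = p w" if "w \<in> W" for w
    proof -
      obtain x where x: "x \<in> V" "w = g x" using W(2) \<open>w \<in> W\<close> by auto
      then show ?thesis using inv[OF x(1)] VC assms(1) by (simp add: subset_iff)
    qed
    then show ?thesis by (simp add: image_image)
  qed
  ultimately show "openin (top_of_set \<Omega>) (p ` W)" by simp
qed

lemma lebesgue_slices:
  "\<exists>\<V> e. finite \<V> \<and> e > 0 \<and> e \<le> 1/4 \<and> (\<forall>V\<in>\<V>. slice V) \<and>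
    (\<forall>T\<in>\<Omega>. \<exists>V\<in>\<V>. \<forall>T'\<in>\<Omega>. close e T T' \<longrightarrow> T' \<in> p ` V)"
proof -
  have "\<exists>\<W>\<subseteq>(\<lambda>V. p ` V) ` {V. slice V}. finite \<W> \<and> (\<exists>e>0. \<forall>T\<in>\<Omega>. \<exists>U\<in>\<W>. \<forall>T'\<in>\<Omega>. close e T T' \<longrightarrow> T' \<in> U)"
  proof (rule lebesgue_finite[OF seq_compact_Omega])
    fix T assume "T \<in> \<Omega>"
    then obtain x where x: "x \<in> C" "p x = T" using fibre_ex by blast
    then obtain V where V: "slice V" "x \<in> V" using slice_ex by blast
    then show "\<exists>U\<in>(\<lambda>V. p ` V) ` {V. slice V}. openin (top_of_set \<Omega>) U \<and> T \<in> U"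
      using slice_image_openin[OF V(1)] x(2) by (intro bexI[of _ "p ` V"]) auto
  qed
  then obtain \<W> e where W: "\<W> \<subseteq> (\<lambda>V. p ` V) ` {V. slice V}" "finite \<W>" "e > 0"
    "\<forall>T\<in>\<Omega>. \<exists>U\<in>\<W>. \<forall>T'\<in>\<Omega>. close e T T' \<longrightarrow> T' \<in> U" by blast
  obtain \<V> where V: "\<V> \<subseteq> {V. slice V}" "finite \<V>" "\<W> = (\<lambda>V. p ` V) ` \<V>"
    using finite_subset_image[OF W(2,1)] by blast
  have "\<exists>V\<in>\<V>. \<forall>T'\<in>\<Omega>. close (min e (1/4)) T T' \<longrightarrow> T' \<in> p ` V" if T: "T \<in> \<Omega>" for T
  proof -
    obtain V where "V \<in> \<V>" "\<forall>T'\<in>\<Omega>. close e T T' \<longrightarrow> T' \<in> p ` V" using W(4) T V(3) by blast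
    moreover have "close e T T'" if "close (min e (1/4)) T T'" for T'
      using that W(3) by (elim close_mono) auto
    ultimately show ?thesis by blast
  qed
  then show ?thesis using V(1,2) W(3) by (intro exI[of _ \<V>] exI[of _ "min e (1/4)"]) auto
qed

text \<open>Finiteness of the family matters: in \<open>near_tendsto\<close> one of its slices is
  selected by the pigeonhole principle.\<close>

definition slices where
  "slices = (SOME \<V>. \<exists>e. finite \<V> \<and> e > 0 \<and> e \<le> 1/4 \<and> (\<forall>V\<in>\<V>. slice V) \<and>
    (\<forall>T\<in>\<Omega>. \<exists>V\<in>\<V>. \<forall>T'\<in>\<Omega>. close e T T' \<longrightarrow> T' \<in> p ` V))"

definition e0 :: real where
  "e0 = (SOME e. finite slices \<and> e > 0 \<and> e \<le> 1/4 \<and> (\<forall>V\<in>slices. slice V) \<and>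
    (\<forall>T\<in>\<Omega>. \<exists>V\<in>slices. \<forall>T'\<in>\<Omega>. close e T T' \<longrightarrow> T' \<in> p ` V))"

lemma slices_all: "finite slices \<and> e0 > 0 \<and> e0 \<le> 1/4 \<and> (\<forall>V\<in>slices. slice V) \<and>
    (\<forall>T\<in>\<Omega>. \<exists>V\<in>slices. \<forall>T'\<in>\<Omega>. close e0 T T' \<longrightarrow> T' \<in> p ` V)"
  unfolding e0_def by (rule someI_ex) (use someI_ex[OF lebesgue_slices] in \<open>simp add: slices_def\<close>)

lemma finite_slices: "finite slices" and e0: "e0 > 0" "e0 \<le> 1/4"
  and slices_slice: "V \<in> slices \<Longrightarrow> slice V"
  and slices_lebesgue: "T \<in> \<Omega> \<Longrightarrow> \<exists>V\<in>slices. \<forall>T'\<in>\<Omega>. close e0 T T' \<longrightarrow> T' \<in> p ` V"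
  using slices_all by blast+

text \<open>The finite family covers \<Omega> but need not cover \<open>C\<close>. Transitivity on
  fibres supplies a deck transformation that moves a slice of the family to one through
  \<open>x\<close>.\<close>

lemma slice_around:
  assumes x: "x \<in> C"
  shows "\<exists>V. slice V \<and> x \<in> V \<and> (\<forall>T'\<in>\<Omega>. close e0 (p x) T' \<longrightarrow> T' \<in> p ` V)"
proof -
  obtain V where V: "V \<in> slices" "\<forall>T'\<in>\<Omega>. close e0 (p x) T' \<longrightarrow> T' \<in> p ` V"
    using slices_lebesgue x by (meson p_mem)
  have sV: "slice V" by (rule slices_slice[OF V(1)])
  have "p x \<in> p ` V" by (rule V(2)[rule_format, OF p_mem[OF x] close_refl[OF e0(1)]])
  then obtain y where y: "y \<in> V" "p x = p y" by blast
  have yC: "y \<in> C" using y(1) slice_subset[OF sV] by blast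
  obtain g where g: "g \<in> G" "g y = x" using deck_transitive[OF yC x] y(2) by auto
  have "p ` g ` V = p ` V"
    using slice_subset[OF sV] g(1) by (simp add: image_image subset_iff)
  then show ?thesis
    using deck_slice[OF g(1) sV] y(1) g(2) V(2) by (intro exI[of _ "g ` V"]) auto
qed

text \<open>Over a limit of the projected sequence, the points are deck translates of points in one
  slice. The deck group is finite, so one transformation can be fixed along a subsequence.\<close>

lemma seq_compact_C: "seq_compact C"
proof (rule seq_compactI)
  fix X :: "nat \<Rightarrow> 'c" assume X: "\<forall>n. X n \<in> C"
  then have "p (X n) \<in> \<Omega>" for n by simp
  from seq_compactD[OF seq_compact_Omega this] obtain T r where
    r: "T \<in> \<Omega>" "strict_mono (r :: nat \<Rightarrow> nat)" "((\<lambda>n. p (X n)) \<circ> r) \<longlonglongrightarrow> T" .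
  obtain y where y: "y \<in> C" "p y = T" using fibre_ex[OF r(1)] by blast
  obtain V where V: "slice V" "y \<in> V" using slice_ex[OF y(1)] by blast
  have "p y \<in> p ` V" using V(2) by blast
  then have "\<forall>\<^sub>F n in sequentially. p (X (r n)) \<in> p ` V"
    using r(3) X by (intro tendsto_mem_openin[OF slice_image_openin[OF V(1)]]) (simp_all add: y(2) o_def)
  then obtain N where N: "\<And>n. n \<ge> N \<Longrightarrow> p (X (r n)) \<in> p ` V"
    unfolding eventually_sequentially by blast
  have "\<exists>s g. s \<in> V \<and> g \<in> G \<and> p s = p (X (r (n + N))) \<and> X (r (n + N)) = g s" for n
  proof -
    obtain s where s: "s \<in> V" "p (X (r (n + N))) = p s" using N[of "n + N"] by auto
    have "s \<in> C" using s(1) slice_subset[OF V(1)] by blast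
    then obtain g where "g \<in> G" "g s = X (r (n + N))"
      using deck_transitive[of s "X (r (n + N))"] X s(2) by auto
    then show ?thesis using s by metis
  qed
  then obtain s g where sg: "\<And>n. s n \<in> V" "\<And>n. g n \<in> G" "\<And>n. p (s n) = p (X (r (n + N)))" "\<And>n. X (r (n + N)) = g n (s n)"
    by metis
  obtain q :: "nat \<Rightarrow> nat" and h where q: "strict_mono q" "h \<in> G" "\<forall>n. g (q n) = h"
    using constant_subseq[OF finite_deck sg(2)] .
  have m: "strict_mono (\<lambda>n. q n + N)" using q(1) by (simp add: strict_mono_def)
  have "(\<lambda>n. p (s (q n))) \<longlonglongrightarrow> p y"
    using LIMSEQ_subseq_LIMSEQ[OF r(3) m] by (simp add: o_def sg(3) y(2))
  then have "(\<lambda>n. s (q n)) \<longlonglongrightarrow> y" using sg(1) by (intro slice_tendsto[OF V]) simp_all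
  then have "(\<lambda>n. h (s (q n))) \<longlonglongrightarrow> h y"
    using sg(1) slice_subset[OF V(1)] by (intro deck_tendsto[OF q(2) _ y(1)]) auto
  moreover have "(\<lambda>n. h (s (q n))) = X \<circ> (r \<circ> (\<lambda>n. q n + N))"
    by (rule ext) (use sg(4) q(3) in simp)
  ultimately have "(X \<circ> (r \<circ> (\<lambda>n. q n + N))) \<longlonglongrightarrow> h y" by simp
  moreover have "strict_mono (r \<circ> (\<lambda>n. q n + N))" using r(2) m by (rule strict_mono_o)
  ultimately show "\<exists>l\<in>C. \<exists>r. strict_mono r \<and> (X \<circ> r) \<longlonglongrightarrow> l" using q(2) y(1) by (meson deck_mem)
qed

end

section \<open>The translation flow of a cover\<close>

lemma close_tr: "norm w < e \<Longrightarrow> close e T (tr w T)"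
  unfolding close_eq by blast

context tiling_cover
begin

text \<open>\<open>y\<close> is the end point of the lift, starting at \<open>x\<close>, of the
  straight path of translations from \<open>p x\<close> to \<open>tr v (p x)\<close>. The whole path
  has to lie under one sheet, so the lift is obtained by inverting \<open>p\<close> there.\<close>

definition seg :: "'c \<Rightarrow> 'a \<Rightarrow> 'c \<Rightarrow> bool" where
  "seg x v y \<longleftrightarrow> (\<exists>V. slice V \<and> x \<in> V \<and> y \<in> V \<and> p y = tr v (p x) \<and>
     (\<forall>s\<in>{0..1}. tr (s *\<^sub>R v) (p x) \<in> p ` V))"

lemma seg_lift:
  assumes "seg x v y"
  obtains f where "\<forall>s\<in>{0..1}. f s \<in> C \<and> p (f s) = tr (s *\<^sub>R v) (p x)" "f 0 = x" "f 1 = y"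
    "\<forall>s\<in>{0..1::real}. \<forall>X. (\<forall>n. X n \<in> {0..1}) \<longrightarrow> X \<longlonglongrightarrow> s \<longrightarrow> (\<lambda>n. f (X n)) \<longlonglongrightarrow> f s"
proof -
  obtain V where V: "slice V" "x \<in> V" "y \<in> V" "p y = tr v (p x)" "\<forall>s\<in>{0..1}. tr (s *\<^sub>R v) (p x) \<in> p ` V"
    using assms unfolding seg_def by blast
  have "\<forall>s\<in>{0..1}. \<exists>z. z \<in> V \<and> p z = tr (s *\<^sub>R v) (p x)" using V(5) by (metis imageE)
  then obtain f where f: "\<forall>s\<in>{0..1}. f s \<in> V \<and> p (f s) = tr (s *\<^sub>R v) (p x)" by metis
  show thesis
  proof (rule that)
    show "\<forall>s\<in>{0..1}. f s \<in> C \<and> p (f s) = tr (s *\<^sub>R v) (p x)"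
      using f slice_subset[OF V(1)] by blast
    have "p (f 0) = p x" "f 0 \<in> V" using bspec[OF f, of 0] by simp_all
    then show "f 0 = x" using slice_inj[OF V(1)] V(2) by blast
    have "p (f 1) = p y" "f 1 \<in> V" using bspec[OF f, of 1] V(4) by simp_all
    then show "f 1 = y" using slice_inj[OF V(1)] V(3) by blast
    show "\<forall>s\<in>{0..1::real}. \<forall>X. (\<forall>n. X n \<in> {0..1}) \<longrightarrow> X \<longlonglongrightarrow> s \<longrightarrow> (\<lambda>n. f (X n)) \<longlonglongrightarrow> f s"
    proof (intro ballI allI impI)
      fix s :: real and X assume s: "s \<in> {0..1}" and X: "\<forall>n. X n \<in> {0..1::real}" "X \<longlonglongrightarrow> s"
      have "(\<lambda>n. tr (X n *\<^sub>R v) (p x)) \<longlonglongrightarrow> tr (s *\<^sub>R v) (p x)"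
        using X(2) by (intro tendsto_tr tendsto_intros)
      moreover have "(\<lambda>n. tr (X n *\<^sub>R v) (p x)) = (\<lambda>n. p (f (X n)))" using f X(1) by simp
      ultimately have "(\<lambda>n. p (f (X n))) \<longlonglongrightarrow> p (f s)" using f s by simp
      then show "(\<lambda>n. f (X n)) \<longlonglongrightarrow> f s"
        using f s X(1) by (intro slice_tendsto[OF V(1)]) simp_all
    qed
  qed
qed

text \<open>The two segments may run in different sheets. Agreement of the lifted paths is locally
  constant on \<open>{0..1}\<close>, and they agree at 0.\<close>

lemma seg_unique:
  assumes "seg x v y" "seg x v y'"
  shows "y = y'"
proof -
  obtain f where f: "\<forall>s\<in>{0..1}. f s \<in> C \<and> p (f s) = tr (s *\<^sub>R v) (p x)" "f 0 = x" "f 1 = y"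
    "\<forall>s\<in>{0..1::real}. \<forall>X. (\<forall>n. X n \<in> {0..1}) \<longrightarrow> X \<longlonglongrightarrow> s \<longrightarrow> (\<lambda>n. f (X n)) \<longlonglongrightarrow> f s"
    using seg_lift[OF assms(1)] .
  obtain h where h: "\<forall>s\<in>{0..1}. h s \<in> C \<and> p (h s) = tr (s *\<^sub>R v) (p x)" "h 0 = x" "h 1 = y'"
    "\<forall>s\<in>{0..1::real}. \<forall>X. (\<forall>n. X n \<in> {0..1}) \<longrightarrow> X \<longlonglongrightarrow> s \<longrightarrow> (\<lambda>n. h (X n)) \<longlonglongrightarrow> h s"
    using seg_lift[OF assms(2)] .
  have "(f 0 = h 0) = (f 1 = h 1)"
  proof (rule seq_nhds_connected_const[OF seq_nhds_first_countable, where S = "{0..1::real}" and P = "\<lambda>s. f s = h s"])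
    fix s X assume s: "s \<in> {0..1::real}" and X: "\<And>n. X n \<in> {0..1::real}" "X \<longlonglongrightarrow> s"
    have lim: "(\<lambda>n. f (X n)) \<longlonglongrightarrow> f s" "(\<lambda>n. h (X n)) \<longlonglongrightarrow> h s" using f(4) h(4) s X by blast+
    have pts: "f s \<in> C" "h s \<in> C" "p (f s) = p (h s)" "\<And>n. f (X n) \<in> C" "\<And>n. h (X n) \<in> C"
      "\<And>n. p (f (X n)) = p (h (X n))"
      using f(1) h(1) s X(1) by simp_all
    show "\<forall>\<^sub>F n in sequentially. (f (X n) = h (X n)) = (f s = h s)"
    proof (cases "f s = h s")
      case True
      then have "\<forall>\<^sub>F n in sequentially. f (X n) = h (X n)"
        using lim pts by (intro eventually_eq_over[of "f s"]) simp_all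
      then show ?thesis by eventually_elim (use True in simp)
    next
      case False
      then have "\<forall>\<^sub>F n in sequentially. f (X n) \<noteq> h (X n)"
        using lim pts by (intro eventually_neq_over[of "f s" "h s"]) simp_all
      then show ?thesis by eventually_elim (use False in simp)
    qed
  qed simp_all
  then show ?thesis using f(2,3) h(2,3) by simp
qed

lemma seg_in:
  assumes "slice V" "x \<in> V" "\<forall>T'\<in>\<Omega>. close e0 (p x) T' \<longrightarrow> T' \<in> p ` V" "y \<in> V" "p y = tr v (p x)" "norm v < e0"
  shows "seg x v y"
proof -
  have "tr (s *\<^sub>R v) (p x) \<in> p ` V" if s: "s \<in> {0..1}" for s
  proof -
    have "norm (s *\<^sub>R v) \<le> norm v" using s by (simp add: mult_left_le_one_le)
    then have "close e0 (p x) (tr (s *\<^sub>R v) (p x))" using assms(6) by (intro close_tr) linarith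
    moreover have "tr (s *\<^sub>R v) (p x) \<in> \<Omega>" using assms(2) slice_subset[OF assms(1)] by auto
    ultimately show ?thesis using assms(3) by blast
  qed
  with assms show ?thesis unfolding seg_def by blast
qed

text \<open>Extending by the identity outside \<open>C\<close> makes the composition law below unconditional.\<close>

definition act :: "'a \<Rightarrow> 'c \<Rightarrow> 'c" where
  "act v x = (if x \<in> C then THE y. seg x v y else x)"

lemma act_eq: "seg x v y \<Longrightarrow> x \<in> C \<Longrightarrow> act v x = y"
  unfolding act_def using seg_unique by (simp add: the_equality)

lemma act_slice:
  assumes "slice V" "x \<in> V" "\<forall>T'\<in>\<Omega>. close e0 (p x) T' \<longrightarrow> T' \<in> p ` V" "norm v < e0"
  shows "act v x \<in> V \<and> p (act v x) = tr v (p x)"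
proof -
  have x: "x \<in> C" using assms(2) slice_subset[OF assms(1)] by blast
  have "tr v (p x) \<in> p ` V"
    by (rule assms(3)[rule_format, OF _ close_tr[OF assms(4)]]) (use x in simp)
  then obtain y where y: "y \<in> V" "p y = tr v (p x)" by (metis imageE)
  have "act v x = y" using seg_in[OF assms(1-3) y assms(4)] x by (rule act_eq)
  with y show ?thesis by simp
qed

lemma act_mem:
  assumes "norm v < e0" "x \<in> C"
  shows "act v x \<in> C" "p (act v x) = tr v (p x)"
proof -
  obtain V where V: "slice V" "x \<in> V" "\<forall>T'\<in>\<Omega>. close e0 (p x) T' \<longrightarrow> T' \<in> p ` V"
    using slice_around[OF assms(2)] by blast
  from act_slice[OF V assms(1)] slice_subset[OF V(1)]
  show "act v x \<in> C" "p (act v x) = tr v (p x)" by auto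
qed

text \<open>The bound keeps the whole broken path under one slice around \<open>x\<close>, so both
  routes end in the same sheet over the same tiling.\<close>

lemma act_comp:
  assumes "norm v + norm w < e0"
  shows "act w (act v x) = act (w + v) x"
proof (cases "x \<in> C")
  case True
  obtain V where V: "slice V" "x \<in> V" "\<forall>T'\<in>\<Omega>. close e0 (p x) T' \<longrightarrow> T' \<in> p ` V"
    using slice_around[OF True] by blast
  have nv: "norm v < e0" using assms norm_ge_zero[of w] by linarith
  have nwv: "norm (w + v) < e0" using assms norm_triangle_ineq[of w v] by linarith
  have y: "act v x \<in> V" "p (act v x) = tr v (p x)" using act_slice[OF V nv] by simp_all
  have z: "act (w + v) x \<in> V" "p (act (w + v) x) = tr (w + v) (p x)" using act_slice[OF V nwv] by simp_all
  have "tr (s *\<^sub>R w) (p (act v x)) \<in> p ` V" if s: "s \<in> {0..1}" for s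
  proof -
    have "norm (s *\<^sub>R w) \<le> norm w" using s by (simp add: mult_left_le_one_le)
    then have "norm (s *\<^sub>R w + v) < e0" using assms norm_triangle_ineq[of "s *\<^sub>R w" v] by linarith
    from close_tr[OF this] have "close e0 (p x) (tr (s *\<^sub>R w) (p (act v x)))" by (simp add: y(2))
    then show ?thesis using V(3) True by (simp add: y(2))
  qed
  then have "seg (act v x) w (act (w + v) x)"
    unfolding seg_def using V(1) y z by (intro exI[of _ V]) simp
  then show ?thesis using act_mem(1)[OF nv True] by (rule act_eq)
qed (simp add: act_def)

lemma act_0: "act 0 x = x"
proof (cases "x \<in> C")
  case True
  obtain V where V: "slice V" "x \<in> V" "\<forall>T'\<in>\<Omega>. close e0 (p x) T' \<longrightarrow> T' \<in> p ` V"
    using slice_around[OF True] by blast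
  have "seg x 0 x" using e0(1) V(2) by (intro seg_in[OF V]) simp_all
  then show ?thesis using True by (rule act_eq)
qed (simp add: act_def)

lemma act_deck:
  assumes "g \<in> G" "x \<in> C" "norm v < e0"
  shows "act v (g x) = g (act v x)"
proof -
  obtain V where V: "slice V" "x \<in> V" "\<forall>T'\<in>\<Omega>. close e0 (p x) T' \<longrightarrow> T' \<in> p ` V"
    using slice_around[OF assms(2)] by blast
  have VC: "V \<subseteq> C" by (rule slice_subset[OF V(1)])
  have y: "act v x \<in> V" "p (act v x) = tr v (p x)" using act_slice[OF V assms(3)] by simp_all
  have im: "p ` g ` V = p ` V" using VC assms(1) by (simp add: image_image subset_iff)
  have "seg (g x) v (g (act v x))"
  proof (rule seg_in[OF deck_slice[OF assms(1) V(1)]])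
    show "\<forall>T'\<in>\<Omega>. close e0 (p (g x)) T' \<longrightarrow> T' \<in> p ` g ` V"
      unfolding im using V(3) assms(1,2) by simp
    show "p (g (act v x)) = tr v (p (g x))"
      using y VC assms(1,2) by (simp add: subset_iff)
  qed (use V(2) y(1) assms(3) in simp_all)
  then show ?thesis using assms(1,2) by (intro act_eq) simp_all
qed

lemma act_tendsto:
  assumes X: "X \<longlonglongrightarrow> x" "x \<in> C" "\<And>n. X n \<in> C" and u: "u \<longlonglongrightarrow> v" and v: "norm v < e0"
  shows "(\<lambda>n. act (u n) (X n)) \<longlonglongrightarrow> act v x"
proof -
  obtain V where V: "slice V" "x \<in> V" "\<forall>T'\<in>\<Omega>. close e0 (p x) T' \<longrightarrow> T' \<in> p ` V"
    using slice_around[OF X(2)] by blast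
  \<comment> \<open>\<open>b\<close> separates the lengths of the steps \<open>u n\<close> from
    \<open>e0\<close>, and \<open>a\<close> is chosen so that closeness at scale \<open>a\<close>
    followed by a step of length below \<open>b\<close> remains closeness at scale
    \<open>e0\<close>.\<close>
  define b where "b = (norm v + e0) / 2"
  have b: "norm v < b" "b < e0" "b > 0"
    using v e0(1) add_nonneg_pos[of "norm v" e0] by (simp_all add: b_def)
  define a where "a = min (e0 - b) (1 / (1 / e0 + b))"
  have pos: "1 / e0 + b > 0" using e0 b by (intro add_pos_pos) simp_all
  then have a: "a > 0" "a + b \<le> e0" using b by (auto simp: a_def)
  have "a \<le> 1 / (1 / e0 + b)" by (simp add: a_def)
  then have "1 / a \<ge> 1 / e0 + b" using a(1) pos by (simp add: field_simps)
  then have ab: "1 / e0 \<le> 1 / a - b" by simp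
  have be: "1 / e0 \<le> 1 / b" using b by (intro divide_left_mono) simp_all
  have "\<forall>\<^sub>F n in sequentially. close a (p x) (p (X n))"
    using tendsto_p[OF X] a(1) by (rule eventually_close)
  moreover have "\<forall>\<^sub>F n in sequentially. norm (u n) < b"
    using order_tendstoD(2)[OF tendsto_norm[OF u] b(1)] .
  moreover have "\<forall>\<^sub>F n in sequentially. X n \<in> V"
    by (rule tendsto_mem_openin[OF slice_openin[OF V(1)] V(2) X(1,3)])
  ultimately have ev: "\<forall>\<^sub>F n in sequentially. act (u n) (X n) \<in> V \<and> p (act (u n) (X n)) = tr (u n) (p (X n))"
  proof eventually_elim
    case (elim n)
    have path: "tr w (p (X n)) \<in> p ` V" if "norm w \<le> norm (u n)" for w
    proof -
      have "close b (p (X n)) (tr w (p (X n)))" using that elim(2) by (intro close_tr) linarith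
      from close_trans[OF elim(1) this a(1) b(3) a(2) ab be] show ?thesis
        using V(3) X(3) by simp
    qed
    obtain y where y: "y \<in> V" "p y = tr (u n) (p (X n))" using path[of "u n"] by (metis imageE order_refl)
    have "seg (X n) (u n) y"
      unfolding seg_def using V(1) elim(3) y path
      by (intro exI[of _ V]) (simp add: mult_left_le_one_le)
    then have "act (u n) (X n) = y" using X(3) by (rule act_eq)
    with y show ?case by simp
  qed
  have y: "act v x \<in> V" "p (act v x) = tr v (p x)" using act_slice[OF V v] by simp_all
  have "(\<lambda>n. tr (u n) (p (X n))) \<longlonglongrightarrow> p (act v x)"
    unfolding y(2) using tendsto_p[OF X] u by (rule tendsto_tr)
  then have "(\<lambda>n. p (act (u n) (X n))) \<longlonglongrightarrow> p (act v x)"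
    by (rule Lim_transform_eventually) (use ev in eventually_elim, simp)
  then show ?thesis
    using ev y(1) by (intro slice_tendsto[OF V(1)]) (auto elim: eventually_mono)
qed

text \<open>Since the local actions of small vectors commute, they extend to an action of the whole
  vector space by composing many small steps.\<close>

definition steps :: "'a \<Rightarrow> nat" where "steps v = Suc (nat \<lceil>norm v / e0\<rceil>)"

definition flow :: "'a \<Rightarrow> 'c \<Rightarrow> 'c" where
  "flow v = act (v /\<^sub>R real (steps v)) ^^ steps v"

lemma steps: "steps v > 0" "norm v < real (steps v) * e0"
proof -
  have "norm v / e0 < real (steps v)" unfolding steps_def by linarith
  then show "norm v < real (steps v) * e0" using e0(1) by (simp add: field_simps)
qed (simp add: steps_def)

lemma act_pow: "real k * norm w < e0 \<Longrightarrow> act w ^^ k = act (real k *\<^sub>R w)"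
proof (induction k)
  case 0
  then show ?case by (simp add: fun_eq_iff act_0)
next
  case (Suc k)
  have "real k * norm w + norm w < e0" using Suc.prems by (simp add: algebra_simps)
  moreover from this have "real k * norm w < e0" using norm_ge_zero[of w] by linarith
  ultimately have *: "real k * norm w < e0" "norm (real k *\<^sub>R w) + norm w < e0" by simp_all
  have "(act w ^^ Suc k) x = act (real (Suc k) *\<^sub>R w) x" for x
    using Suc.IH[OF *(1)] act_comp[OF *(2)] by (simp add: algebra_simps)
  then show ?case by (rule ext)
qed

lemma act_pow_refine:
  assumes "n > 0" "m > 0" "norm v < real n * e0"
  shows "act (v /\<^sub>R real n) ^^ n = act (v /\<^sub>R (real m * real n)) ^^ (m * n)"
proof -
  have eq: "real m *\<^sub>R (v /\<^sub>R (real m * real n)) = v /\<^sub>R real n"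
    using assms(2) by (simp add: field_simps)
  have "real m * norm (v /\<^sub>R (real m * real n)) = norm (real m *\<^sub>R (v /\<^sub>R (real m * real n)))"
    by simp
  also have "\<dots> = norm v / real n" unfolding eq by (simp add: divide_inverse mult.commute)
  also have "\<dots> < e0" using assms by (simp add: field_simps)
  finally have "act (v /\<^sub>R (real m * real n)) ^^ m = act (v /\<^sub>R real n)"
    by (simp only: act_pow eq)
  then show ?thesis by (simp only: funpow_mult[symmetric])
qed

text \<open>Two admissible numbers of steps are compared by refining both to their product, so the
  choice made in \<open>steps\<close> does not affect \<open>flow\<close>.\<close>

lemma flow_eq:
  assumes "n > 0" "norm v < real n * e0"
  shows "flow v = act (v /\<^sub>R real n) ^^ n"
  using act_pow_refine[OF assms(1) steps(1)[of v] assms(2)] act_pow_refine[OF steps(1) assms(1) steps(2), of v]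
  unfolding flow_def by (simp add: mult.commute)

lemma flow_small: "norm v < e0 \<Longrightarrow> flow v = act v"
  using flow_eq[of 1 v] by simp

lemma funpow_comp_commute:
  assumes "\<And>x :: 'x. f (g x) = g (f x)"
  shows "((f \<circ> g) ^^ n) x = (f ^^ n) ((g ^^ n) x)"
proof (induction n)
  case (Suc n)
  have "g ((f ^^ n) y) = (f ^^ n) (g y)" for n y
    by (induction n) (simp_all add: assms[symmetric])
  with Suc show ?case by simp
qed simp

lemma flow_add: "flow v (flow w x) = flow (v + w) x"
proof -
  \<comment> \<open>One number of steps is large enough for \<open>v\<close>, \<open>w\<close> and
    \<open>v + w\<close> at once; the small steps for \<open>v\<close> and \<open>w\<close> commute
    and compose to those for \<open>v + w\<close>.\<close>
  obtain n :: nat where n: "(norm v + norm w) / e0 < real n" using reals_Archimedean2 by blast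
  have "0 \<le> (norm v + norm w) / e0" using e0(1) by simp
  then have n0: "n > 0" using n by (cases n) auto
  have small: "norm v + norm w < real n * e0" using n e0(1) by (simp add: field_simps)
  have sm: "norm (w /\<^sub>R real n) + norm (v /\<^sub>R real n) < e0" "norm (v /\<^sub>R real n) + norm (w /\<^sub>R real n) < e0"
    using small n0 by (simp_all add: field_simps)
  have comp: "act (v /\<^sub>R real n) \<circ> act (w /\<^sub>R real n) = act ((v + w) /\<^sub>R real n)"
    "act (w /\<^sub>R real n) \<circ> act (v /\<^sub>R real n) = act ((v + w) /\<^sub>R real n)"
    using act_comp[OF sm(1)] act_comp[OF sm(2)] by (simp_all add: fun_eq_iff scaleR_add_right add.commute)
  have "flow (v + w) = act ((v + w) /\<^sub>R real n) ^^ n"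
    using norm_triangle_ineq[of v w] small by (intro flow_eq n0) linarith
  then have "flow (v + w) x = ((act (v /\<^sub>R real n) \<circ> act (w /\<^sub>R real n)) ^^ n) x"
    unfolding comp(1) by simp
  also have "\<dots> = (act (v /\<^sub>R real n) ^^ n) ((act (w /\<^sub>R real n) ^^ n) x)"
    by (rule funpow_comp_commute) (use comp in \<open>simp add: fun_eq_iff\<close>)
  finally have eq: "flow (v + w) x = (act (v /\<^sub>R real n) ^^ n) ((act (w /\<^sub>R real n) ^^ n) x)" .
  show ?thesis
  proof -
    have "norm v < real n * e0" "norm w < real n * e0"
      using small norm_ge_zero[of v] norm_ge_zero[of w] by linarith+
    then show ?thesis unfolding eq using flow_eq[OF n0] by simp
  qed
qed

lemma flow_0: "flow 0 x = x"
  using e0(1) by (simp add: flow_small act_0)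

lemma flow_inverse [simp]: "flow (- v) (flow v x) = x" "flow v (flow (- v) x) = x"
  by (simp_all add: flow_add flow_0)

lemma steps_small: "norm (v /\<^sub>R real (steps v)) < e0"
  using steps[of v] by (simp add: field_simps)

lemma act_pow_mem:
  assumes "norm w < e0" "x \<in> C"
  shows "(act w ^^ k) x \<in> C \<and> p ((act w ^^ k) x) = tr (real k *\<^sub>R w) (p x)"
proof (induction k)
  case (Suc k)
  then show ?case using act_mem[OF assms(1), of "(act w ^^ k) x"] by (simp add: algebra_simps)
qed (use assms in simp)

lemma flow_mem [simp]: "x \<in> C \<Longrightarrow> flow v x \<in> C"
  using act_pow_mem[OF steps_small] by (simp add: flow_def)

lemma p_flow [simp]: "x \<in> C \<Longrightarrow> p (flow v x) = tr v (p x)"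
  using act_pow_mem[OF steps_small[of v], of x "steps v"] steps(1)[of v] by (simp add: flow_def)

lemma flow_deck: 
  assumes "g \<in> G" "x \<in> C"
  shows "flow v (g x) = g (flow v x)"
proof -
  have "(act w ^^ k) (g x) = g ((act w ^^ k) x)" if "norm w < e0" for w k
  proof (induction k)
    case (Suc k)
    then show ?case using act_deck[OF assms(1) _ that] act_pow_mem[OF that assms(2)] by simp
  qed simp
  from this[OF steps_small] show ?thesis by (simp add: flow_def)
qed

lemma tendsto_flow:
  assumes X: "X \<longlonglongrightarrow> x" "x \<in> C" "\<And>n. X n \<in> C" and u: "u \<longlonglongrightarrow> v"
  shows "(\<lambda>n. flow (u n) (X n)) \<longlonglongrightarrow> flow v x"
proof -
  have pow: "(\<lambda>n. (act w ^^ k) (X n)) \<longlonglongrightarrow> (act w ^^ k) x" if w: "norm w < e0" for w k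
  proof (induction k)
    case (Suc k)
    have "(\<lambda>n. act w ((act w ^^ k) (X n))) \<longlonglongrightarrow> act w ((act w ^^ k) x)"
      by (rule act_tendsto[OF Suc _ _ tendsto_const w]) (use act_pow_mem[OF w] X(2,3) in simp_all)
    then show ?case by simp
  qed (use X in simp)
  have fv: "(\<lambda>n. flow v (X n)) \<longlonglongrightarrow> flow v x"
    unfolding flow_def by (rule pow[OF steps_small])
  have small: "(\<lambda>n. u n - v) \<longlonglongrightarrow> 0" using u by (simp add: LIM_zero)
  \<comment> \<open>The flow by the fixed vector \<open>v\<close> is continuous as an iterate of one
    small step; the remainder \<open>u n - v\<close> is eventually a single small step.\<close>
  have "(\<lambda>n. act (u n - v) (flow v (X n))) \<longlonglongrightarrow> act 0 (flow v x)"
    using act_tendsto[OF fv _ _ small] X e0(1) by simp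
  moreover have "\<forall>\<^sub>F n in sequentially. act (u n - v) (flow v (X n)) = flow (u n) (X n)"
  proof -
    have "\<forall>\<^sub>F n in sequentially. norm (u n - v) < e0"
      using small e0(1) unfolding tendsto_iff by simp
    then show ?thesis
    proof eventually_elim
      case (elim n)
      then show ?case using flow_small[of "u n - v"] flow_add[of "u n - v" v "X n"] by simp
    qed
  qed
  ultimately show ?thesis using Lim_transform_eventually by (force simp: act_0)
qed

section \<open>Nearby points in the same sheet\<close>

text \<open>This is \<open>1 / (e0 / 4)\<close>, the radius on which \<open>close\<close> at scale
  \<open>e0 / 4\<close> compares tilings.\<close>

definition R0 :: real where "R0 = 4 / e0"

text \<open>The slice is a function of the patch of radius \<open>R0\<close> alone. It is chosen for
  one tiling with that patch and still works for every other one at the smaller scale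
  \<open>e0 / 4\<close>.\<close>

definition patch_slice where
  "patch_slice P = (SOME V. V \<in> slices \<and> (\<exists>T\<in>\<Omega>. cp R0 T = P \<and> (\<forall>T'\<in>\<Omega>. close e0 T T' \<longrightarrow> T' \<in> p ` V)))"

lemma patch_slice:
  assumes T: "T \<in> \<Omega>"
  shows "patch_slice (cp R0 T) \<in> slices"
    "\<forall>T'\<in>\<Omega>. close (e0 / 4) T T' \<longrightarrow> T' \<in> p ` patch_slice (cp R0 T)"
proof -
  have "\<exists>V. V \<in> slices \<and> (\<exists>T1\<in>\<Omega>. cp R0 T1 = cp R0 T \<and> (\<forall>T'\<in>\<Omega>. close e0 T1 T' \<longrightarrow> T' \<in> p ` V))"
    using slices_lebesgue[OF T] T by blast
  from someI_ex[OF this, folded patch_slice_def]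
  have P: "patch_slice (cp R0 T) \<in> slices"
    "\<exists>T1\<in>\<Omega>. cp R0 T1 = cp R0 T \<and> (\<forall>T'\<in>\<Omega>. close e0 T1 T' \<longrightarrow> T' \<in> p ` patch_slice (cp R0 T))"
    by simp_all
  then obtain T1 where T1: "T1 \<in> \<Omega>" "cp R0 T1 = cp R0 T"
    "\<forall>T'\<in>\<Omega>. close e0 T1 T' \<longrightarrow> T' \<in> p ` patch_slice (cp R0 T)" by blast
  show "patch_slice (cp R0 T) \<in> slices" by (rule P(1))
  show "\<forall>T'\<in>\<Omega>. close (e0 / 4) T T' \<longrightarrow> T' \<in> p ` patch_slice (cp R0 T)"
  proof (intro ballI impI)
    fix T' assume T': "T' \<in> \<Omega>" "close (e0 / 4) T T'"
    then obtain v where v: "norm v < e0 / 4" "cp R0 T' = cp R0 (tr v T)"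
      unfolding close_eq R0_def by auto
    have R: "1 / e0 \<le> R0" "1 / e0 + norm v \<le> R0"
    proof -
      have "1 \<le> 1 / e0" using e0 by simp
      then have "1 / e0 + 1 \<le> R0" unfolding R0_def by simp
      then show "1 / e0 \<le> R0" "1 / e0 + norm v \<le> R0" using v(1) e0 by linarith+
    qed
    have "cp (1 / e0) T' = cp (1 / e0) (tr v T)" using v(2) R(1) by (rule cp_mono)
    also have "\<dots> = cp (1 / e0) (tr v T1)" using T1(2)[symmetric] R(2) by (rule cp_tr)
    finally have "close e0 T1 T'" unfolding close_eq using v(1) e0(1) by (intro exI[of _ v]) simp
    then show "T' \<in> p ` patch_slice (cp R0 T)" using T1(3) T'(1) by blast
  qed
qed

definition sec :: "('a, 'l) tiling \<Rightarrow> 'c" where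
  "sec T = (SOME x. x \<in> patch_slice (cp R0 T) \<and> p x = T)"

lemma sec:
  assumes T: "T \<in> \<Omega>"
  shows "sec T \<in> patch_slice (cp R0 T)" "p (sec T) = T" "sec T \<in> C"
proof -
  have "T \<in> p ` patch_slice (cp R0 T)"
    using patch_slice(2)[OF T] T close_refl[of "e0/4" T] e0(1) by simp
  then have "\<exists>x. x \<in> patch_slice (cp R0 T) \<and> p x = T" by (metis imageE)
  from someI_ex[OF this, folded sec_def]
  show 1: "sec T \<in> patch_slice (cp R0 T)" "p (sec T) = T" by simp_all
  show "sec T \<in> C" using 1(1) slice_subset[OF slices_slice[OF patch_slice(1)[OF T]]] by blast
qed

text \<open>The section \<open>sec\<close> is not continuous, but on tilings with a common patch of radius \<open>R0\<close> it takes
  values in a single sheet.\<close>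

definition near :: "'c \<Rightarrow> 'c \<Rightarrow> bool" where
  "near x y \<longleftrightarrow> x \<in> C \<and> y \<in> C \<and> cp R0 (p x) = cp R0 (p y) \<and> (\<exists>g\<in>G. x = g (sec (p x)) \<and> y = g (sec (p y)))"

lemma nearD: "near x y \<Longrightarrow> x \<in> C" "near x y \<Longrightarrow> y \<in> C" "near x y \<Longrightarrow> cp R0 (p x) = cp R0 (p y)"
  by (auto simp: near_def)

lemma deck_sec: "x \<in> C \<Longrightarrow> \<exists>g\<in>G. x = g (sec (p x))"
proof -
  assume x: "x \<in> C"
  then have "p x \<in> \<Omega>" by simp
  from deck_transitive[OF sec(3)[OF this] x sec(2)[OF this]] show ?thesis by metis
qed

lemma near_refl: "x \<in> C \<Longrightarrow> near x x"
  using deck_sec[of x] by (simp add: near_def)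

lemma near_sym: "near x y \<Longrightarrow> near y x"
  by (auto simp: near_def)

text \<open>Both comparisons write \<open>y\<close> as a deck translate of the same point of the
  section, hence they use the same deck transformation.\<close>

lemma near_trans:
  assumes "near x y" "near y z"
  shows "near x z"
proof -
  obtain g where g: "g \<in> G" "x = g (sec (p x))" "y = g (sec (p y))" using assms(1) by (auto simp: near_def)
  obtain h where h: "h \<in> G" "y = h (sec (p y))" "z = h (sec (p z))" using assms(2) by (auto simp: near_def)
  have "sec (p y) \<in> C" using nearD(2)[OF assms(1)] sec(3) by simp
  then have "g = h" using deck_unique[OF g(1) h(1)] g(3) h(2) by metis
  then have "\<exists>g\<in>G. x = g (sec (p x)) \<and> z = g (sec (p z))" using g h by metis
  then show ?thesis using assms unfolding near_def by simp
qed

lemma near_eq: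
  assumes "near x y" "p x = p y"
  shows "x = y"
proof -
  obtain g where "x = g (sec (p x))" "y = g (sec (p y))" using assms(1) by (auto simp: near_def)
  then show ?thesis using assms(2) by simp
qed

lemma near_ex:
  assumes "x \<in> C" "T \<in> \<Omega>" "cp R0 (p x) = cp R0 T"
  shows "\<exists>y. near x y \<and> p y = T"
proof -
  obtain g where g: "g \<in> G" "x = g (sec (p x))" using deck_sec[OF assms(1)] by blast
  have "p (g (sec T)) = T" "g (sec T) \<in> C" using sec[OF assms(2)] g(1) by simp_all
  then show ?thesis
    using g assms(1,3) by (intro exI[of _ "g (sec T)"]) (auto simp: near_def)
qed

text \<open>Some pair of a deck transformation and a slice occurs infinitely often. Along that
  subsequence both sequences move in one sheet, where convergence can be tested after applying
  \<open>p\<close>.\<close>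

lemma near_tendsto:
  assumes N: "\<And>n. near (X n) (Y n)" and X: "X \<longlonglongrightarrow> x" "x \<in> C" and Y: "(\<lambda>n. p (Y n)) \<longlonglongrightarrow> p x"
  shows "Y \<longlonglongrightarrow> x"
proof (rule tendsto_by_subseq)
  fix r :: "nat \<Rightarrow> nat" assume r: "strict_mono r"
  have XC: "\<And>n. X n \<in> C" and YC: "\<And>n. Y n \<in> C" using N nearD by blast+
  have "\<exists>g\<in>G. X n = g (sec (p (X n))) \<and> Y n = g (sec (p (Y n)))" for n
    using N[of n] by (simp add: near_def)
  then obtain g where g: "\<And>n. g n \<in> G" "\<And>n. X n = g n (sec (p (X n)))" "\<And>n. Y n = g n (sec (p (Y n)))"
    by metis
  define V where "V n = patch_slice (cp R0 (p (X n)))" for n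
  have V: "V n \<in> slices" "sec (p (X n)) \<in> V n" "sec (p (Y n)) \<in> V n" for n
    using patch_slice(1)[of "p (X n)"] sec(1)[of "p (X n)"] sec(1)[of "p (Y n)"] nearD(3)[OF N[of n]] XC YC
    by (simp_all add: V_def)
  have "finite (G \<times> slices)" using finite_deck finite_slices by simp
  moreover have "(g (r n), V (r n)) \<in> G \<times> slices" for n using g(1) V(1) by simp
  ultimately obtain s :: "nat \<Rightarrow> nat" and z where s: "strict_mono s" "z \<in> G \<times> slices" "\<forall>n. (g (r (s n)), V (r (s n))) = z"
    by (rule constant_subseq)
  obtain h W where hW: "z = (h, W)" by (cases z)
  have hW': "h \<in> G" "W \<in> slices" "g (r (s n)) = h" "V (r (s n)) = W" for n
    using s(2,3) hW by simp_all
  have sW: "slice W" by (rule slices_slice[OF hW'(2)])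
  define q where "q = r \<circ> s"
  have q: "strict_mono q" unfolding q_def using r s(1) by (rule strict_mono_o)
  have gq: "g (q n) = h" "V (q n) = W" for n using hW' by (simp_all add: q_def)
  have Xq: "(X \<circ> q) \<longlonglongrightarrow> x" using X(1) q by (rule LIMSEQ_subseq_LIMSEQ)
  have pXq: "(\<lambda>n. p (X (q n))) \<longlonglongrightarrow> p x" using tendsto_p[OF Xq X(2)] XC by simp
  have pYq: "(\<lambda>n. p (Y (q n))) \<longlonglongrightarrow> p x" using LIMSEQ_subseq_LIMSEQ[OF Y q] by (simp add: o_def)
  have "\<forall>\<^sub>F n in sequentially. close (e0 / 8) (p x) (p (X (q n)))"
    using pXq e0(1) by (intro eventually_close) simp_all
  then obtain n where "close (e0 / 8) (p x) (p (X (q n)))" unfolding eventually_sequentially by blast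
  then have "close (2 * (e0 / 8)) (p (X (q n))) (p x)" using e0 by (intro close_sym) simp_all
  then have "p x \<in> p ` V (q n)"
    using patch_slice(2)[of "p (X (q n))"] XC X(2) unfolding V_def by simp
  then obtain y where y: "y \<in> W" "p y = p x" unfolding gq by (metis imageE)
  have yC: "y \<in> C" using y(1) slice_subset[OF sW] by blast
  have secX: "(\<lambda>n. sec (p (X (q n)))) \<longlonglongrightarrow> y"
    using V(2)[of "q _"] gq(2) sec(2) XC pXq by (intro slice_tendsto[OF sW y(1)]) (simp_all add: y(2))
  have secY: "(\<lambda>n. sec (p (Y (q n)))) \<longlonglongrightarrow> y"
    using V(3)[of "q _"] gq(2) sec(2) YC pYq by (intro slice_tendsto[OF sW y(1)]) (simp_all add: y(2))
  have "(\<lambda>n. h (sec (p (X (q n))))) \<longlonglongrightarrow> h y"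
    using deck_tendsto[OF hW'(1) secX yC] sec(3) XC by simp
  moreover have "(\<lambda>n. h (sec (p (X (q n))))) = X \<circ> q" using g(2)[of "q _"] gq(1) by (simp add: fun_eq_iff)
  ultimately have "(X \<circ> q) \<longlonglongrightarrow> h y" by simp
  then have "h y = x"
    using Xq LIMSEQ_unique_C[of "h y" x "X \<circ> q"] XC hW'(1) yC X(2) by simp
  have "(\<lambda>n. h (sec (p (Y (q n))))) \<longlonglongrightarrow> h y"
    using deck_tendsto[OF hW'(1) secY yC] sec(3) YC by simp
  moreover have "(\<lambda>n. h (sec (p (Y (q n))))) = Y \<circ> q" using g(3)[of "q _"] gq(1) by (simp add: fun_eq_iff)
  ultimately have "(Y \<circ> r \<circ> s) \<longlonglongrightarrow> x" using \<open>h y = x\<close> by (simp add: q_def o_assoc)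
  then show "\<exists>s. strict_mono s \<and> (Y \<circ> r \<circ> s) \<longlonglongrightarrow> x" using s(1) by blast
qed

text \<open>Replace \<open>Y n\<close> by the point over \<open>p (Y n)\<close> that is near to
  \<open>X n\<close>. It also tends to \<open>x\<close>, and two sequences over the same tilings
  with the same limit eventually coincide.\<close>

lemma eventually_near:
  assumes X: "X \<longlonglongrightarrow> x" "\<And>n. X n \<in> C" and Y: "Y \<longlonglongrightarrow> x" "\<And>n. Y n \<in> C" and x: "x \<in> C"
    and ag: "\<forall>\<^sub>F n in sequentially. cp R0 (p (X n)) = cp R0 (p (Y n))"
  shows "\<forall>\<^sub>F n in sequentially. near (X n) (Y n)"
proof -
  obtain N where N: "\<And>n. n \<ge> N \<Longrightarrow> cp R0 (p (X n)) = cp R0 (p (Y n))"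
    using ag unfolding eventually_sequentially by blast
  have "\<exists>z. near (X (n + N)) z \<and> p z = p (Y (n + N))" for n
    using near_ex[OF X(2) _ N] Y(2) by simp
  then obtain Z where Z: "\<And>n. near (X (n + N)) (Z n)" "\<And>n. p (Z n) = p (Y (n + N))" by metis
  have "(\<lambda>n. p (Y (n + N))) \<longlonglongrightarrow> p x"
    using LIMSEQ_ignore_initial_segment[OF tendsto_p[OF Y(1) x Y(2)]] .
  then have "(\<lambda>n. p (Z n)) \<longlonglongrightarrow> p x" by (simp add: Z(2))
  then have "Z \<longlonglongrightarrow> x"
    by (rule near_tendsto[OF Z(1) LIMSEQ_ignore_initial_segment[OF X(1)] x])
  then have "\<forall>\<^sub>F n in sequentially. Z n = Y (n + N)"
    using nearD(2)[OF Z(1)] Y(2) Z(2) LIMSEQ_ignore_initial_segment[OF Y(1)]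
    by (intro eventually_eq_over[OF x]) simp_all
  then have "\<forall>\<^sub>F n in sequentially. near (X (n + N)) (Y (n + N))"
    by eventually_elim (use Z(1) in metis)
  then show ?thesis by (rule eventually_sequentially_seg[THEN iffD1])
qed

text \<open>The common core of the compactness arguments for uniform radii: counterexamples with
  growing agreement accumulate at a single point of \<open>C\<close>.\<close>

lemma near_seq_limit:
  assumes N: "\<And>n. near (X n) (Y n)" and ag: "\<And>n. cp (real n) (p (X n)) = cp (real n) (p (Y n))"
  obtains x and r :: "nat \<Rightarrow> nat" where "x \<in> C" "strict_mono r" "(\<lambda>n. X (r n)) \<longlonglongrightarrow> x" "(\<lambda>n. Y (r n)) \<longlonglongrightarrow> x"
    "\<forall>\<rho>. \<forall>\<^sub>F n in sequentially. cp \<rho> (p (X (r n))) = cp \<rho> (p (Y (r n)))"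
proof -
  have XC: "\<And>n. X n \<in> C" using N nearD by blast
  obtain x r where r: "x \<in> C" "strict_mono (r :: nat \<Rightarrow> nat)" "(X \<circ> r) \<longlonglongrightarrow> x"
    using seq_compactD[OF seq_compact_C XC] .
  have agr: "\<forall>\<^sub>F n in sequentially. cp \<rho> (p (X (r n))) = cp \<rho> (p (Y (r n)))" for \<rho>
  proof -
    obtain m :: nat where m: "\<rho> \<le> real m" using real_arch_simple by blast
    have "cp \<rho> (p (X (r n))) = cp \<rho> (p (Y (r n)))" if "n \<ge> m" for n
    proof (rule cp_mono[OF ag])
      show "\<rho> \<le> real (r n)" using m that seq_suble[OF r(2), of n] by linarith
    qed
    then show ?thesis unfolding eventually_sequentially by blast
  qed
  have X: "(\<lambda>n. X (r n)) \<longlonglongrightarrow> x" using r(3) by (simp add: o_def)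
  obtain v where "conv (\<lambda>n. p (X (r n))) (p x) v"
    using tendsto_imp_conv[OF tendsto_p[OF X r(1) XC]] by blast
  from conv_imp_tendsto[OF conv_agree_conv[OF this agr]]
  have "(\<lambda>n. p (Y (r n))) \<longlonglongrightarrow> p x" .
  from near_tendsto[OF N X r(1) this] have "(\<lambda>n. Y (r n)) \<longlonglongrightarrow> x" .
  with that r(1,2) X agr show thesis by blast
qed

text \<open>If no radius and no \<delta> worked, counterexamples with ever larger agreement and ever
  shorter vectors would converge to one point and would be near after all.\<close>

lemma near_flow_uniform:
  "\<exists>R. R \<ge> R0 \<and> (\<exists>\<delta>>0. \<forall>x y v. near x y \<longrightarrow> cp R (p x) = cp R (p y) \<longrightarrow> norm v < \<delta> \<longrightarrow> near (flow v x) (flow v y))"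
proof (rule ccontr)
  assume neg: "\<not> ?thesis"
  \<comment> \<open>The summand 1 leaves room for the translations, all of norm below 1, so that
    agreement on radius \<open>R0\<close> survives them.\<close>
  have "\<exists>x y v. near x y \<and> cp (\<bar>R0\<bar> + 1 + real n) (p x) = cp (\<bar>R0\<bar> + 1 + real n) (p y) \<and>
      norm v < 1 / real (Suc n) \<and> \<not> near (flow v x) (flow v y)" for n
  proof (rule ccontr)
    assume c: "\<not> ?thesis"
    have "\<bar>R0\<bar> + 1 + real n \<ge> R0" "1 / real (Suc n) > 0" by simp_all
    with c neg show False by metis
  qed
  then obtain X Y v where D: "\<And>n. near (X n) (Y n)"
    "\<And>n. cp (\<bar>R0\<bar> + 1 + real n) (p (X n)) = cp (\<bar>R0\<bar> + 1 + real n) (p (Y n))"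
    "\<And>n. norm (v n) < 1 / real (Suc n)" "\<And>n. \<not> near (flow (v n) (X n)) (flow (v n) (Y n))"
    by metis
  have XC: "\<And>n. X n \<in> C" and YC: "\<And>n. Y n \<in> C" using D(1) nearD by blast+
  have "cp (real n) (p (X n)) = cp (real n) (p (Y n))" for n
    using D(2) by (rule cp_mono) simp
  from near_seq_limit[OF D(1) this] obtain x and r :: "nat \<Rightarrow> nat" where r: "x \<in> C" "strict_mono r"
    "(\<lambda>n. X (r n)) \<longlonglongrightarrow> x" "(\<lambda>n. Y (r n)) \<longlonglongrightarrow> x"
    "\<forall>\<rho>. \<forall>\<^sub>F n in sequentially. cp \<rho> (p (X (r n))) = cp \<rho> (p (Y (r n)))" .
  have "v \<longlonglongrightarrow> 0"
  proof (rule LIMSEQ_norm_0)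
    show "norm (v n) < 1 / real (Suc n)" for n by (rule D(3))
  qed
  then have v: "(\<lambda>n. v (r n)) \<longlonglongrightarrow> 0" using LIMSEQ_subseq_LIMSEQ[OF _ r(2)] by (simp add: o_def)
  have "\<forall>\<^sub>F n in sequentially. near (flow (v (r n)) (X (r n))) (flow (v (r n)) (Y (r n)))"
  proof (rule eventually_near)
    show "(\<lambda>n. flow (v (r n)) (X (r n))) \<longlonglongrightarrow> x" "(\<lambda>n. flow (v (r n)) (Y (r n))) \<longlonglongrightarrow> x"
      using tendsto_flow[OF r(3,1) XC v] tendsto_flow[OF r(4,1) YC v] by (simp_all add: flow_0)
    have "cp R0 (tr (v n) (p (X n))) = cp R0 (tr (v n) (p (Y n)))" for n
    proof (rule cp_tr[OF D(2)])
      have "norm (v n) < 1 / real (Suc n)" by (rule D(3))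
      also have "\<dots> \<le> 1" by simp
      finally show "R0 + norm (v n) \<le> \<bar>R0\<bar> + 1 + real n" by linarith
    qed
    then show "\<forall>\<^sub>F n in sequentially. cp R0 (p (flow (v (r n)) (X (r n)))) = cp R0 (p (flow (v (r n)) (Y (r n))))"
      using XC YC by simp
  qed (use r(1) XC YC in simp_all)
  then show False using D(4) by simp
qed

definition R2 :: real where
  "R2 = (SOME R. R \<ge> R0 \<and> (\<exists>\<delta>>0. \<forall>x y v. near x y \<longrightarrow> cp R (p x) = cp R (p y) \<longrightarrow> norm v < \<delta> \<longrightarrow> near (flow v x) (flow v y)))"

lemma R2: "R2 \<ge> R0"
  "\<exists>\<delta>>0. \<forall>x y v. near x y \<longrightarrow> cp R2 (p x) = cp R2 (p y) \<longrightarrow> norm v < \<delta> \<longrightarrow> near (flow v x) (flow v y)"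
  using someI_ex[OF near_flow_uniform] unfolding R2_def[symmetric] by blast+

text \<open>Moves of length below \<delta> preserve nearness in both directions, so nearness is
  locally constant along \<open>K\<close>. In the applications \<open>K\<close> is the region of a
  supertile.\<close>

lemma near_along:
  assumes K: "connected K" "y0 \<in> K" "y \<in> K" and x: "x \<in> C" "x' \<in> C"
    and ag: "\<And>y. y \<in> K \<Longrightarrow> cp R2 (tr (- y) (p x)) = cp R2 (tr (- y) (p x'))"
    and near0: "near (flow (- y0) x) (flow (- y0) x')"
  shows "near (flow (- y) x) (flow (- y) x')"
proof -
  obtain \<delta> where \<delta>: "\<delta> > 0" "\<And>x y v. near x y \<Longrightarrow> cp R2 (p x) = cp R2 (p y) \<Longrightarrow> norm v < \<delta> \<Longrightarrow> near (flow v x) (flow v y)"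
    using R2(2) by metis
  have step: "near (flow (- b) x) (flow (- b) x')"
    if "a \<in> K" "near (flow (- a) x) (flow (- a) x')" "norm (a - b) < \<delta>" for a b
  proof -
    have "near (flow (a - b) (flow (- a) x)) (flow (a - b) (flow (- a) x'))"
      by (rule \<delta>(2)[OF that(2) _ that(3)]) (use ag[OF that(1)] x in simp)
    then show ?thesis by (simp add: flow_add)
  qed
  have "near (flow (- y0) x) (flow (- y0) x') = near (flow (- y) x) (flow (- y) x')"
  proof (rule seq_nhds_connected_const[OF seq_nhds_first_countable K(1) _ K(2,3), where P = "\<lambda>y. near (flow (- y) x) (flow (- y) x')"])
    fix z X assume z: "z \<in> K" "\<And>n. X n \<in> K" "X \<longlonglongrightarrow> z"
    have "\<forall>\<^sub>F n in sequentially. norm (X n - z) < \<delta>"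
      using z(3) \<delta>(1) tendstoD[of X z sequentially \<delta>] by (simp add: dist_norm)
    then show "\<forall>\<^sub>F n in sequentially. near (flow (- X n) x) (flow (- X n) x') = near (flow (- z) x) (flow (- z) x')"
    proof eventually_elim
      case (elim n)
      then show ?case
        using step[OF z(1), of "X n"] step[OF z(2), of n z] by (metis norm_minus_commute)
    qed
  qed
  with near0 show ?thesis by simp
qed

section \<open>Minimality of the cover\<close>

definition orbit_closure :: "'c \<Rightarrow> 'c set" where
  "orbit_closure x = C \<inter> closure (range (\<lambda>v. flow v x))"

lemma orbit_closure_seq:
  assumes "y \<in> orbit_closure x" "x \<in> C"
  obtains v where "(\<lambda>n. flow (v n) x) \<longlonglongrightarrow> y"
proof -
  have "range (\<lambda>v. flow v x) \<subseteq> C" using assms(2) by auto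
  from seq_nhds_closure[OF seq_nhds_C _ this, of y] assms(1)
  obtain X where X: "\<forall>n. X n \<in> range (\<lambda>v. flow v x)" "X \<longlonglongrightarrow> y"
    unfolding orbit_closure_def by blast
  have "\<forall>n. \<exists>v. X n = flow v x" using X(1) by blast
  then obtain v where "\<forall>n. X n = flow (v n) x" by metis
  then have "X = (\<lambda>n. flow (v n) x)" by (simp add: fun_eq_iff)
  with X(2) that show thesis by simp
qed

lemma orbit_closure_limit:
  assumes "\<And>n. X n \<in> orbit_closure x" "X \<longlonglongrightarrow> y" "y \<in> C"
  shows "y \<in> orbit_closure x"
proof -
  have "y \<in> closure (range (\<lambda>v. flow v x))"
    by (rule Lim_in_closed_set[OF closed_closure _ trivial_limit_sequentially assms(2)])
      (use assms(1) in \<open>simp add: orbit_closure_def\<close>)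
  with assms(3) show ?thesis by (simp add: orbit_closure_def)
qed

lemma flow_in_orbit_closure: "x \<in> C \<Longrightarrow> flow v x \<in> orbit_closure x"
  using closure_subset[of "range (\<lambda>v. flow v x)"] by (auto simp: orbit_closure_def)

lemma orbit_closure_trans:
  assumes "x \<in> C" "y \<in> orbit_closure x"
  shows "orbit_closure y \<subseteq> orbit_closure x"
proof -
  have y: "y \<in> C" using assms(2) by (simp add: orbit_closure_def)
  obtain v where v: "(\<lambda>n. flow (v n) x) \<longlonglongrightarrow> y" using orbit_closure_seq[OF assms(2,1)] .
  have "flow w y \<in> orbit_closure x" for w
  proof (rule orbit_closure_limit)
    show "(\<lambda>n. flow w (flow (v n) x)) \<longlonglongrightarrow> flow w y"
      by (rule tendsto_flow[OF v y _ tendsto_const]) (use assms(1) in simp)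
    show "flow w (flow (v n) x) \<in> orbit_closure x" for n
      unfolding flow_add by (rule flow_in_orbit_closure[OF assms(1)])
  qed (use y in simp)
  then have "range (\<lambda>v. flow v y) \<subseteq> closure (range (\<lambda>v. flow v x))"
    by (auto simp: orbit_closure_def)
  then have "closure (range (\<lambda>v. flow v y)) \<subseteq> closure (range (\<lambda>v. flow v x))"
    by (rule closure_minimal) simp
  then show ?thesis by (auto simp: orbit_closure_def)
qed

lemma orbit_closure_deck:
  assumes "x \<in> C" "y \<in> orbit_closure x" "g \<in> G"
  shows "g y \<in> orbit_closure (g x)"
proof -
  have y: "y \<in> C" using assms(2) by (simp add: orbit_closure_def)
  obtain v where v: "(\<lambda>n. flow (v n) x) \<longlonglongrightarrow> y" using orbit_closure_seq[OF assms(2,1)] .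
  show ?thesis
  proof (rule orbit_closure_limit)
    show "(\<lambda>n. g (flow (v n) x)) \<longlonglongrightarrow> g y"
      using assms(1) by (intro deck_tendsto[OF assms(3) v y]) simp
    show "g (flow (v n) x) \<in> orbit_closure (g x)" for n
      unfolding flow_deck[OF assms(3,1), symmetric] using assms by (intro flow_in_orbit_closure) simp
  qed (use assms y in simp)
qed

text \<open>Translates of \<open>p z\<close> converge to \<open>p x\<close> because the translation
  action on \<Omega> is minimal; sequential compactness of \<open>C\<close> lifts this to an
  accumulation point of the orbit of \<open>z\<close>.\<close>

lemma orbit_closure_fibre:
  assumes "x \<in> C" "z \<in> C"
  shows "\<exists>y\<in>orbit_closure z. p y = p x"
proof -
  obtain v where v: "(\<lambda>n. tr (v n) (p z)) \<longlonglongrightarrow> p x"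
    using minimal[of "p x" "p z"] assms by auto
  have "\<And>n. flow (v n) z \<in> C" using assms(2) by simp
  from seq_compactD[OF seq_compact_C this] obtain y and r :: "nat \<Rightarrow> nat" where
    r: "y \<in> C" "strict_mono r" "((\<lambda>n. flow (v n) z) \<circ> r) \<longlonglongrightarrow> y" .
  have "(\<lambda>n. p (((\<lambda>n. flow (v n) z) \<circ> r) n)) \<longlonglongrightarrow> p y"
    by (rule tendsto_p[OF r(3,1)]) (use assms(2) in simp)
  moreover have "((\<lambda>n. tr (v n) (p z)) \<circ> r) \<longlonglongrightarrow> p x" using v r(2) by (rule LIMSEQ_subseq_LIMSEQ)
  ultimately have "p y = p x"
    using assms(2) by (intro tiling_LIMSEQ_unique[of "\<lambda>n. tr (v (r n)) (p z)"]) (simp_all add: o_def)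
  moreover have "y \<in> orbit_closure z"
    using flow_in_orbit_closure[OF assms(2)] r(1) by (intro orbit_closure_limit[OF _ r(3)]) simp_all
  ultimately show ?thesis by blast
qed

text \<open>The key point is that \<open>g x \<in> orbit_closure x\<close> implies \<open>x \<in> orbit_closure (g x)\<close>, because
  some positive power of \<open>g\<close> fixes \<open>x\<close>.\<close>

lemma orbit_closure_sym:
  assumes x: "x \<in> C" and z: "z \<in> orbit_closure x"
  shows "x \<in> orbit_closure z"
proof -
  have zC: "z \<in> C" using z by (simp add: orbit_closure_def)
  obtain y where y: "y \<in> orbit_closure z" "p y = p x" using orbit_closure_fibre[OF x zC] by blast
  have yC: "y \<in> C" using y(1) by (simp add: orbit_closure_def)
  obtain g where g: "g \<in> G" "g x = y" using deck_transitive[OF x yC] y(2) by auto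
  have gx: "g x \<in> orbit_closure x" using g(2) y(1) orbit_closure_trans[OF x z] by blast
  have powC: "(g ^^ i) a \<in> C \<and> p ((g ^^ i) a) = p a" if "a \<in> C" for i a
    using that g(1) by (induction i) simp_all
  have step: "(g ^^ Suc i) x \<in> orbit_closure ((g ^^ i) x)" for i
  proof (induction i)
    case (Suc i)
    from orbit_closure_deck[OF _ Suc g(1)] powC[OF x, of i] show ?case by simp
  qed (use gx in simp)
  have pow: "(g ^^ Suc j) x \<in> orbit_closure (g x)" for j
  proof (induction j)
    case 0
    then show ?case using flow_in_orbit_closure[of "g x" 0] g(1) x by (simp add: flow_0)
  next
    case (Suc j)
    show ?case
      using orbit_closure_trans[OF _ Suc] step[of "Suc j"] g(1) x by auto
  qed
  have "\<not> inj (\<lambda>i. (g ^^ i) x)"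
  proof
    assume inj: "inj (\<lambda>i. (g ^^ i) x)"
    have "range (\<lambda>i. (g ^^ i) x) \<subseteq> {a \<in> C. p a = p x}" using powC[OF x] by auto
    moreover have "finite {a \<in> C. p a = p x}" using cov x by (simp add: finite_regular_cover_def)
    ultimately have "finite (range (\<lambda>i. (g ^^ i) x))" by (rule finite_subset)
    then show False using finite_imageD[OF _ inj] by simp
  qed
  then obtain i j where ij: "i < j" "(g ^^ i) x = (g ^^ j) x"
    unfolding inj_def by (metis nat_neq_iff)
  have inj: "a = b" if "(g ^^ i) a = (g ^^ i) b" "a \<in> C" "b \<in> C" for i a b
    using that
  proof (induction i)
    case (Suc i)
    then show ?case using deck_inj[OF g(1)] powC by simp
  qed simp
  have eq: "(g ^^ i) x = (g ^^ i) ((g ^^ (j - i)) x)"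
  proof -
    have "(g ^^ (i + (j - i))) x = (g ^^ i) ((g ^^ (j - i)) x)" by (simp only: funpow_add o_apply)
    then show ?thesis using ij by simp
  qed
  have "x = (g ^^ (j - i)) x" by (rule inj[OF eq x conjunct1[OF powC[OF x]]])
  moreover obtain l where "j - i = Suc l" using ij(1) by (metis Suc_diff_Suc)
  ultimately have "x \<in> orbit_closure (g x)" using pow[of l] by simp
  then show ?thesis using orbit_closure_trans[OF zC y(1)] g(2) by auto
qed

text \<open>By symmetry the orbit closures partition \<open>C\<close>. Each of them meets the finite
  fibre of \<open>x\<close>, so there are finitely many and each is open as well as closed;
  connectedness leaves only one.\<close>

lemma orbit_dense:
  assumes x: "x \<in> C" and y: "y \<in> C"
  obtains v where "(\<lambda>n. flow (v n) x) \<longlonglongrightarrow> y"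
proof -
  have "(x \<in> orbit_closure x) = (y \<in> orbit_closure x)"
  proof (rule seq_nhds_connected_const[OF seq_nhds_C connected_C _ x y])
    fix z X assume z: "z \<in> C" and X: "\<And>n. X n \<in> C" "X \<longlonglongrightarrow> z"
    have out: "\<forall>\<^sub>F n in sequentially. X n \<notin> orbit_closure w" if "z \<notin> orbit_closure w" for w
    proof -
      have "z \<in> - closure (range (\<lambda>v. flow v w))" using that z by (simp add: orbit_closure_def)
      moreover have "open (- closure (range (\<lambda>v. flow v w)))" by (simp add: open_Compl)
      ultimately have "\<forall>\<^sub>F n in sequentially. X n \<in> - closure (range (\<lambda>v. flow v w))"
        using X(2) by (intro topological_tendstoD)
      then show ?thesis by eventually_elim (simp add: orbit_closure_def)
    qed
    show "\<forall>\<^sub>F n in sequentially. (X n \<in> orbit_closure x) = (z \<in> orbit_closure x)"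
    proof (cases "z \<in> orbit_closure x")
      case False
      from out[OF this] show ?thesis by eventually_elim (use False in simp)
    next
      case True
      have "\<forall>\<^sub>F n in sequentially. \<forall>w\<in>{w \<in> C. p w = p x}. X n \<in> orbit_closure w \<longrightarrow> X n \<in> orbit_closure x"
      proof (rule eventually_ball_finite)
        show "finite {w \<in> C. p w = p x}" using cov x by (simp add: finite_regular_cover_def)
        show "\<forall>w\<in>{w \<in> C. p w = p x}. \<forall>\<^sub>F n in sequentially. X n \<in> orbit_closure w \<longrightarrow> X n \<in> orbit_closure x"
        proof
          \<comment> \<open>Either \<open>z\<close> lies off the closed orbit closure of
            \<open>w\<close>, and so do all late \<open>X n\<close>, or the orbit closures of
            \<open>w\<close> and \<open>x\<close> share \<open>z\<close> and the former is contained
            in the latter.\<close>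
          fix w assume w: "w \<in> {w \<in> C. p w = p x}"
          show "\<forall>\<^sub>F n in sequentially. X n \<in> orbit_closure w \<longrightarrow> X n \<in> orbit_closure x"
          proof (cases "z \<in> orbit_closure w")
            case True
            have "w \<in> orbit_closure z" using orbit_closure_sym[of w z] w True by simp
            then have "w \<in> orbit_closure x" using orbit_closure_trans[OF x \<open>z \<in> orbit_closure x\<close>] by blast
            then have "orbit_closure w \<subseteq> orbit_closure x" by (rule orbit_closure_trans[OF x])
            then show ?thesis by (auto intro: always_eventually)
          next
            case False
            from out[OF this] show ?thesis by eventually_elim simp
          qed
        qed
      qed
      then show ?thesis
      proof eventually_elim
        case (elim n)
        obtain w where w: "w \<in> orbit_closure (X n)" "p w = p x"
          using orbit_closure_fibre[OF x X(1)] by blast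
        have "X n \<in> orbit_closure w" by (rule orbit_closure_sym[OF X(1) w(1)])
        moreover have "w \<in> C" using w(1) by (simp add: orbit_closure_def)
        ultimately show ?case using elim w(2) True by blast
      qed
    qed
  qed
  then have "y \<in> orbit_closure x" using flow_in_orbit_closure[OF x, of 0] by (simp add: flow_0)
  from orbit_closure_seq[OF this x] that show thesis by blast
qed

end

section \<open>Labels of tiles\<close>

lemma collar_type_eq_iff:
  "collar_type P t = collar_type Q s \<longleftrightarrow> (\<exists>v. s = translate_tile v t \<and> collar Q s = translate v (collar P t))"
proof
  assume e: "collar_type P t = collar_type Q s"
  have "(translate_tile 0 s, translate 0 (collar Q s)) \<in> collar_type Q s"
    unfolding collar_type_def by blast
  then have "(s, collar Q s) \<in> collar_type P t" by (simp add: e)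
  then show "\<exists>v. s = translate_tile v t \<and> collar Q s = translate v (collar P t)"
    unfolding collar_type_def by auto
next
  assume "\<exists>v. s = translate_tile v t \<and> collar Q s = translate v (collar P t)"
  then obtain v where v: "s = translate_tile v t" "collar Q s = translate v (collar P t)" by blast
  show "collar_type P t = collar_type Q s"
  proof
    show "collar_type Q s \<subseteq> collar_type P t" unfolding collar_type_def v(2) unfolding v(1) by auto
    show "collar_type P t \<subseteq> collar_type Q s"
    proof
      fix z assume "z \<in> collar_type P t"
      then obtain w where "z = (translate_tile w t, translate w (collar P t))" unfolding collar_type_def by auto
      then have "z = (translate_tile (w - v) s, translate (w - v) (collar Q s))"
        unfolding v(2) unfolding v(1) by simp
      then show "z \<in> collar_type Q s" unfolding collar_type_def by (rule range_eqI)
    qed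
  qed
qed

lemma collar_cp:
  assumes "cp r T = cp r T'" "t \<in> tiles T" "fst t \<subseteq> ball 0 r"
  shows "t \<in> tiles T'" "collar (tiles T) t = collar (tiles T') t"
proof -
  have "fst t \<noteq> {}" using ball_tile_nonempty[OF tiles_ball_tile[OF assms(2)]] .
  then have "t \<in> cp r T" using assms(2,3) by (auto simp: central_patch_def)
  then show "t \<in> tiles T'" using assms(1) cp_subset by blast
  have "collar (tiles S) t = {s \<in> cp r S. fst s \<inter> fst t \<noteq> {}}" for S :: "('a, 'b) tiling"
    using assms(3) by (auto simp: collar_def central_patch_def)
  then show "collar (tiles T) t = collar (tiles T') t" using assms(1) by simp
qed

lemma tile_bounded: "t \<in> tiles T \<Longrightarrow> \<exists>r>0. fst t \<subseteq> ball 0 r"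
  using bounded_subset_ballD[OF compact_imp_bounded[OF ball_tile_compact[OF tiles_ball_tile]]] .

lemma conv_collar:
  assumes "conv X T v" "t \<in> tiles T"
  shows "\<forall>\<^sub>F n in sequentially. translate_tile (v n) t \<in> tiles (X n) \<and>
    collar (tiles (X n)) (translate_tile (v n) t) = translate (v n) (collar (tiles T) t)"
proof -
  obtain r where r: "fst t \<subseteq> ball 0 r" using tile_bounded[OF assms(2)] by blast
  show ?thesis
    using conv_small[OF assms(1) zero_less_one] conv_agree[OF assms(1), of "r + 1"]
  proof eventually_elim
    case (elim n)
    have "fst (translate_tile (v n) t) \<subseteq> ball 0 (r + 1)"
    proof
      fix x assume "x \<in> fst (translate_tile (v n) t)"
      then obtain y where "y \<in> fst t" "x = v n + y" by auto
      then have "norm y < r" "x = v n + y" using r by auto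
      then show "x \<in> ball 0 (r + 1)" using elim(1) norm_triangle_ineq[of "v n" y] by simp
    qed
    from collar_cp[OF elim(2)[symmetric] _ this] assms(2)
    show ?case by (simp add: collar_tr)
  qed
qed

locale substitution_cover =
  substitution_hull T0 \<Omega> L \<sigma> \<sigma>i \<omega> + tiling_cover T0 \<Omega> C p
  for T0 :: "('a::euclidean_space, 'l) tiling" and \<Omega> L \<sigma> \<sigma>i \<omega>
    and C :: "'c::topological_space set" and p
begin

text \<open>The projection of the cover pulled back along \<open>\<sigma> ^^ k\<close>: as
  \<open>\<sigma>\<close> is a homeomorphism of \<Omega>, the total space can be kept equal to
  \<open>C\<close>.\<close>

definition base :: "nat \<Rightarrow> 'c \<Rightarrow> ('a, 'l) tiling" where
  "base k z = (\<sigma>i ^^ k) (p z)"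

text \<open>At such a level the inflated collar margin \<open>lam ^ k * eps\<close> reaches
  \<open>R2\<close>, so equal collars force the agreement that \<open>near_along\<close> requires on
  the whole supertile.\<close>

definition big :: "nat \<Rightarrow> bool" where "big k \<longleftrightarrow> R2 \<le> lam ^ k * eps"

text \<open>The points \<open>z1\<close> and \<open>z2\<close> are regarded as points, over \<open>base k z1\<close> and \<open>base k z2\<close>, of the cover
  pulled back along \<open>\<sigma> ^^ k\<close>; they are compared along the supertile of \<open>t2\<close>.\<close>

definition linked where
  "linked k z1 t1 z2 t2 \<longleftrightarrow> (\<exists>v. t2 = translate_tile v t1 \<and>
     collar (tiles (base k z2)) t2 = translate v (collar (tiles (base k z1)) t1) \<and>
     (\<forall>y\<in>(L ^^ k) ` fst t2. near (flow (- y) (flow ((L ^^ k) v) z1)) (flow (- y) z2)))"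

definition valid where "valid k z t \<longleftrightarrow> z \<in> C \<and> t \<in> tiles (base k z)"

abbreviation ctype where "ctype k z t \<equiv> collar_type (tiles (base k z)) t"

lemma base_mem [simp]: "z \<in> C \<Longrightarrow> base k z \<in> \<Omega>"
  by (simp add: base_def)

lemma sigma_base [simp]: "z \<in> C \<Longrightarrow> (\<sigma> ^^ k) (base k z) = p z"
  by (simp add: base_def)

lemma base_flow [simp]: "z \<in> C \<Longrightarrow> base k (flow ((L ^^ k) v) z) = tr v (base k z)"
  by (simp add: base_def sigmai_pow_tr)

lemma base_deck [simp]: "z \<in> C \<Longrightarrow> g \<in> G \<Longrightarrow> base k (g z) = base k z"
  by (simp add: base_def)

lemma base_eq_iff: "z \<in> C \<Longrightarrow> z' \<in> C \<Longrightarrow> base k z = base k z' \<longleftrightarrow> p z = p z'"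
  using sigma_base[of z k] sigma_base[of z' k] by (metis base_def)

lemma base_ex:
  assumes "T \<in> \<Omega>"
  shows "\<exists>z\<in>C. base k z = T"
proof -
  obtain z where "z \<in> C" "p z = (\<sigma> ^^ k) T" using fibre_ex[of "(\<sigma> ^^ k) T"] assms by auto
  then show ?thesis using assms by (intro bexI[of _ z]) (simp_all add: base_def)
qed

lemma tendsto_base:
  assumes "X \<longlonglongrightarrow> z" "z \<in> C" "\<And>n. X n \<in> C"
  shows "(\<lambda>n. base k (X n)) \<longlonglongrightarrow> base k z"
  unfolding base_def using tendsto_p[OF assms] assms by (intro tendsto_sigmai_pow) simp_all

lemma linked_sym:
  assumes "linked k z1 t1 z2 t2"
  shows "linked k z2 t2 z1 t1"
proof -
  obtain v where v: "t2 = translate_tile v t1"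
    "collar (tiles (base k z2)) t2 = translate v (collar (tiles (base k z1)) t1)"
    "\<forall>y\<in>(L ^^ k) ` fst t2. near (flow (- y) (flow ((L ^^ k) v) z1)) (flow (- y) z2)"
    using assms unfolding linked_def by blast
  show ?thesis
    unfolding linked_def
  proof (intro exI[of _ "- v"] conjI ballI)
    show "t1 = translate_tile (- v) t2" by (simp add: v(1))
    show "collar (tiles (base k z1)) t1 = translate (- v) (collar (tiles (base k z2)) t2)" by (simp add: v(2))
    fix y assume "y \<in> (L ^^ k) ` fst t1"
    then have "(L ^^ k) v + y \<in> (L ^^ k) ` fst t2"
      by (auto simp: v(1) image_image Lk_add)
    from near_sym[OF v(3)[rule_format, OF this]]
    show "near (flow (- y) (flow ((L ^^ k) (- v)) z2)) (flow (- y) z1)"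
      by (simp add: flow_add Lk_minus add.commute)
  qed
qed

lemma linked_trans:
  assumes "linked k z1 t1 z2 t2" "linked k z2 t2 z3 t3"
  shows "linked k z1 t1 z3 t3"
proof -
  obtain v where v: "t2 = translate_tile v t1"
    "collar (tiles (base k z2)) t2 = translate v (collar (tiles (base k z1)) t1)"
    "\<forall>y\<in>(L ^^ k) ` fst t2. near (flow (- y) (flow ((L ^^ k) v) z1)) (flow (- y) z2)"
    using assms(1) unfolding linked_def by blast
  obtain w where w: "t3 = translate_tile w t2"
    "collar (tiles (base k z3)) t3 = translate w (collar (tiles (base k z2)) t2)"
    "\<forall>y\<in>(L ^^ k) ` fst t3. near (flow (- y) (flow ((L ^^ k) w) z2)) (flow (- y) z3)"
    using assms(2) unfolding linked_def by blast
  show ?thesis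
    unfolding linked_def
  proof (intro exI[of _ "w + v"] conjI ballI)
    show "t3 = translate_tile (w + v) t1" by (simp add: v(1) w(1))
    show "collar (tiles (base k z3)) t3 = translate (w + v) (collar (tiles (base k z1)) t1)"
      by (simp add: v(2) w(2))
    fix y assume y: "y \<in> (L ^^ k) ` fst t3"
    then have "y - (L ^^ k) w \<in> (L ^^ k) ` fst t2"
      by (auto simp: w(1) image_image Lk_add)
    from v(3)[rule_format, OF this]
    have "near (flow (- y) (flow ((L ^^ k) (w + v)) z1)) (flow (- y) (flow ((L ^^ k) w) z2))"
      by (simp add: flow_add Lk_add algebra_simps)
    with w(3)[rule_format, OF y]
    show "near (flow (- y) (flow ((L ^^ k) (w + v)) z1)) (flow (- y) z3)" by (rule near_trans[rotated])
  qed
qed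

lemma linked_ctype: "linked k z1 t1 z2 t2 \<Longrightarrow> ctype k z1 t1 = ctype k z2 t2"
  unfolding linked_def collar_type_eq_iff by blast

text \<open>A tile is not its own translate by a nonzero vector, so the comparison is made without
  shift, and near points over the same tiling are equal.\<close>

lemma linked_same_base:
  assumes "linked k z t z' t" "valid k z t" "valid k z' t" "base k z = base k z'"
  shows "z = z'"
proof -
  have bt: "ball_tile t" using assms(2) tiles_ball_tile[of t "base k z"] by (simp add: valid_def)
  obtain v where v: "t = translate_tile v t"
    "\<forall>y\<in>(L ^^ k) ` fst t. near (flow (- y) (flow ((L ^^ k) v) z)) (flow (- y) z')"
    using assms(1) unfolding linked_def by blast
  have "translate_tile v t = translate_tile 0 t" using v(1) by simp
  then have "v = 0" by (simp only: translate_tile_eq_iff[OF bt])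
  obtain a where "a \<in> fst t" using ball_tile_nonempty[OF bt] by blast
  then have n: "near (flow (- (L ^^ k) a) z) (flow (- (L ^^ k) a) z')"
    using v(2) \<open>v = 0\<close> by (simp add: Lk_0 flow_0)
  have "z \<in> C" "z' \<in> C" using assms(2,3) by (simp_all add: valid_def)
  then have "flow (- (L ^^ k) a) z = flow (- (L ^^ k) a) z'"
    using assms(4) by (intro near_eq[OF n]) (simp add: base_eq_iff)
  then have "flow ((L ^^ k) a) (flow (- (L ^^ k) a) z) = flow ((L ^^ k) a) (flow (- (L ^^ k) a) z')" by simp
  then show ?thesis by simp
qed

lemma big_agree:
  assumes "big k" "T1 \<in> \<Omega>" "T2 \<in> \<Omega>" "t \<in> tiles T1" "t \<in> tiles T2"
    "collar (tiles T1) t = collar (tiles T2) t" "y \<in> (L ^^ k) ` fst t"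
  shows "cp R2 (tr (- y) ((\<sigma> ^^ k) T1)) = cp R2 (tr (- y) ((\<sigma> ^^ k) T2))"
  using assms unfolding big_def by (intro cp_sigma_pow_collar)

text \<open>The region of the supertile is connected, and equal collars give agreement of radius
  \<open>R2\<close> around each of its points; nearness therefore spreads from one point to all of
  it.\<close>

lemma linked_at:
  assumes big: "big k" and val: "valid k z1 t1" "valid k z2 t2"
    and v: "t2 = translate_tile v t1" "collar (tiles (base k z2)) t2 = translate v (collar (tiles (base k z1)) t1)"
    and a: "a \<in> fst t2" "near (flow (- (L ^^ k) a) (flow ((L ^^ k) v) z1)) (flow (- (L ^^ k) a) z2)"
  shows "linked k z1 t1 z2 t2"
  unfolding linked_def
proof (intro exI[of _ v] conjI ballI)
  fix y assume y: "y \<in> (L ^^ k) ` fst t2"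
  have zC: "z1 \<in> C" "z2 \<in> C" and t: "t1 \<in> tiles (base k z1)" "t2 \<in> tiles (base k z2)"
    using val by (simp_all add: valid_def)
  have conn: "connected ((L ^^ k) ` fst t2)"
    using ball_tile_connected[OF tiles_ball_tile[OF t(2)]] linear_Lk
    by (intro connected_continuous_image linear_continuous_on) (simp_all add: linear_conv_bounded_linear)
  show "near (flow (- y) (flow ((L ^^ k) v) z1)) (flow (- y) z2)"
  proof (rule near_along[OF conn _ y _ zC(2) _ a(2)])
    show "(L ^^ k) a \<in> (L ^^ k) ` fst t2" using a(1) by (rule imageI)
    show "flow ((L ^^ k) v) z1 \<in> C" using zC by simp
    fix y assume y: "y \<in> (L ^^ k) ` fst t2"
    have "cp R2 (tr (- y) ((\<sigma> ^^ k) (tr v (base k z1)))) = cp R2 (tr (- y) ((\<sigma> ^^ k) (base k z2)))"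
      using zC t by (intro big_agree[OF big _ _ _ t(2) _ y]) (simp_all add: v(1) collar_tr v(2)[unfolded v(1)])
    then show "cp R2 (tr (- y) (p (flow ((L ^^ k) v) z1))) = cp R2 (tr (- y) (p z2))"
      using zC by (simp add: sigma_pow_tr)
  qed
qed (rule v)+

text \<open>\<open>near_ex\<close> provides a partner at one point \<open>a\<close> of the tile.
  Moving it back by the flow and applying \<open>linked_at\<close> yields a partner along the whole
  supertile.\<close>

lemma linked_ex:
  assumes big: "big k" and val: "valid k z1 t1" and T2: "T2 \<in> \<Omega>" "t2 \<in> tiles T2"
    and ct: "ctype k z1 t1 = collar_type (tiles T2) t2"
  shows "\<exists>z2\<in>C. base k z2 = T2 \<and> linked k z1 t1 z2 t2"
proof -
  have zC: "z1 \<in> C" and t: "t1 \<in> tiles (base k z1)" using val by (simp_all add: valid_def)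
  obtain v where v: "t2 = translate_tile v t1" "collar (tiles T2) t2 = translate v (collar (tiles (base k z1)) t1)"
    using ct unfolding collar_type_eq_iff by blast
  obtain a where a: "a \<in> fst t2" using ball_tile_nonempty[OF tiles_ball_tile[OF T2(2)]] by blast
  let ?y = "(L ^^ k) a"
  have "cp R2 (tr (- ?y) ((\<sigma> ^^ k) (tr v (base k z1)))) = cp R2 (tr (- ?y) ((\<sigma> ^^ k) T2))"
    using zC t T2 a by (intro big_agree[OF big _ T2(1) _ T2(2)]) (simp_all add: v(1) collar_tr v(2)[unfolded v(1)])
  then have "cp R0 (tr (- ?y) ((\<sigma> ^^ k) (tr v (base k z1)))) = cp R0 (tr (- ?y) ((\<sigma> ^^ k) T2))"
    using R2(1) by (rule cp_mono)
  then have "cp R0 (p (flow (- ?y) (flow ((L ^^ k) v) z1))) = cp R0 (tr (- ?y) ((\<sigma> ^^ k) T2))"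
    using zC by (simp add: sigma_pow_tr)
  then obtain y where y: "near (flow (- ?y) (flow ((L ^^ k) v) z1)) y" "p y = tr (- ?y) ((\<sigma> ^^ k) T2)"
    using near_ex[of "flow (- ?y) (flow ((L ^^ k) v) z1)" "tr (- ?y) ((\<sigma> ^^ k) T2)"] zC T2(1) by auto
  define z2 where "z2 = flow ?y y"
  have yC: "y \<in> C" using y(1) by (rule nearD)
  have z2: "z2 \<in> C" "p z2 = (\<sigma> ^^ k) T2" "flow (- ?y) z2 = y" using yC y(2) by (simp_all add: z2_def)
  have base: "base k z2 = T2" using z2(2) T2(1) by (simp add: base_def)
  have "linked k z1 t1 z2 t2"
    using z2(1) T2(2) y(1) v(2)
    by (intro linked_at[OF big val _ v(1) _ a]) (simp_all add: valid_def base z2(3))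
  with z2(1) base show ?thesis by blast
qed

section \<open>Labels in the group of deck transformations\<close>

definition rep :: "nat \<Rightarrow> ('a, 'l) collar_type \<Rightarrow> 'c \<times> ('a, 'l) tile" where
  "rep k c = (SOME (z, t). valid k z t \<and> ctype k z t = c)"

text \<open>A coordinate on the fibre: each collar type has a reference point, chosen in
  \<open>rep\<close>, and the label is the deck transformation taking it to a point linked with
  \<open>z\<close>.\<close>

definition lab :: "nat \<Rightarrow> 'c \<Rightarrow> ('a, 'l) tile \<Rightarrow> ('c \<Rightarrow> 'c)" where
  "lab k z t = (THE g. g \<in> G \<and> (case rep k (ctype k z t) of (zc, tc) \<Rightarrow> linked k (g zc) tc z t))"

lemma rep:
  assumes "valid k z t"
  obtains zc tc where "rep k (ctype k z t) = (zc, tc)" "valid k zc tc" "ctype k zc tc = ctype k z t"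
proof -
  have "\<exists>q. case q of (z', t') \<Rightarrow> valid k z' t' \<and> ctype k z' t' = ctype k z t"
    using assms by (intro exI[of _ "(z, t)"]) simp
  from someI_ex[OF this, folded rep_def] that show thesis
    by (cases "rep k (ctype k z t)") simp
qed

lemma valid_deck: "valid k z t \<Longrightarrow> g \<in> G \<Longrightarrow> valid k (g z) t"
  by (simp add: valid_def)

lemma lab_linked:
  assumes big: "big k" and val: "valid k z t"
    and rp: "rep k (ctype k z t) = (zc, tc)" "valid k zc tc" "ctype k zc tc = ctype k z t"
  shows "lab k z t \<in> G \<and> linked k (lab k z t zc) tc z t"
proof -
  have zC: "z \<in> C" "zc \<in> C" and tc: "tc \<in> tiles (base k zc)" using val rp(2) by (simp_all add: valid_def)
  obtain z2 where z2: "z2 \<in> C" "base k z2 = base k zc" "linked k z t z2 tc"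
    using linked_ex[OF big val _ tc] zC rp(3) by auto
  have "p zc = p z2" using z2(1,2) zC by (simp add: base_eq_iff)
  then obtain g where g: "g \<in> G" "g zc = z2" using deck_transitive[OF zC(2) z2(1)] by blast
  have "\<exists>!g. g \<in> G \<and> linked k (g zc) tc z t"
  proof (rule ex1I)
    show "g \<in> G \<and> linked k (g zc) tc z t" using g linked_sym[OF z2(3)] by simp
    fix h assume h: "h \<in> G \<and> linked k (h zc) tc z t"
    have "linked k (h zc) tc (g zc) tc" using h z2(3) g(2) linked_trans by blast
    then have "h zc = g zc"
      using h g(1) rp(2) zC by (intro linked_same_base[of k _ tc]) (simp_all add: valid_deck)
    then show "h = g" using deck_unique h g(1) zC(2) by blast
  qed
  from theI'[OF this] show ?thesis unfolding lab_def rp(1) by simp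
qed

lemma lab_in: "big k \<Longrightarrow> valid k z t \<Longrightarrow> lab k z t \<in> G"
  using lab_linked rep by metis

text \<open>Each of the two points is linked to the common reference point moved by its own label.
  Transitivity reduces the claim to \<open>linked_same_base\<close> and to the freeness of the deck
  action.\<close>

lemma lab_eq_iff:
  assumes big: "big k" and val: "valid k z1 t1" "valid k z2 t2" and ct: "ctype k z1 t1 = ctype k z2 t2"
  shows "lab k z1 t1 = lab k z2 t2 \<longleftrightarrow> linked k z1 t1 z2 t2"
proof -
  obtain zc tc where rp: "rep k (ctype k z1 t1) = (zc, tc)" "valid k zc tc" "ctype k zc tc = ctype k z1 t1"
    using rep[OF val(1)] .
  note l1 = lab_linked[OF big val(1) rp] and l2 = lab_linked[OF big val(2) rp[unfolded ct]]
  show ?thesis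
  proof
    assume "lab k z1 t1 = lab k z2 t2"
    then show "linked k z1 t1 z2 t2" using l1 l2 linked_sym linked_trans by metis
  next
    assume "linked k z1 t1 z2 t2"
    then have "linked k (lab k z1 t1 zc) tc (lab k z2 t2 zc) tc"
      using l1 l2 linked_sym linked_trans by metis
    moreover have zc: "zc \<in> C" using rp(2) by (simp add: valid_def)
    ultimately have "lab k z1 t1 zc = lab k z2 t2 zc"
      using l1 l2 rp(2) by (intro linked_same_base[of k _ tc]) (simp_all add: valid_deck)
    then show "lab k z1 t1 = lab k z2 t2" using deck_unique l1 l2 zc by blast
  qed
qed

text \<open>Moving the reference point by \<open>g\<close> and linking it over to \<open>T\<close>
  gives a point with label \<open>g\<close>. The isomorphism of two pullbacks starts from such a
  point.\<close>

lemma lab_surj: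
  assumes big: "big k" and T: "T \<in> \<Omega>" "t \<in> tiles T" and g: "g \<in> G"
  shows "\<exists>z\<in>C. base k z = T \<and> lab k z t = g"
proof -
  obtain z0 where z0: "z0 \<in> C" "base k z0 = T" using base_ex[OF T(1)] by blast
  then have val: "valid k z0 t" using T(2) by (simp add: valid_def)
  obtain zc tc where rp: "rep k (ctype k z0 t) = (zc, tc)" "valid k zc tc" "ctype k zc tc = ctype k z0 t"
    using rep[OF val] .
  have zc: "zc \<in> C" using rp(2) by (simp add: valid_def)
  have valg: "valid k (g zc) tc" using rp(2) g by (rule valid_deck)
  have "ctype k (g zc) tc = collar_type (tiles T) t" using rp(3) z0(2) zc g by simp
  from linked_ex[OF big valg T this] obtain z where z: "z \<in> C" "base k z = T" "linked k (g zc) tc z t" by blast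
  have val': "valid k z t" using z T(2) by (simp add: valid_def)
  have rp': "rep k (ctype k z t) = (zc, tc)" "valid k zc tc" "ctype k zc tc = ctype k z t"
    using rp z(2) z0(2) by simp_all
  note l = lab_linked[OF big val' rp']
  have "linked k (lab k z t zc) tc (g zc) tc" using l z(3) linked_sym linked_trans by metis
  then have "lab k z t zc = g zc"
    using l g rp(2) zc by (intro linked_same_base[of k _ tc]) (simp_all add: valid_deck)
  then have "lab k z t = g" using deck_unique l g zc by blast
  with z show ?thesis by blast
qed

lemma valid_flow: "valid k z t \<Longrightarrow> valid k (flow ((L ^^ k) v) z) (translate_tile v t)"
  by (simp add: valid_def)

lemma lab_flow:
  assumes "big k" "valid k z t"
  shows "lab k (flow ((L ^^ k) v) z) (translate_tile v t) = lab k z t"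
proof -
  have z: "z \<in> C" using assms(2) by (simp add: valid_def)
  have l: "linked k z t (flow ((L ^^ k) v) z) (translate_tile v t)"
    unfolding linked_def using z by (intro exI[of _ v]) (auto simp: collar_tr intro: near_refl)
  show ?thesis
    using lab_eq_iff[OF assms(1,2) valid_flow[OF assms(2)] linked_ctype[OF l]] l by simp
qed

text \<open>It suffices to compare at one point \<open>a\<close> of the tile. There the shifted
  \<open>X n\<close> converge to the correspondingly shifted \<open>z\<close>, so
  \<open>eventually_near\<close> applies and \<open>linked_at\<close> spreads the result over the
  supertile.\<close>

lemma eventually_linked:
  assumes big: "big k" and X: "X \<longlonglongrightarrow> z" "z \<in> C" "\<And>n. X n \<in> C"
    and v: "conv (\<lambda>n. base k (X n)) (base k z) v" and t: "t \<in> tiles (base k z)"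
  shows "\<forall>\<^sub>F n in sequentially. valid k (X n) (translate_tile (v n) t) \<and> linked k z t (X n) (translate_tile (v n) t)"
proof -
  obtain a where a: "a \<in> fst t" using ball_tile_nonempty[OF tiles_ball_tile[OF t]] by blast
  have v0: "v \<longlonglongrightarrow> 0" using v by (simp add: conv_def)
  have lim: "(\<lambda>n. - (L ^^ k) (v n + a)) \<longlonglongrightarrow> - (L ^^ k) (0 + a)"
    by (intro tendsto_minus tendsto_Lk tendsto_add v0 tendsto_const)
  have Y: "(\<lambda>n. flow (- (L ^^ k) (v n + a)) (X n)) \<longlonglongrightarrow> flow (- (L ^^ k) a) z"
    using tendsto_flow[OF X lim] by simp
  note col = conv_collar[OF v t]
  have "\<forall>\<^sub>F n in sequentially. near (flow (- (L ^^ k) a) z) (flow (- (L ^^ k) (v n + a)) (X n))"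
  proof (rule eventually_near[OF tendsto_const _ Y])
    from col show "\<forall>\<^sub>F n in sequentially. cp R0 (p (flow (- (L ^^ k) a) z)) = cp R0 (p (flow (- (L ^^ k) (v n + a)) (X n)))"
    proof eventually_elim
      case (elim n)
      have y: "(L ^^ k) (v n + a) \<in> (L ^^ k) ` fst (translate_tile (v n) t)" using a by auto
      have "cp R2 (tr (- (L ^^ k) (v n + a)) ((\<sigma> ^^ k) (tr (v n) (base k z)))) =
          cp R2 (tr (- (L ^^ k) (v n + a)) ((\<sigma> ^^ k) (base k (X n))))"
        using elim X t by (intro big_agree[OF big _ _ _ _ _ y]) (simp_all add: collar_tr)
      then have "cp R2 (p (flow (- (L ^^ k) a) z)) = cp R2 (p (flow (- (L ^^ k) (v n + a)) (X n)))"
        using X(2,3) by (simp add: sigma_pow_tr Lk_add)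
      then show ?case using R2(1) by (rule cp_mono)
    qed
  qed (use X in simp_all)
  with col show ?thesis
  proof eventually_elim
    case (elim n)
    have val: "valid k (X n) (translate_tile (v n) t)" "valid k z t" using elim(1) X t by (simp_all add: valid_def)
    have "flow (- (L ^^ k) (v n + a)) (flow ((L ^^ k) (v n)) z) = flow (- (L ^^ k) a) z"
      by (simp add: flow_add Lk_add)
    then show ?case
      using elim a val by (intro conjI linked_at[OF big val(2,1) refl, of "v n + a"]) simp_all
  qed
qed

text \<open>Converse to \<open>eventually_linked\<close>: convergence of the tilings and linking
  along a single tile determine the sheet, so they give back convergence in the cover.\<close>

lemma tendsto_of_linked:
  assumes z: "z \<in> C" and X: "\<And>n. X n \<in> C"
    and v: "conv (\<lambda>n. base k (X n)) (base k z) v" and t: "t \<in> tiles (base k z)"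
    and l: "\<forall>\<^sub>F n in sequentially. linked k z t (X n) (translate_tile (v n) t)"
  shows "X \<longlonglongrightarrow> z"
proof -
  have bt: "ball_tile t" by (rule tiles_ball_tile[OF t])
  obtain a where a: "a \<in> fst t" using ball_tile_nonempty[OF bt] by blast
  have v0: "v \<longlonglongrightarrow> 0" using v by (simp add: conv_def)
  define Y where "Y n = flow (- (L ^^ k) (v n + a)) (X n)" for n
  have "\<forall>\<^sub>F n in sequentially. near (flow (- (L ^^ k) a) z) (Y n)"
    using l
  proof eventually_elim
    case (elim n)
    then obtain w where w: "translate_tile (v n) t = translate_tile w t"
      "\<forall>y\<in>(L ^^ k) ` fst (translate_tile (v n) t). near (flow (- y) (flow ((L ^^ k) w) z)) (flow (- y) (X n))"
      unfolding linked_def by blast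
    have "v n = w" using w(1) by (simp only: translate_tile_eq_iff[OF bt])
    have "(L ^^ k) (v n + a) \<in> (L ^^ k) ` fst (translate_tile (v n) t)" using a by auto
    from w(2)[rule_format, OF this] show ?case
      unfolding Y_def \<open>v n = w\<close> by (simp add: flow_add Lk_add)
  qed
  then obtain N where N: "\<And>n. n \<ge> N \<Longrightarrow> near (flow (- (L ^^ k) a) z) (Y n)"
    unfolding eventually_sequentially by blast
  have "(\<lambda>n. (\<sigma> ^^ k) (base k (X n))) \<longlonglongrightarrow> (\<sigma> ^^ k) (base k z)"
    using conv_imp_tendsto[OF v] z X by (intro tendsto_sigma_pow) simp_all
  then have pX: "(\<lambda>n. p (X n)) \<longlonglongrightarrow> p z" using z X by simp
  have lim: "(\<lambda>n. - (L ^^ k) (v n + a)) \<longlonglongrightarrow> - (L ^^ k) (0 + a)"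
    by (intro tendsto_minus tendsto_Lk tendsto_add v0 tendsto_const)
  have pY: "(\<lambda>n. p (Y n)) \<longlonglongrightarrow> p (flow (- (L ^^ k) a) z)"
    using tendsto_tr[OF pX lim] z X by (simp add: Y_def)
  have "(\<lambda>n. Y (n + N)) \<longlonglongrightarrow> flow (- (L ^^ k) a) z"
    by (rule near_tendsto[OF N tendsto_const _ LIMSEQ_ignore_initial_segment[OF pY]]) (use z in simp_all)
  then have Y: "Y \<longlonglongrightarrow> flow (- (L ^^ k) a) z" by (rule LIMSEQ_offset)
  have lim': "(\<lambda>n. (L ^^ k) (v n + a)) \<longlonglongrightarrow> (L ^^ k) (0 + a)"
    by (intro tendsto_Lk tendsto_add v0 tendsto_const)
  have "(\<lambda>n. flow ((L ^^ k) (v n + a)) (Y n)) \<longlonglongrightarrow> flow ((L ^^ k) (0 + a)) (flow (- (L ^^ k) a) z)"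
    using z X by (intro tendsto_flow[OF Y _ _ lim']) (simp_all add: Y_def)
  then show ?thesis by (simp add: Y_def)
qed

end

section \<open>A lift of a power of the substitution\<close>

text \<open>Both tiles and both collars are moved by the same vector, so the class also remembers
  the relative position of the two tiles.\<close>

definition pair_type where
  "pair_type P s t = range (\<lambda>v. (translate_tile v s, translate_tile v t, translate v (collar P s), translate v (collar P t)))"

lemma pair_type_translate:
  "pair_type (translate v P) (translate_tile v s) (translate_tile v t) = pair_type P s t"
proof
  show "pair_type (translate v P) (translate_tile v s) (translate_tile v t) \<subseteq> pair_type P s t"
    unfolding pair_type_def collar_translate by auto
  show "pair_type P s t \<subseteq> pair_type (translate v P) (translate_tile v s) (translate_tile v t)"
  proof
    fix z assume "z \<in> pair_type P s t"
    then obtain w where "z = (translate_tile w s, translate_tile w t, translate w (collar P s), translate w (collar P t))"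
      unfolding pair_type_def by auto
    then have "z = (translate_tile (w - v) (translate_tile v s), translate_tile (w - v) (translate_tile v t),
        translate (w - v) (collar (translate v P) (translate_tile v s)),
        translate (w - v) (collar (translate v P) (translate_tile v t)))"
      unfolding collar_translate by simp
    then show "z \<in> pair_type (translate v P) (translate_tile v s) (translate_tile v t)"
      unfolding pair_type_def by (rule range_eqI)
  qed
qed

lemma pair_type_eqD:
  assumes "pair_type P s t = pair_type Q s' t'"
  shows "\<exists>v. s' = translate_tile v s \<and> t' = translate_tile v t \<and>
    collar Q s' = translate v (collar P s) \<and> collar Q t' = translate v (collar P t)"
proof -
  have "(translate_tile 0 s', translate_tile 0 t', translate 0 (collar Q s'), translate 0 (collar Q t')) \<in> pair_type Q s' t'"
    unfolding pair_type_def by blast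
  then have "(s', t', collar Q s', collar Q t') \<in> pair_type P s t" by (simp add: assms)
  then show ?thesis unfolding pair_type_def by auto
qed

context flc_hull
begin

text \<open>With a common point of the two tiles shifted to the origin, infinitely many types would
  accumulate at one limit tiling, which offers only finitely many pairs of tiles around its
  origin.\<close>

lemma finite_pair_types:
  "finite {pair_type (tiles T) s t | T s t. T \<in> \<Omega> \<and> s \<in> tiles T \<and> t \<in> tiles T \<and> fst s \<inter> fst t \<noteq> {}}"
proof (rule ccontr)
  assume "infinite {pair_type (tiles T) s t | T s t. T \<in> \<Omega> \<and> s \<in> tiles T \<and> t \<in> tiles T \<and> fst s \<inter> fst t \<noteq> {}}"
    (is "infinite ?PT")
  from infinite_countable_subset[OF this]
  obtain f :: "nat \<Rightarrow> _" where f: "inj f" "range f \<subseteq> ?PT" by (elim exE conjE)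
  have "\<exists>T s t x. f n = pair_type (tiles T) s t \<and> T \<in> \<Omega> \<and> s \<in> tiles T \<and> t \<in> tiles T \<and> x \<in> fst s \<and> x \<in> fst t" for n
  proof -
    have "f n \<in> ?PT" using f(2) by (rule subsetD) (rule rangeI)
    then obtain T s t where q: "f n = pair_type (tiles T) s t" "T \<in> \<Omega>" "s \<in> tiles T" "t \<in> tiles T"
      "fst s \<inter> fst t \<noteq> {}"
      unfolding mem_Collect_eq by (elim exE conjE)
    from q(5) obtain x where "x \<in> fst s" "x \<in> fst t" by blast
    with q(1-4) show ?thesis by (intro exI conjI)
  qed
  then obtain T s t x where D: "\<And>n. f n = pair_type (tiles (T n)) (s n) (t n)" "\<And>n. T n \<in> \<Omega>"
    "\<And>n. s n \<in> tiles (T n)" "\<And>n. t n \<in> tiles (T n)" "\<And>n. x n \<in> fst (s n)" "\<And>n. x n \<in> fst (t n)"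
    by metis
  define Z where "Z n = tr (- x n) (T n)" for n
  have "Z n \<in> \<Omega>" for n using D(2) by (simp add: Z_def)
  from seq_compactD[OF seq_compact_Omega this] obtain U r where
    r: "U \<in> \<Omega>" "strict_mono (r :: nat \<Rightarrow> nat)" "(Z \<circ> r) \<longlonglongrightarrow> U" .
  obtain v where v: "conv (Z \<circ> r) U v" using tendsto_imp_conv[OF r(3)] by blast
  obtain B where B: "B > 0" "\<forall>T\<in>\<Omega>. \<forall>t\<in>tiles T. \<forall>x\<in>fst t. \<forall>y\<in>fst t. norm (x - y) \<le> B"
    using tile_bound by blast
  have shift: "translate_tile (- x n) u \<in> tiles (Z n)" "fst (translate_tile (- x n) u) \<subseteq> ball 0 (B + 1)"
    "translate_tile (- x n) u \<in> cp (B + 1) (Z n)"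
    if "u \<in> tiles (T n)" "x n \<in> fst u" for n u
  proof -
    show m: "translate_tile (- x n) u \<in> tiles (Z n)" using that(1) by (simp add: Z_def)
    have "norm (- x n + y) \<le> B" if "y \<in> fst u" for y
      using B(2)[rule_format, OF D(2) \<open>u \<in> tiles (T n)\<close> that \<open>x n \<in> fst u\<close>] by simp
    then show "fst (translate_tile (- x n) u) \<subseteq> ball 0 (B + 1)" by fastforce
    show "translate_tile (- x n) u \<in> cp (B + 1) (Z n)"
    proof (rule mem_cp[OF m])
      show "- x n + x n \<in> fst (translate_tile (- x n) u)"
        unfolding fst_translate_tile using that(2) by (rule imageI)
    qed (use B(1) in simp)
  qed
  define S where "S = (\<lambda>(a, b). pair_type (tiles U) a b) ` (cp (B + 2) U \<times> cp (B + 2) U)"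
  have finS: "finite S" unfolding S_def using r(1) by simp
  have "\<forall>\<^sub>F n in sequentially. f (r n) \<in> S"
    using conv_agree[OF v, of "B + 1"] conv_back[OF v, of "B + 1"]
  proof eventually_elim
    case (elim n)
    let ?s = "translate_tile (- x (r n)) (s (r n))" and ?t = "translate_tile (- x (r n)) (t (r n))"
    have e: "cp (B + 1) (Z (r n)) = cp (B + 1) (tr (v n) U)" using elim(1) by simp
    note ss = shift[OF D(3) D(5), of "r n"] and tt = shift[OF D(4) D(6), of "r n"]
    have cols: "collar (tiles (Z (r n))) ?s = collar (tiles (tr (v n) U)) ?s"
      "collar (tiles (Z (r n))) ?t = collar (tiles (tr (v n) U)) ?t"
      using collar_cp(2)[OF e ss(1,2)] collar_cp(2)[OF e tt(1,2)] .
    have "f (r n) = pair_type (tiles (Z (r n))) ?s ?t"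
      unfolding D(1) Z_def tiles_tr pair_type_translate ..
    also have "\<dots> = pair_type (tiles (tr (v n) U)) ?s ?t"
      unfolding pair_type_def cols ..
    also have "\<dots> = pair_type (translate (- v n) (tiles (tr (v n) U))) (translate_tile (- v n) ?s) (translate_tile (- v n) ?t)"
      by (simp only: pair_type_translate)
    also have "translate (- v n) (tiles (tr (v n) U)) = tiles U" by (simp add: tiles_tr)
    finally have "f (r n) = pair_type (tiles U) (translate_tile (- v n) ?s) (translate_tile (- v n) ?t)" .
    moreover have "translate_tile (- v n) ?s \<in> cp (B + 2) U" "translate_tile (- v n) ?t \<in> cp (B + 2) U"
      using elim(2) ss(3) tt(3) by (simp_all add: add.assoc del: translate_tile_add)
    ultimately show ?case unfolding S_def by (intro image_eqI[of _ _ "(translate_tile (- v n) ?s, translate_tile (- v n) ?t)"]) simp_all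
  qed
  then obtain N where N: "\<And>n. n \<ge> N \<Longrightarrow> f (r n) \<in> S" unfolding eventually_sequentially by blast
  have "inj (\<lambda>n. f (r (n + N)))"
  proof (rule injI)
    fix i j assume "f (r (i + N)) = f (r (j + N))"
    then have "r (i + N) = r (j + N)" using f(1) by (simp add: inj_eq)
    then show "i = j" using strict_mono_eq[OF r(2)] by simp
  qed
  moreover have "range (\<lambda>n. f (r (n + N))) \<subseteq> S" using N by auto
  then have "finite (range (\<lambda>n. f (r (n + N))))" using finS by (rule finite_subset)
  ultimately have "finite (UNIV :: nat set)" by (rule finite_imageD[rotated])
  then show False by simp
qed

end

context substitution_cover
begin

text \<open>Gluing data of the pulled back cover: labels identify the fibre with the deck group
  along each supertile, and the triples record how the identifications for touching tiles are
  related.\<close>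

definition transitions where
  "transitions k = {(pair_type (tiles (base k z)) s t, lab k z s, lab k z t) | z s t.
     z \<in> C \<and> s \<in> tiles (base k z) \<and> t \<in> tiles (base k z) \<and> fst s \<inter> fst t \<noteq> {}}"

lemma transitionsI:
  "z \<in> C \<Longrightarrow> s \<in> tiles (base k z) \<Longrightarrow> t \<in> tiles (base k z) \<Longrightarrow> fst s \<inter> fst t \<noteq> {} \<Longrightarrow>
    (pair_type (tiles (base k z)) s t, lab k z s, lab k z t) \<in> transitions k"
  unfolding transitions_def mem_Collect_eq
  by (rule exI[of _ z], rule exI[of _ s], rule exI[of _ t]) simp

lemma transitionsE:
  assumes "q \<in> transitions k"
  obtains z s t where "q = (pair_type (tiles (base k z)) s t, lab k z s, lab k z t)" "z \<in> C"
    "s \<in> tiles (base k z)" "t \<in> tiles (base k z)" "fst s \<inter> fst t \<noteq> {}"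
  using assms unfolding transitions_def mem_Collect_eq by (elim exE conjE)

lemma transitions_subset:
  assumes "big k"
  shows "transitions k \<subseteq> {pair_type (tiles T) s t | T s t. T \<in> \<Omega> \<and> s \<in> tiles T \<and> t \<in> tiles T \<and> fst s \<inter> fst t \<noteq> {}} \<times> G \<times> G"
    (is "_ \<subseteq> ?PT \<times> _")
proof
  fix q assume "q \<in> transitions k"
  then obtain z s t where q: "q = (pair_type (tiles (base k z)) s t, lab k z s, lab k z t)" "z \<in> C"
    "s \<in> tiles (base k z)" "t \<in> tiles (base k z)" "fst s \<inter> fst t \<noteq> {}"
    by (rule transitionsE)
  have "pair_type (tiles (base k z)) s t \<in> ?PT"
    unfolding mem_Collect_eq using q(2-5) by (intro exI conjI refl) simp_all
  moreover have "lab k z s \<in> G" "lab k z t \<in> G"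
    using q(2-4) by (auto intro!: lab_in assms simp: valid_def)
  ultimately show "q \<in> ?PT \<times> G \<times> G" unfolding q(1) by (intro SigmaI)
qed

lemma big_eventually: "\<exists>k0. \<forall>k\<ge>k0. c \<le> lam ^ k * eps"
proof -
  obtain k0 where k0: "c / eps < lam ^ k0" using real_arch_pow[OF lam(1)] by blast
  have "c \<le> lam ^ k * eps" if "k \<ge> k0" for k
  proof -
    have "lam ^ k0 \<le> lam ^ k" using that lam(1) by (intro power_increasing) simp_all
    then have "c / eps < lam ^ k" using k0 by linarith
    then show ?thesis using eps(1) by (simp add: field_simps)
  qed
  then show ?thesis by blast
qed

text \<open>Pulling the cover back along large powers of the substitution yields only finitely many
  transition patterns, so two of the pulled back covers are isomorphic.\<close>

lemma transitions_repeat: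
  obtains k m where "k < m" "big k" "big m" "transitions k = transitions m"
proof -
  obtain k0 where k0: "\<forall>k\<ge>k0. big k" using big_eventually[of R2] unfolding big_def by blast
  have "finite (Pow ({pair_type (tiles T) s t | T s t. T \<in> \<Omega> \<and> s \<in> tiles T \<and> t \<in> tiles T \<and> fst s \<inter> fst t \<noteq> {}} \<times> G \<times> G))"
    using finite_pair_types finite_deck by (intro finite_Pow_iff[THEN iffD2] finite_cartesian_product)
  moreover have "transitions ` {k0..} \<subseteq> Pow ({pair_type (tiles T) s t | T s t. T \<in> \<Omega> \<and> s \<in> tiles T \<and> t \<in> tiles T \<and> fst s \<inter> fst t \<noteq> {}} \<times> G \<times> G)"
    using k0 by (intro image_subsetI PowI transitions_subset) simp
  ultimately have "finite (transitions ` {k0..})" by (rule finite_subset[rotated])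
  from pigeonhole_infinite[OF infinite_Ici this]
  obtain k where k: "k \<ge> k0" "infinite {a \<in> {k0..}. transitions a = transitions k}" by auto
  then obtain m where "m > k" "m \<in> {a \<in> {k0..}. transitions a = transitions k}"
    unfolding infinite_nat_iff_unbounded by blast
  then show thesis using that[of k m] k0 k(1) by simp
qed

text \<open>Touching tiles share a point. Linking along the first tile gives nearness at that point,
  and from there nearness spreads over the supertile of the second.\<close>

lemma transitions_functional:
  assumes big: "big k" and q: "(\<tau>, g, h) \<in> transitions k" "(\<tau>, g, h') \<in> transitions k"
  shows "h = h'"
proof -
  obtain z1 s1 t1 where 1: "(\<tau>, g, h) = (pair_type (tiles (base k z1)) s1 t1, lab k z1 s1, lab k z1 t1)" "z1 \<in> C"
    "s1 \<in> tiles (base k z1)" "t1 \<in> tiles (base k z1)" "fst s1 \<inter> fst t1 \<noteq> {}"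
    using q(1) by (rule transitionsE)
  obtain z2 s2 t2 where 2: "(\<tau>, g, h') = (pair_type (tiles (base k z2)) s2 t2, lab k z2 s2, lab k z2 t2)" "z2 \<in> C"
    "s2 \<in> tiles (base k z2)" "t2 \<in> tiles (base k z2)" "fst s2 \<inter> fst t2 \<noteq> {}"
    using q(2) by (rule transitionsE)
  have "pair_type (tiles (base k z1)) s1 t1 = pair_type (tiles (base k z2)) s2 t2" using 1(1) 2(1) by simp
  from pair_type_eqD[OF this] obtain v where v: "s2 = translate_tile v s1" "t2 = translate_tile v t1"
    "collar (tiles (base k z2)) s2 = translate v (collar (tiles (base k z1)) s1)"
    "collar (tiles (base k z2)) t2 = translate v (collar (tiles (base k z1)) t1)" by blast
  have val: "valid k z1 s1" "valid k z1 t1" "valid k z2 s2" "valid k z2 t2"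
    using 1 2 by (simp_all add: valid_def)
  have cs: "ctype k z1 s1 = ctype k z2 s2" unfolding collar_type_eq_iff using v(1,3) by blast
  have ct: "ctype k z1 t1 = ctype k z2 t2" unfolding collar_type_eq_iff using v(2,4) by blast
  have "lab k z1 s1 = lab k z2 s2" using 1(1) 2(1) by simp
  then have "linked k z1 s1 z2 s2" using lab_eq_iff[OF big val(1,3) cs] by simp
  then obtain w where w: "s2 = translate_tile w s1"
    "\<forall>y\<in>(L ^^ k) ` fst s2. near (flow (- y) (flow ((L ^^ k) w) z1)) (flow (- y) z2)"
    unfolding linked_def by blast
  have bt: "ball_tile s1" by (rule tiles_ball_tile[OF 1(3)])
  have "translate_tile w s1 = translate_tile v s1" using v(1) w(1) by simp
  then have "w = v" by (simp only: translate_tile_eq_iff[OF bt])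
  obtain a where a: "a \<in> fst s2" "a \<in> fst t2" using 2(5) by blast
  have "linked k z1 t1 z2 t2"
    by (rule linked_at[OF big val(2,4) v(2,4) a(2)]) (use w(2) a(1) \<open>w = v\<close> in blast)
  then have "lab k z1 t1 = lab k z2 t2" using lab_eq_iff[OF big val(2,4) ct] by simp
  then show ?thesis using 1(1) 2(1) by simp
qed

section \<open>Isomorphisms between pulled back covers\<close>

definition relabel where
  "relabel k m z z' \<longleftrightarrow> z \<in> C \<and> z' \<in> C \<and> base m z' = base k z \<and> (\<forall>t\<in>tiles (base k z). lab m z' t = lab k z t)"

lemma relabel_sym: "relabel k m z z' \<Longrightarrow> relabel m k z' z"
  by (simp add: relabel_def)

lemma relabel_unique:
  assumes big: "big m" and r: "relabel k m z z1" "relabel k m z z2"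
  shows "z1 = z2"
proof -
  obtain t where t: "t \<in> tiles (base k z)" using tiles_cover by blast
  have val: "valid m z1 t" "valid m z2 t" using r t by (simp_all add: relabel_def valid_def)
  have b: "base m z1 = base m z2" using r by (simp add: relabel_def)
  have "lab m z1 t = lab m z2 t" using r t by (simp add: relabel_def)
  then have "linked m z1 t z2 t" using lab_eq_iff[OF big val] b by simp
  from linked_same_base[OF this val b] show ?thesis .
qed

text \<open>The label of one tile is matched by \<open>lab_surj\<close>. Equal transition data force
  equality at every touching tile, and so over the whole tiling.\<close>

lemma relabel_ex:
  assumes big: "big k" "big m" and tr: "transitions k = transitions m" and z: "z \<in> C"
  shows "\<exists>z'. relabel k m z z'"
proof -
  let ?T = "base k z"
  obtain t0 where t0: "t0 \<in> tiles ?T" using tiles_cover by blast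
  have "lab k z t0 \<in> G" using big(1) z t0 by (intro lab_in) (simp_all add: valid_def)
  from lab_surj[OF big(2) base_mem[OF z] t0 this]
  obtain z' where z': "z' \<in> C" "base m z' = ?T" "lab m z' t0 = lab k z t0" by blast
  have "lab m z' t = lab k z t" if t: "t \<in> tiles ?T" for t
  proof (rule touching_induct[where P = "\<lambda>t. lab m z' t = lab k z t", OF base_mem[OF z] t0 z'(3) t])
    fix s t assume st: "s \<in> tiles ?T" "t \<in> tiles ?T" "lab m z' s = lab k z s" "fst s \<inter> fst t \<noteq> {}"
    have "(pair_type (tiles ?T) s t, lab k z s, lab k z t) \<in> transitions m"
      unfolding tr[symmetric] by (rule transitionsI[OF z st(1,2,4)])
    moreover have "(pair_type (tiles ?T) s t, lab k z s, lab m z' t) \<in> transitions m"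
      using transitionsI[OF z'(1), of s m t] st z'(2) by simp
    ultimately show "lab m z' t = lab k z t" using transitions_functional[OF big(2)] by blast
  qed
  then show ?thesis using z z' unfolding relabel_def by blast
qed

lemma relabel_flow:
  assumes big: "big k" "big m" and r: "relabel k m z z'"
  shows "relabel k m (flow ((L ^^ k) v) z) (flow ((L ^^ m) v) z')"
proof -
  have z: "z \<in> C" "z' \<in> C" "base m z' = base k z" "\<forall>t\<in>tiles (base k z). lab m z' t = lab k z t"
    using r by (simp_all add: relabel_def)
  have "lab m (flow ((L ^^ m) v) z') t = lab k (flow ((L ^^ k) v) z) t" if "t \<in> tiles (tr v (base k z))" for t
  proof -
    define s where "s = translate_tile (- v) t"
    have s: "s \<in> tiles (base k z)" "t = translate_tile v s" using that by (simp_all add: s_def mem_tiles_tr)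
    show ?thesis
      unfolding s(2) using z s(1) lab_flow[OF big(1), of z s v] lab_flow[OF big(2), of z' s v]
      by (simp add: valid_def)
  qed
  then show ?thesis using z by (simp add: relabel_def)
qed

text \<open>Convergence in the cover amounts to convergence of tilings together with linking along
  one tile. Linking is equality of labels over equal collar types, and relabelling preserves
  both.\<close>

lemma relabel_tendsto:
  assumes big: "big k" "big m" and r: "relabel k m z z'" "\<And>n. relabel k m (X n) (X' n)" and X: "X \<longlonglongrightarrow> z"
  shows "X' \<longlonglongrightarrow> z'"
proof -
  have z: "z \<in> C" "z' \<in> C" "base m z' = base k z" "\<forall>t\<in>tiles (base k z). lab m z' t = lab k z t"
    using r(1) by (simp_all add: relabel_def)
  have XC: "X n \<in> C" "X' n \<in> C" "base m (X' n) = base k (X n)"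
    "\<forall>t\<in>tiles (base k (X n)). lab m (X' n) t = lab k (X n) t" for n
    using r(2)[of n] by (simp_all add: relabel_def)
  obtain v where v: "conv (\<lambda>n. base k (X n)) (base k z) v"
    using tendsto_imp_conv[OF tendsto_base[OF X z(1) XC(1)]] by blast
  obtain t where t: "t \<in> tiles (base k z)" using tiles_cover by blast
  have v': "conv (\<lambda>n. base m (X' n)) (base m z') v" using v by (simp add: XC(3) z(3))
  have t': "t \<in> tiles (base m z')" using t by (simp add: z(3))
  have "\<forall>\<^sub>F n in sequentially. linked m z' t (X' n) (translate_tile (v n) t)"
    using eventually_linked[OF big(1) X z(1) XC(1) v t]
  proof eventually_elim
    case (elim n)
    let ?t = "translate_tile (v n) t"
    have val: "valid k z t" "valid k (X n) ?t" "valid m z' t" "valid m (X' n) ?t"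
      using elim z XC t by (simp_all add: valid_def)
    have ct: "ctype k z t = ctype k (X n) ?t" using elim linked_ctype by blast
    have "lab k z t = lab k (X n) ?t" using elim lab_eq_iff[OF big(1) val(1,2) ct] by simp
    then have "lab m z' t = lab m (X' n) ?t" using z(4) XC(4) t val(2) by (simp add: valid_def)
    moreover have "ctype m z' t = ctype m (X' n) ?t" using ct by (simp add: z(3) XC(3))
    ultimately show ?case using lab_eq_iff[OF big(2) val(3,4)] by simp
  qed
  from tendsto_of_linked[OF z(2) XC(2) v' t' this] show ?thesis .
qed

text \<open>Relabelling from \<open>k\<close> to \<open>m\<close> gives \<open>F\<close>, and
  relabelling from \<open>m\<close> to \<open>k\<close> its inverse. Applying
  \<open>\<sigma> ^^ m\<close> to \<open>base m (F x) = base k x\<close> leaves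
  \<open>\<sigma> ^^ (m - k)\<close> on the side of \<open>p x\<close>.\<close>

lemma lift_exists:
  obtains n F F' where "n > 0" "\<forall>x\<in>C. F x \<in> C \<and> F' x \<in> C \<and> F' (F x) = x \<and> F (F' x) = x"
    "\<forall>x\<in>C. p (F x) = (\<sigma> ^^ n) (p x)" "\<forall>x\<in>C. \<forall>v. F (flow v x) = flow ((L ^^ n) v) (F x)"
    "\<forall>X x. x \<in> C \<longrightarrow> (\<forall>n. X n \<in> C) \<longrightarrow> X \<longlonglongrightarrow> x \<longrightarrow> (\<lambda>n. F (X n)) \<longlonglongrightarrow> F x"
    "\<forall>X x. x \<in> C \<longrightarrow> (\<forall>n. X n \<in> C) \<longrightarrow> X \<longlonglongrightarrow> x \<longrightarrow> (\<lambda>n. F' (X n)) \<longlonglongrightarrow> F' x"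
proof -
  obtain k m where km: "k < m" "big k" "big m" "transitions k = transitions m"
    by (rule transitions_repeat)
  have "\<forall>z. \<exists>z'. z \<in> C \<longrightarrow> relabel k m z z'" using relabel_ex[OF km(2-4)] by blast
  then obtain F where F: "\<And>z. z \<in> C \<Longrightarrow> relabel k m z (F z)" by metis
  have "\<forall>z. \<exists>z'. z \<in> C \<longrightarrow> relabel m k z z'" using relabel_ex[OF km(3,2) km(4)[symmetric]] by blast
  then obtain F' where F': "\<And>z. z \<in> C \<Longrightarrow> relabel m k z (F' z)" by metis
  have FC: "F z \<in> C" "F' z \<in> C" if "z \<in> C" for z using F[OF that] F'[OF that] by (simp_all add: relabel_def)
  define n where "n = m - k"
  have mn: "m = n + k" "n > 0" using km(1) by (simp_all add: n_def)
  show thesis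
  proof (rule that[of n F F'])
    show "\<forall>x\<in>C. F x \<in> C \<and> F' x \<in> C \<and> F' (F x) = x \<and> F (F' x) = x"
    proof (intro ballI conjI)
      fix x assume x: "x \<in> C"
      show "F x \<in> C" "F' x \<in> C" using FC x by simp_all
      show "F' (F x) = x"
        using relabel_unique[OF km(2) F'[OF FC(1)[OF x]] relabel_sym[OF F[OF x]]] .
      show "F (F' x) = x"
        using relabel_unique[OF km(3) F[OF FC(2)[OF x]] relabel_sym[OF F'[OF x]]] .
    qed
    show "\<forall>x\<in>C. p (F x) = (\<sigma> ^^ n) (p x)"
    proof
      fix x assume x: "x \<in> C"
      have "p (F x) = (\<sigma> ^^ m) (base m (F x))" using FC(1)[OF x] by simp
      also have "\<dots> = (\<sigma> ^^ n) ((\<sigma> ^^ k) (base k x))"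
        using F[OF x] by (simp add: relabel_def mn(1) funpow_add)
      finally show "p (F x) = (\<sigma> ^^ n) (p x)" using x by simp
    qed
    show "\<forall>x\<in>C. \<forall>v. F (flow v x) = flow ((L ^^ n) v) (F x)"
    proof (intro ballI allI)
      fix x v assume x: "x \<in> C"
      \<comment> \<open>\<open>relabel_flow\<close> speaks of vectors in the image of
        \<open>L ^^ k\<close>, which is the whole space.\<close>
      obtain w where w: "v = (L ^^ k) w" using bij_Lk[of k] by (metis bij_pointE)
      have "(L ^^ m) w = (L ^^ n) v" by (simp add: w mn(1) funpow_add)
      with relabel_flow[OF km(2,3) F[OF x], of w] have "relabel k m (flow v x) (flow ((L ^^ n) v) (F x))"
        by (simp add: w)
      then show "F (flow v x) = flow ((L ^^ n) v) (F x)"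
        using relabel_unique[OF km(3) F[of "flow v x"]] x by simp
    qed
    show "\<forall>X x. x \<in> C \<longrightarrow> (\<forall>n. X n \<in> C) \<longrightarrow> X \<longlonglongrightarrow> x \<longrightarrow> (\<lambda>n. F (X n)) \<longlonglongrightarrow> F x"
      using relabel_tendsto[OF km(2,3) F F] by blast
    show "\<forall>X x. x \<in> C \<longrightarrow> (\<forall>n. X n \<in> C) \<longrightarrow> X \<longlonglongrightarrow> x \<longrightarrow> (\<lambda>n. F' (X n)) \<longlonglongrightarrow> F' x"
      using relabel_tendsto[OF km(3,2) F' F'] by blast
  qed (rule mn(2))
qed

end

locale lifted_substitution = substitution_cover T0 \<Omega> L \<sigma> \<sigma>i \<omega> C p
  for T0 :: "('a::euclidean_space, 'l) tiling" and \<Omega> L \<sigma> \<sigma>i \<omega>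
    and C :: "'c::topological_space set" and p +
  fixes n :: nat and F F' :: "'c \<Rightarrow> 'c"
  assumes n: "n > 0"
    and F_inv: "x \<in> C \<Longrightarrow> F x \<in> C \<and> F' x \<in> C \<and> F' (F x) = x \<and> F (F' x) = x"
    and p_F: "x \<in> C \<Longrightarrow> p (F x) = (\<sigma> ^^ n) (p x)"
    and F_flow: "x \<in> C \<Longrightarrow> F (flow v x) = flow ((L ^^ n) v) (F x)"
    and F_tendsto: "x \<in> C \<Longrightarrow> (\<And>i. X i \<in> C) \<Longrightarrow> X \<longlonglongrightarrow> x \<Longrightarrow> (\<lambda>i. F (X i)) \<longlonglongrightarrow> F x"
    and F'_tendsto: "x \<in> C \<Longrightarrow> (\<And>i. X i \<in> C) \<Longrightarrow> X \<longlonglongrightarrow> x \<Longrightarrow> (\<lambda>i. F' (X i)) \<longlonglongrightarrow> F' x"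
begin

lemma F_mem [simp]: "x \<in> C \<Longrightarrow> F x \<in> C" and F'_mem [simp]: "x \<in> C \<Longrightarrow> F' x \<in> C"
  and F'_F [simp]: "x \<in> C \<Longrightarrow> F' (F x) = x" and F_F' [simp]: "x \<in> C \<Longrightarrow> F (F' x) = x"
  using F_inv by blast+

text \<open>Uniform continuity of \<open>F\<close> in terms of nearness, by compactness as for the
  flow. Agreement of the images on radius \<open>R0\<close> holds because agreement on a central
  ball is inherited by the substituted tilings.\<close>

lemma F_near_uniform: "\<exists>R. \<forall>x y. near x y \<longrightarrow> cp R (p x) = cp R (p y) \<longrightarrow> near (F x) (F y)"
proof (rule ccontr)
  assume neg: "\<not> ?thesis"
  have "\<exists>x y. near x y \<and> cp (real i) (p x) = cp (real i) (p y) \<and> \<not> near (F x) (F y)" for i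
    using neg by blast
  then obtain X Y where D: "\<And>i. near (X i) (Y i)" "\<And>i. cp (real i) (p (X i)) = cp (real i) (p (Y i))"
    "\<And>i. \<not> near (F (X i)) (F (Y i))"
    by metis
  have XC: "\<And>i. X i \<in> C" and YC: "\<And>i. Y i \<in> C" using D(1) nearD by blast+
  from near_seq_limit[OF D(1,2)] obtain x and r :: "nat \<Rightarrow> nat" where r: "x \<in> C" "strict_mono r"
    "(\<lambda>i. X (r i)) \<longlonglongrightarrow> x" "(\<lambda>i. Y (r i)) \<longlonglongrightarrow> x"
    "\<forall>\<rho>. \<forall>\<^sub>F i in sequentially. cp \<rho> (p (X (r i))) = cp \<rho> (p (Y (r i)))" .
  have "\<forall>\<^sub>F i in sequentially. near (F (X (r i))) (F (Y (r i)))"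
  proof (rule eventually_near)
    show "(\<lambda>i. F (X (r i))) \<longlonglongrightarrow> F x" "(\<lambda>i. F (Y (r i))) \<longlonglongrightarrow> F x"
      using F_tendsto[OF r(1) _ r(3)] F_tendsto[OF r(1) _ r(4)] XC YC by simp_all
    show "\<forall>\<^sub>F i in sequentially. cp R0 (p (F (X (r i)))) = cp R0 (p (F (Y (r i))))"
      using r(5)[rule_format, of R0]
    proof eventually_elim
      case (elim i)
      have "cp R0 ((\<sigma> ^^ n) (p (X (r i)))) = cp R0 ((\<sigma> ^^ n) (p (Y (r i))))"
        by (rule cp_sigma_pow[OF _ _ elim]) (use XC YC in simp_all)
      then show ?case using XC YC by (simp add: p_F)
    qed
  qed (use r(1) XC YC in simp_all)
  then show False using D(3) by simp
qed

definition R3 :: real where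
  "R3 = (SOME R. \<forall>x y. near x y \<longrightarrow> cp R (p x) = cp R (p y) \<longrightarrow> near (F x) (F y))"

lemma F_near: "near x y \<Longrightarrow> cp R3 (p x) = cp R3 (p y) \<Longrightarrow> near (F x) (F y)"
  using someI_ex[OF F_near_uniform] unfolding R3_def[symmetric] by blast

lemma F_pow_mem [simp]: "x \<in> C \<Longrightarrow> (F ^^ i) x \<in> C"
  by (induction i) simp_all

lemma p_F_pow: "x \<in> C \<Longrightarrow> p ((F ^^ i) x) = (\<sigma> ^^ (n * i)) (p x)"
proof (induction i)
  case (Suc i)
  have "p ((F ^^ Suc i) x) = (\<sigma> ^^ n) (p ((F ^^ i) x))" using Suc.prems by (simp add: p_F)
  also have "\<dots> = (\<sigma> ^^ n) ((\<sigma> ^^ (n * i)) (p x))" using Suc by simp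
  also have "\<dots> = (\<sigma> ^^ (n * Suc i)) (p x)" by (simp add: funpow_add)
  finally show ?case .
qed simp

lemma F_pow_flow: "x \<in> C \<Longrightarrow> (F ^^ i) (flow v x) = flow ((L ^^ (n * i)) v) ((F ^^ i) x)"
proof (induction i)
  case (Suc i)
  then have "(F ^^ Suc i) (flow v x) = flow ((L ^^ n) ((L ^^ (n * i)) v)) ((F ^^ Suc i) x)"
    by (simp add: F_flow)
  also have "(L ^^ n) ((L ^^ (n * i)) v) = (L ^^ (n * Suc i)) v" by (simp add: funpow_add)
  finally show ?case .
qed simp

lemma F_pow_tendsto: "x \<in> C \<Longrightarrow> (\<And>i. X i \<in> C) \<Longrightarrow> X \<longlonglongrightarrow> x \<Longrightarrow> (\<lambda>i. (F ^^ j) (X i)) \<longlonglongrightarrow> (F ^^ j) x"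
proof (induction j)
  case (Suc j)
  have "(\<lambda>i. F ((F ^^ j) (X i))) \<longlonglongrightarrow> F ((F ^^ j) x)" using Suc by (intro F_tendsto) simp_all
  then show ?case by simp
qed simp

lemma F'_pow: "x \<in> C \<Longrightarrow> (F' ^^ j) ((F ^^ j) x) = x"
proof (induction j arbitrary: x)
  case (Suc j)
  have "(F' ^^ Suc j) ((F ^^ Suc j) x) = (F' ^^ j) (F' (F ((F ^^ j) x)))" by (simp add: funpow_swap1)
  then show ?case using Suc by simp
qed simp

lemma F'_pow_tendsto: "x \<in> C \<Longrightarrow> (\<And>i. X i \<in> C) \<Longrightarrow> X \<longlonglongrightarrow> x \<Longrightarrow> (\<lambda>i. (F' ^^ j) (X i)) \<longlonglongrightarrow> (F' ^^ j) x"
proof (induction j)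
  case (Suc j)
  have "(F' ^^ j) y \<in> C" if "y \<in> C" for y using that by (induction j) simp_all
  then have "(\<lambda>i. F' ((F' ^^ j) (X i))) \<longlonglongrightarrow> F' ((F' ^^ j) x)" using Suc by (intro F'_tendsto) simp_all
  then show ?case by simp
qed simp

end

section \<open>The labelled tilings\<close>

lemma collar_type_translate:
  "collar_type (translate v P) (translate_tile v t) = collar_type P t"
  unfolding collar_type_eq_iff by (intro exI[of _ "- v"]) (simp add: collar_translate)

definition unlabel :: "('a, 'l \<times> 'x) tile \<Rightarrow> ('a, 'l) tile" where
  "unlabel u = (fst u, fst (snd u))"

lemma fst_unlabel [simp]: "fst (unlabel u) = fst u"
  by (simp add: unlabel_def)

lemma unlabel_translate_tile: "unlabel (translate_tile v u) = translate_tile v (unlabel u)"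
  by (simp add: unlabel_def translate_tile_def)

lemma unlabel_translate: "unlabel ` translate v P = translate v (unlabel ` P)"
  by (simp add: translate_def image_image unlabel_translate_tile)

lemma ball_tile_fst_cong: "fst s = fst t \<Longrightarrow> ball_tile s = ball_tile t"
  by (simp add: ball_tile_def)

context lifted_substitution
begin

text \<open>Labels are taken at a level that is a multiple of \<open>n\<close>, so that iterates of
  \<open>F\<close> reach it. The level is high enough for \<open>R2\<close>, which labels require,
  and for \<open>R3\<close>, which their compatibility with \<open>F\<close> requires.\<close>

definition J :: nat where "J = (SOME j. max R2 R3 \<le> lam ^ (n * j) * eps)"

definition K :: nat where "K = n * J"

lemma K: "big K" "R3 \<le> lam ^ K * eps"
proof -
  obtain k0 where k0: "\<forall>k\<ge>k0. max R2 R3 \<le> lam ^ k * eps" using big_eventually by blast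
  have "k0 \<le> n * k0" using n by simp
  then have "max R2 R3 \<le> lam ^ (n * k0) * eps" using k0 by blast
  then have "\<exists>j. max R2 R3 \<le> lam ^ (n * j) * eps" by blast
  from someI_ex[OF this] have "max R2 R3 \<le> lam ^ K * eps" unfolding K_def J_def .
  then show "big K" "R3 \<le> lam ^ K * eps" by (simp_all add: big_def)
qed

text \<open>The labels of the tiles of \<open>p x\<close> are read at \<open>psi x\<close>, since
  this is the point of the level \<open>K\<close> pullback with
  \<open>base K (psi x) = p x\<close>.\<close>

definition psi :: "'c \<Rightarrow> 'c" where "psi = F ^^ J"

lemma psi_mem [simp]: "x \<in> C \<Longrightarrow> psi x \<in> C"
  by (simp add: psi_def)

lemma base_psi [simp]: "x \<in> C \<Longrightarrow> base K (psi x) = p x"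
  by (simp add: base_def psi_def p_F_pow K_def)

lemma psi_flow: "x \<in> C \<Longrightarrow> psi (flow v x) = flow ((L ^^ K) v) (psi x)"
  by (simp add: psi_def F_pow_flow K_def)

lemma psi_F: "psi (F x) = F (psi x)"
  by (simp add: psi_def funpow_swap1)

definition label_tile :: "'c \<Rightarrow> ('a, 'l) tile \<Rightarrow> ('a, 'l \<times> ('a, 'l) collar_type \<times> ('c \<Rightarrow> 'c)) tile" where
  "label_tile x t = (fst t, snd t, collar_type (tiles (p x)) t, lab K (psi x) t)"

lemma unlabel_label_tile [simp]: "unlabel (label_tile x t) = t"
  by (simp add: unlabel_def label_tile_def)

lemma fst_label_tile [simp]: "fst (label_tile x t) = fst t"
  by (simp add: label_tile_def)

lemma valid_psi: "x \<in> C \<Longrightarrow> valid K (psi x) t \<longleftrightarrow> t \<in> tiles (p x)"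
  by (simp add: valid_def)

lemma label_tile_flow:
  assumes "x \<in> C" "t \<in> tiles (p x)"
  shows "label_tile (flow v x) (translate_tile v t) = translate_tile v (label_tile x t)"
  using assms lab_flow[OF K(1), of "psi x" t v]
  by (simp add: label_tile_def translate_tile_def[of v "(_, _)"] tiles_tr collar_type_translate psi_flow valid_psi)

lemma is_tiling_label_tile: "is_tiling (label_tile x ` tiles (p x))"
  unfolding is_tiling_def
proof (intro conjI ballI)
  fix u assume "u \<in> label_tile x ` tiles (p x)"
  then obtain t where "t \<in> tiles (p x)" "u = label_tile x t" by blast
  then show "ball_tile u" using tiles_ball_tile[of t "p x"] ball_tile_fst_cong[of "label_tile x t" t] by simp
next
  show "disjoint_interiors (label_tile x ` tiles (p x))"
    unfolding disjoint_interiors_def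
  proof (rule pairwiseI)
    fix a b assume "a \<in> label_tile x ` tiles (p x)" "b \<in> label_tile x ` tiles (p x)" "a \<noteq> b"
    then obtain s t where st: "s \<in> tiles (p x)" "t \<in> tiles (p x)" "a = label_tile x s" "b = label_tile x t" "s \<noteq> t" by blast
    then show "interior (fst a) \<inter> interior (fst b) = {}" using tiles_eqI[OF st(1,2)] by auto
  qed
next
  have "support (label_tile x ` tiles (p x)) = support (tiles (p x))" by (simp add: support_def)
  then show "support (label_tile x ` tiles (p x)) = UNIV" using is_tiling_tiles[of "p x"] by (simp add: is_tiling_def)
qed

definition h :: "'c \<Rightarrow> ('a, 'l \<times> ('a, 'l) collar_type \<times> ('c \<Rightarrow> 'c)) tiling" where
  "h x = Tiling (label_tile x ` tiles (p x))"

lemma tiles_h: "tiles (h x) = label_tile x ` tiles (p x)"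
  unfolding h_def by (rule Tiling_inverse) (simp add: is_tiling_label_tile)

lemma h_flow: "x \<in> C \<Longrightarrow> h (flow v x) = tr v (h x)"
proof -
  assume x: "x \<in> C"
  have "tiles (h (flow v x)) = (\<lambda>t. label_tile (flow v x) (translate_tile v t)) ` tiles (p x)"
    using x by (simp add: tiles_h tiles_tr translate_def image_image)
  also have "\<dots> = (\<lambda>t. translate_tile v (label_tile x t)) ` tiles (p x)"
    using label_tile_flow[OF x] by simp
  also have "\<dots> = tiles (tr v (h x))" by (simp add: tiles_tr tiles_h translate_def image_image)
  finally show ?thesis by (simp add: tiles_inject)
qed

lemma unlabel_tiles_h: "unlabel ` tiles (h x) = tiles (p x)"
  by (simp add: tiles_h image_image)

lemma adds_labels_h:
  assumes x: "x \<in> C"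
  shows "adds_labels G (p x) (h x)"
  unfolding adds_labels_def
proof
  have "(\<lambda>(S, l, c, g). (S, l)) = (unlabel :: ('a, 'l \<times> ('a, 'l) collar_type \<times> ('c \<Rightarrow> 'c)) tile \<Rightarrow> _)"
    by (auto simp: unlabel_def)
  then show "(\<lambda>(S, l, c, g). (S, l)) ` tiles (h x) = tiles (p x)" by (simp add: unlabel_tiles_h)
  show "\<forall>(S, l, c, g)\<in>tiles (h x). c = collar_type (tiles (p x)) (S, l) \<and> g \<in> G"
  proof
    fix u assume "u \<in> tiles (h x)"
    then obtain t where t: "t \<in> tiles (p x)" "u = label_tile x t" unfolding tiles_h by blast
    have "lab K (psi x) t \<in> G" using K(1) x t(1) by (intro lab_in) (simp_all add: valid_psi)
    then show "case u of (S, l, c, g) \<Rightarrow> c = collar_type (tiles (p x)) (S, l) \<and> g \<in> G"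
      by (simp add: t(2) label_tile_def)
  qed
qed

text \<open>Deck labels are comparable only over the same collar type. Carrying the collar type in
  the tile turns equality of labelled tiles, up to the shift \<open>v\<close>, into linking.\<close>

lemma label_tile_eq_iff:
  assumes x: "x \<in> C" "y \<in> C" and t: "s \<in> tiles (p x)" "translate_tile v s \<in> tiles (p y)"
  shows "label_tile y (translate_tile v s) = translate_tile v (label_tile x s) \<longleftrightarrow> linked K (psi x) s (psi y) (translate_tile v s)"
proof -
  have val: "valid K (psi x) s" "valid K (psi y) (translate_tile v s)" using x t by (simp_all add: valid_psi)
  have "label_tile y (translate_tile v s) = translate_tile v (label_tile x s) \<longleftrightarrow>
      ctype K (psi x) s = ctype K (psi y) (translate_tile v s) \<and> lab K (psi x) s = lab K (psi y) (translate_tile v s)"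
    using x by (auto simp: label_tile_def translate_tile_def)
  also have "\<dots> \<longleftrightarrow> linked K (psi x) s (psi y) (translate_tile v s)"
    using lab_eq_iff[OF K(1) val] linked_ctype by blast
  finally show ?thesis .
qed

lemma cp_h: "cp r (h x) = label_tile x ` cp r (p x)"
  unfolding tiles_h central_patch_def Compr_image_eq fst_label_tile ..

lemma finite_cp_h: "x \<in> C \<Longrightarrow> finite (cp r (h x))"
  by (simp add: cp_h)

lemma cp_unlabel: "unlabel ` {u \<in> P. fst u \<inter> B \<noteq> {}} = {t \<in> unlabel ` P. fst t \<inter> B \<noteq> {}}"
  unfolding Compr_image_eq fst_unlabel ..

text \<open>By \<open>eventually_linked\<close> each tile eventually keeps its label along the
  sequence, and only finitely many tiles are involved in a given ball.\<close>

lemma conv_h: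
  assumes X: "X \<longlonglongrightarrow> x" "x \<in> C" "\<And>i. X i \<in> C" and v: "conv (\<lambda>i. p (X i)) (p x) v"
  shows "conv (\<lambda>i. h (X i)) (h x) v"
  unfolding conv_def
proof (intro conjI allI)
  show "v \<longlonglongrightarrow> 0" using v by (simp add: conv_def)
  fix r
  have psiX: "(\<lambda>i. psi (X i)) \<longlonglongrightarrow> psi x" unfolding psi_def by (rule F_pow_tendsto[OF X(2,3,1)])
  have "conv (\<lambda>i. base K (psi (X i))) (base K (psi x)) v" using v X by simp
  from eventually_linked[OF K(1) psiX _ _ this]
  have each: "\<forall>\<^sub>F i in sequentially. valid K (psi (X i)) (translate_tile (v i) t) \<and>
      linked K (psi x) t (psi (X i)) (translate_tile (v i) t)" if "t \<in> tiles (p x)" for t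
    using that X(2,3) by simp
  have "\<forall>\<^sub>F i in sequentially. \<forall>t\<in>cp (r + 1) (p x). valid K (psi (X i)) (translate_tile (v i) t) \<and>
      linked K (psi x) t (psi (X i)) (translate_tile (v i) t)"
  proof (rule eventually_ball_finite)
    show "finite (cp (r + 1) (p x))" using X(2) by simp
    show "\<forall>t\<in>cp (r + 1) (p x). \<forall>\<^sub>F i in sequentially. valid K (psi (X i)) (translate_tile (v i) t) \<and>
      linked K (psi x) t (psi (X i)) (translate_tile (v i) t)"
      using each cp_subset by blast
  qed
  with conv_back[OF v, of r]
  show "\<forall>\<^sub>F i in sequentially. cp r (h (X i)) = cp r (tr (v i) (h x))"
  proof eventually_elim
    case (elim i)
    have "cp r (h (X i)) \<subseteq> tiles (tr (v i) (h x))"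
    proof
      fix u assume "u \<in> cp r (h (X i))"
      then obtain s where s: "s \<in> cp r (p (X i))" "u = label_tile (X i) s" unfolding cp_h by blast
      define t where "t = translate_tile (- v i) s"
      have st: "s = translate_tile (v i) t" by (simp add: t_def)
      have t: "t \<in> cp (r + 1) (p x)" using elim(1) s(1) by (simp add: t_def)
      then have tx: "t \<in> tiles (p x)" using cp_subset by blast
      have "translate_tile (v i) t \<in> tiles (p (X i))" using s(1) cp_subset unfolding st by blast
      then have "u = translate_tile (v i) (label_tile x t)"
        unfolding s(2) st using label_tile_eq_iff[OF X(2,3) tx] elim(2) t by blast
      then show "u \<in> tiles (tr (v i) (h x))" using tx by (simp add: tiles_h)
    qed
    then show ?case using finite_cp_h[OF X(3)] by (rule cp_eqI)
  qed
qed

lemma tendsto_h: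
  assumes X: "X \<longlonglongrightarrow> x" "x \<in> C" "\<And>i. X i \<in> C"
  shows "(\<lambda>i. h (X i)) \<longlonglongrightarrow> h x"
proof -
  obtain v where "conv (\<lambda>i. p (X i)) (p x) v" using tendsto_imp_conv[OF tendsto_p[OF X]] by blast
  from conv_imp_tendsto[OF conv_h[OF X this]] show ?thesis .
qed

text \<open>Forgetting labels gives convergence of the underlying tilings, and one labelled tile
  gives linking; together they give convergence of \<open>psi (X i)\<close>. The continuous inverse
  of \<open>F\<close> undoes \<open>psi\<close>.\<close>

lemma tendsto_of_h:
  assumes hX: "(\<lambda>i. h (X i)) \<longlonglongrightarrow> h x" and x: "x \<in> C" "\<And>i. X i \<in> C"
  shows "X \<longlonglongrightarrow> x"
proof -
  obtain v where v: "conv (\<lambda>i. h (X i)) (h x) v" using tendsto_imp_conv[OF hX] by blast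
  have unl: "unlabel ` cp r (tr w (h y)) = cp r (tr w (p y))" for r w y
    unfolding central_patch_def cp_unlabel tiles_tr unlabel_translate unlabel_tiles_h ..
  have unl0: "unlabel ` cp r (h y) = cp r (p y)" for r y using unl[of r 0 y] by simp
  have pv: "conv (\<lambda>i. p (X i)) (p x) v"
    unfolding conv_def
  proof (intro conjI allI)
    show "v \<longlonglongrightarrow> 0" using v by (simp add: conv_def)
    fix r
    from conv_agree[OF v, of r] show "\<forall>\<^sub>F i in sequentially. cp r (p (X i)) = cp r (tr (v i) (p x))"
    proof eventually_elim
      case (elim i)
      then have "unlabel ` cp r (h (X i)) = unlabel ` cp r (tr (v i) (h x))" by simp
      then show ?case unfolding unl unl0 .
    qed
  qed
  obtain t where t: "t \<in> tiles (p x)" using tiles_cover by blast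
  have "label_tile x t \<in> tiles (h x)" using t by (simp add: tiles_h)
  from conv_tile[OF v this]
  have "\<forall>\<^sub>F i in sequentially. linked K (psi x) t (psi (X i)) (translate_tile (v i) t)"
  proof eventually_elim
    case (elim i)
    then obtain s where s: "s \<in> tiles (p (X i))" "translate_tile (v i) (label_tile x t) = label_tile (X i) s"
      unfolding tiles_h by blast
    have "unlabel (translate_tile (v i) (label_tile x t)) = unlabel (label_tile (X i) s)" using s(2) by simp
    then have st: "s = translate_tile (v i) t" by (simp add: unlabel_translate_tile)
    show ?case using label_tile_eq_iff[OF x t s(1)[unfolded st]] s(2) st by simp
  qed
  then have "(\<lambda>i. psi (X i)) \<longlonglongrightarrow> psi x"
    using x pv t by (intro tendsto_of_linked[of "psi x" "\<lambda>i. psi (X i)" K v t]) simp_all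
  then have "(\<lambda>i. (F' ^^ J) (psi (X i))) \<longlonglongrightarrow> (F' ^^ J) (psi x)"
    using x by (intro F'_pow_tendsto) simp_all
  then show ?thesis using x by (simp add: psi_def F'_pow)
qed

text \<open>Injectivity is the case of a constant sequence in \<open>tendsto_of_h\<close>, by
  uniqueness of limits in \<open>C\<close>.\<close>

lemma h_inj: "inj_on h C"
proof (rule inj_onI)
  fix x y assume xy: "x \<in> C" "y \<in> C" "h x = h y"
  have "(\<lambda>i::nat. h y) \<longlonglongrightarrow> h x" using xy(3) by simp
  then have "(\<lambda>i::nat. y) \<longlonglongrightarrow> x" by (rule tendsto_of_h) (use xy in simp_all)
  then show "x = y" using LIMSEQ_unique_C[OF xy(1,2), of "\<lambda>i. y"] xy(2) by simp
qed

abbreviation \<Omega>' where "\<Omega>' \<equiv> h ` C"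

definition hi where "hi = inv_into C h"

lemma hi_h [simp]: "x \<in> C \<Longrightarrow> hi (h x) = x"
  by (simp add: hi_def inv_into_f_f[OF h_inj])

lemma homeomorphism_h: "homeomorphism C \<Omega>' h hi"
  unfolding homeomorphism_def
proof (intro conjI)
  show "continuous_on C h"
    by (rule seq_nhds_continuous_on[OF seq_nhds_C]) (rule tendsto_h)
  show "continuous_on \<Omega>' hi"
  proof (rule seq_nhds_continuous_on[OF seq_nhds_tilings])
    fix S X assume S: "S \<in> \<Omega>'" and X: "\<And>i. X i \<in> \<Omega>'" "X \<longlonglongrightarrow> S"
    obtain x where x: "x \<in> C" "S = h x" using S by blast
    have "\<exists>y. y \<in> C \<and> X i = h y" for i using X(1)[of i] by auto
    then obtain Y where Y: "\<And>i. Y i \<in> C" "\<And>i. X i = h (Y i)" by metis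
    have "X = (\<lambda>i. h (Y i))" using Y(2) by (rule ext)
    then have "(\<lambda>i. h (Y i)) \<longlonglongrightarrow> h x" using X(2) x(2) by simp
    then have "Y \<longlonglongrightarrow> x" using x(1) Y(1) by (rule tendsto_of_h)
    then show "(\<lambda>i. hi (X i)) \<longlonglongrightarrow> hi S" using Y x by simp
  qed
qed (auto simp: image_image)

lemma homeomorphism_F: "homeomorphism C C F F'"
  unfolding homeomorphism_def
proof (intro conjI)
  show "continuous_on C F"
    by (rule seq_nhds_continuous_on[OF seq_nhds_C]) (rule F_tendsto)
  show "continuous_on C F'"
    by (rule seq_nhds_continuous_on[OF seq_nhds_C]) (rule F'_tendsto)
  have "x \<in> F ` C" "x \<in> F' ` C" if "x \<in> C" for x
    using image_eqI[of x F "F' x" C] image_eqI[of x F' "F x" C] that by simp_all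
  then show "F ` C = C" "F' ` C = C" by auto
qed auto

definition sigma' where "sigma' = h \<circ> F \<circ> hi"

lemma sigma'_h: "x \<in> C \<Longrightarrow> sigma' (h x) = h (F x)"
  by (simp add: sigma'_def)

lemma homeomorphism_sigma': "\<exists>s. homeomorphism \<Omega>' \<Omega>' sigma' s"
  using homeomorphism_compose[OF homeomorphism_symD[OF homeomorphism_h]
      homeomorphism_compose[OF homeomorphism_F homeomorphism_h]]
  unfolding sigma'_def o_assoc by blast

section \<open>The labelled tilings form a tiling space\<close>

lemma h_subseq:
  assumes "\<And>i. X i \<in> C"
  obtains y v and r :: "nat \<Rightarrow> nat" where "y \<in> C" "strict_mono r" "conv (\<lambda>i. h (X (r i))) (h y) v"
proof -
  obtain y r where r: "y \<in> C" "strict_mono (r :: nat \<Rightarrow> nat)" "(X \<circ> r) \<longlonglongrightarrow> y"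
    using seq_compactD[OF seq_compact_C assms] .
  have "(\<lambda>i. h ((X \<circ> r) i)) \<longlonglongrightarrow> h y" using assms by (intro tendsto_h[OF r(3,1)]) simp
  then obtain v where "conv (\<lambda>i. h (X (r i))) (h y) v" using tendsto_imp_conv by fastforce
  with r(1,2) that show thesis by blast
qed

text \<open>Recentred at the patches, the labelled tilings have a convergent subsequence, so
  infinitely many classes would be represented by subsets of one finite central patch of the
  limit.\<close>

lemma finite_patch_classes:
  assumes x: "x \<in> C"
  shows "finite ((\<lambda>P. range (\<lambda>v. translate v P)) ` {P. P \<subseteq> tiles (h x) \<and> (\<exists>w. \<forall>t\<in>P. fst t \<inter> ball w r \<noteq> {})})"
    (is "finite (?c ` ?A)")
proof (rule ccontr)
  assume "infinite (?c ` ?A)"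
  from infinite_countable_subset[OF this]
  obtain f :: "nat \<Rightarrow> _" where f: "inj f" "range f \<subseteq> ?c ` ?A" by (elim exE conjE)
  have "\<exists>P w. f i = ?c P \<and> P \<subseteq> tiles (h x) \<and> (\<forall>t\<in>P. fst t \<inter> ball w r \<noteq> {})" for i
  proof -
    have "f i \<in> ?c ` ?A" using f(2) by (rule subsetD) (rule rangeI)
    then obtain P where P: "f i = ?c P" "P \<in> ?A" by (rule imageE)
    then show ?thesis by blast
  qed
  then obtain P w where P: "\<And>i. f i = ?c (P i)" "\<And>i. P i \<subseteq> tiles (h x)"
    "\<And>i t. t \<in> P i \<Longrightarrow> fst t \<inter> ball (w i) r \<noteq> {}"
    by metis
  have "flow (- w i) x \<in> C" for i using x by simp
  from h_subseq[OF this] obtain y v and q :: "nat \<Rightarrow> nat" where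
    q: "y \<in> C" "strict_mono q" "conv (\<lambda>i. h (flow (- w (q i)) x)) (h y) v" .
  have shift: "translate (- w i) (P i) \<subseteq> cp r (h (flow (- w i) x))" for i
  proof
    fix u assume "u \<in> translate (- w i) (P i)"
    then have t: "translate_tile (w i) u \<in> P i" by (simp add: mem_translate)
    then obtain z where z: "z \<in> fst u" "w i + z \<in> ball (w i) r" using P(3) by fastforce
    have "u \<in> tiles (h (flow (- w i) x))"
      using subsetD[OF P(2) t] x by (simp add: h_flow mem_tiles_tr)
    then show "u \<in> cp r (h (flow (- w i) x))"
      using z(1) by (rule mem_cp) (use z(2) in \<open>simp add: dist_norm\<close>)
  qed
  have "\<forall>\<^sub>F i in sequentially. f (q i) \<in> ?c ` Pow (cp (r + 1) (h y))"
    using conv_back[OF q(3), of r]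
  proof eventually_elim
    case (elim i)
    have "translate (- v i) (translate (- w (q i)) (P (q i))) \<subseteq> cp (r + 1) (h y)"
    proof
      fix u assume "u \<in> translate (- v i) (translate (- w (q i)) (P (q i)))"
      then have "translate_tile (v i) u \<in> translate (- w (q i)) (P (q i))" by (simp only: mem_translate minus_minus)
      then have "translate_tile (v i) u \<in> cp r (h (flow (- w (q i)) x))" using shift by blast
      from bspec[OF elim this] show "u \<in> cp (r + 1) (h y)" by simp
    qed
    moreover have "f (q i) = ?c (translate (- v i) (translate (- w (q i)) (P (q i))))"
      unfolding P(1) range_translate ..
    ultimately show ?case by (intro image_eqI[of _ _ "translate (- v i) (translate (- w (q i)) (P (q i)))"] PowI)
  qed
  then obtain N where N: "\<And>i. i \<ge> N \<Longrightarrow> f (q i) \<in> ?c ` Pow (cp (r + 1) (h y))"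
    unfolding eventually_sequentially by blast
  have "inj (\<lambda>i. f (q (i + N)))"
  proof (rule injI)
    fix i j assume "f (q (i + N)) = f (q (j + N))"
    then have "q (i + N) = q (j + N)" using f(1) by (simp add: inj_eq)
    then show "i = j" using strict_mono_eq[OF q(2)] by simp
  qed
  moreover have "range (\<lambda>i. f (q (i + N))) \<subseteq> ?c ` Pow (cp (r + 1) (h y))"
    by (rule image_subsetI) (rule N, simp)
  then have "finite (range (\<lambda>i. f (q (i + N))))"
    by (rule finite_subset) (use finite_cp_h[OF q(1)] in simp)
  ultimately have "finite (UNIV :: nat set)" by (rule finite_imageD[rotated])
  then show False by simp
qed

text \<open>Both conditions reduce to \<open>finite_patch_classes\<close>: the class of a tile is
  the union of the class of its singleton patch, and all tiles of a patch of diameter at most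
  \<open>r\<close> meet the ball of radius \<open>r + 1\<close> around any point of its
  support.\<close>

lemma flc_h:
  assumes x: "x \<in> C"
  shows "finite_local_complexity (h x)"
  unfolding finite_local_complexity_def
proof (intro conjI allI)
  let ?c = "\<lambda>P. range (\<lambda>v. translate v P)"
  have "(\<lambda>t. range (\<lambda>v. translate_tile v t)) ` tiles (h x) \<subseteq>
      Union ` ?c ` {P. P \<subseteq> tiles (h x) \<and> (\<exists>w. \<forall>t\<in>P. fst t \<inter> ball w 1 \<noteq> {})}"
  proof (rule image_subsetI)
    fix t assume t: "t \<in> tiles (h x)"
    obtain w where w: "w \<in> fst t" using ball_tile_nonempty[OF tiles_ball_tile[OF t]] by blast
    have "range (\<lambda>v. translate_tile v t) = \<Union>(?c {t})" by (auto simp: translate_def)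
    moreover have "\<forall>s\<in>{t}. fst s \<inter> ball w 1 \<noteq> {}" using w by force
    then have "{t} \<in> {P. P \<subseteq> tiles (h x) \<and> (\<exists>w. \<forall>t\<in>P. fst t \<inter> ball w 1 \<noteq> {})}" using t by blast
    ultimately show "range (\<lambda>v. translate_tile v t) \<in>
        Union ` ?c ` {P. P \<subseteq> tiles (h x) \<and> (\<exists>w. \<forall>t\<in>P. fst t \<inter> ball w 1 \<noteq> {})}"
      by (intro image_eqI[of _ Union "?c {t}"] imageI)
  qed
  then show "finite ((\<lambda>t. range (\<lambda>v. translate_tile v t)) ` tiles (h x))"
    by (rule finite_subset) (intro finite_imageI finite_patch_classes[OF x])
  fix r
  have "{P. P \<subseteq> tiles (h x) \<and> finite P \<and> diameter (support P) \<le> r} \<subseteq>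
      {P. P \<subseteq> tiles (h x) \<and> (\<exists>w. \<forall>t\<in>P. fst t \<inter> ball w (r + 1) \<noteq> {})}"
  proof
    fix P assume "P \<in> {P. P \<subseteq> tiles (h x) \<and> finite P \<and> diameter (support P) \<le> r}"
    then have P: "P \<subseteq> tiles (h x)" "finite P" "diameter (support P) \<le> r" by simp_all
    have "compact (support P)" unfolding support_def
      using P(1,2) by (intro compact_UN) (auto intro!: ball_tile_compact tiles_ball_tile)
    then have bd: "bounded (support P)" by (rule compact_imp_bounded)
    have ne: "\<exists>y. y \<in> fst t" if "t \<in> P" for t
      using ball_tile_nonempty[OF tiles_ball_tile, of t "h x"] that P(1) by blast
    have "\<exists>w. \<forall>t\<in>P. fst t \<inter> ball w (r + 1) \<noteq> {}"
    proof (cases "P = {}")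
      case False
      then obtain w where w: "w \<in> support P" using ne unfolding support_def by blast
      have "fst t \<inter> ball w (r + 1) \<noteq> {}" if t: "t \<in> P" for t
      proof -
        obtain y where y: "y \<in> fst t" using ne[OF t] by blast
        then have "y \<in> support P" using t unfolding support_def by blast
        then have "dist w y \<le> diameter (support P)" by (rule diameter_bounded_bound[OF bd w])
        then have "y \<in> ball w (r + 1)" using P(3) by simp
        with y show ?thesis by blast
      qed
      then show ?thesis by blast
    qed simp
    with P(1) show "P \<in> {P. P \<subseteq> tiles (h x) \<and> (\<exists>w. \<forall>t\<in>P. fst t \<inter> ball w (r + 1) \<noteq> {})}" by simp
  qed
  then show "finite (?c ` {P. P \<subseteq> tiles (h x) \<and> finite P \<and> diameter (support P) \<le> r})"
    by (intro finite_subset[OF image_mono finite_patch_classes[OF x]])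
qed

text \<open>Density of the orbit of \<open>y\<close> in the cover is what controls the labels;
  minimality of \<Omega> alone would recover the patch only up to its labels.\<close>

lemma patch_in_orbit:
  assumes "x \<in> C" "y \<in> C" "P \<subseteq> tiles (h x)" "finite P"
  shows "\<exists>v. translate v P \<subseteq> tiles (h y)"
proof -
  obtain u where u: "(\<lambda>i. flow (u i) y) \<longlonglongrightarrow> x" using orbit_dense[OF assms(2,1)] .
  have "(\<lambda>i. h (flow (u i) y)) \<longlonglongrightarrow> h x" using assms(2) by (intro tendsto_h[OF u assms(1)]) simp
  then obtain v where "conv (\<lambda>i. h (flow (u i) y)) (h x) v" using tendsto_imp_conv by blast
  from conv_patch[OF this assms(3,4)] obtain i where "translate (v i) P \<subseteq> tiles (h (flow (u i) y))"
    unfolding eventually_sequentially by blast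
  then have "translate (- u i) (translate (v i) P) \<subseteq> tiles (h y)"
    using assms(2) by (simp add: h_flow tiles_tr translate_subset_iff del: translate_add)
  then show ?thesis by auto
qed

text \<open>If the gaps between copies of \<open>P\<close> were unbounded, recentring in ever larger
  gaps would have a limit \<open>h y\<close>. It contains a copy of \<open>P\<close>, hence so do
  the recentred tilings at bounded distance from the origin.\<close>

lemma repetitive_h:
  assumes x: "x \<in> C"
  shows "repetitive (h x)"
  unfolding repetitive_def
proof (intro allI impI, rule ccontr)
  fix P assume "P \<subseteq> tiles (h x) \<and> finite P"
  then have P: "P \<subseteq> tiles (h x)" "finite P" by simp_all
  assume neg: "\<not> (\<exists>r>0. \<forall>z. \<exists>v. translate v P \<subseteq> tiles (h x) \<and> support (translate v P) \<subseteq> ball z r)"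
  have "\<exists>z. \<forall>v. translate v P \<subseteq> tiles (h x) \<longrightarrow> \<not> support (translate v P) \<subseteq> ball z (real (Suc i))" for i
  proof (rule ccontr)
    assume c: "\<not> ?thesis"
    have "real (Suc i) > 0" by simp
    with c neg show False by blast
  qed
  then obtain w where w: "\<And>i v. translate v P \<subseteq> tiles (h x) \<Longrightarrow> \<not> support (translate v P) \<subseteq> ball (w i) (real (Suc i))"
    by metis
  have "flow (- w i) x \<in> C" for i using x by simp
  from h_subseq[OF this] obtain y v and q :: "nat \<Rightarrow> nat" where
    q: "y \<in> C" "strict_mono q" "conv (\<lambda>i. h (flow (- w (q i)) x)) (h y) v" .
  obtain a where a: "translate a P \<subseteq> tiles (h y)" using patch_in_orbit[OF x q(1) P] by blast
  have "compact (support (translate a P))" unfolding support_def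
    using P(2) a by (intro compact_UN) (auto intro!: ball_tile_compact tiles_ball_tile)
  then obtain B where B: "support (translate a P) \<subseteq> ball 0 B"
    using bounded_subset_ballD[OF compact_imp_bounded] by blast
  \<comment> \<open>The copy of \<open>P\<close> in the limit has radius \<open>B\<close> and is
    displaced by less than 1, so gaps of radius at least \<open>B + 1\<close> leave no room to avoid
    it.\<close>
  obtain m :: nat where m: "B + 1 \<le> real m" using real_arch_simple by blast
  have "finite (translate a P)" using P(2) by simp
  from conv_patch[OF q(3) a this] conv_small[OF q(3) zero_less_one] eventually_ge_at_top[of m]
  have "\<forall>\<^sub>F i in sequentially. False"
  proof eventually_elim
    case (elim i)
    define b where "b = w (q i) + (v i + a)"
    have "translate (w (q i)) (translate (v i) (translate a P)) \<subseteq> tiles (h x)"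
      using elim(1) x by (simp add: h_flow tiles_tr translate_subset_iff del: translate_add)
    then have 1: "translate b P \<subseteq> tiles (h x)" by (simp add: b_def)
    have "translate b P = translate (w (q i) + v i) (translate a P)" by (simp add: b_def add.assoc)
    then have "support (translate b P) = (+) (w (q i) + v i) ` support (translate a P)"
      by (simp only: support_translate[of _ "translate a P"])
    also have "\<dots> \<subseteq> (+) (w (q i) + v i) ` ball 0 B" using B by (rule image_mono)
    also have "\<dots> = ball (w (q i) + v i) B" by (simp add: plus_image_ball)
    also have "\<dots> \<subseteq> ball (w (q i)) (real (Suc (q i)))"
    proof
      fix z assume z: "z \<in> ball (w (q i) + v i) B"
      have "dist (w (q i)) z \<le> dist (w (q i)) (w (q i) + v i) + dist (w (q i) + v i) z" by (rule dist_triangle)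
      also have "\<dots> < 1 + B" using z elim(2) by (intro add_strict_mono) (simp_all add: dist_norm)
      also have "\<dots> \<le> real (q i)" using m elim(3) seq_suble[OF q(2), of i] by linarith
      finally show "z \<in> ball (w (q i)) (real (Suc (q i)))" by simp
    qed
    finally show False using w[OF 1] by blast
  qed
  then show False by simp
qed

text \<open>A tiling in the hull is a limit of translates of \<open>h x\<close>; compactness of
  \<open>C\<close> and uniqueness of limits place it in the image of \<open>h\<close>. The other
  inclusion is \<open>patch_in_orbit\<close>.\<close>

lemma hull_h:
  assumes x: "x \<in> C"
  shows "\<Omega>' = tiling_hull (h x)"
proof
  interpret H: flc_hull "h x" "tiling_hull (h x)"
    by unfold_locales (use flc_h[OF x] in simp_all)
  show "\<Omega>' \<subseteq> tiling_hull (h x)"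
  proof
    fix S assume "S \<in> \<Omega>'"
    then obtain y where y: "y \<in> C" "S = h y" by blast
    show "S \<in> tiling_hull (h x)"
      unfolding tiling_hull_def mem_Collect_eq y(2) using patch_in_orbit[OF y(1) x] by blast
  qed
  show "tiling_hull (h x) \<subseteq> \<Omega>'"
  proof
    fix S assume S: "S \<in> tiling_hull (h x)"
    have "\<exists>v. cp (real m) S = cp (real m) (h (flow v x))" for m
    proof -
      have fin: "finite (cp (real m) S)" using S by simp
      obtain v where "translate v (cp (real m) S) \<subseteq> tiles (h x)" using H.OmegaD[OF S cp_subset fin] .
      then have "cp (real m) S \<subseteq> tiles (h (flow (- v) x))"
        using x by (simp add: h_flow tiles_tr translate_subset_iff)
      from cp_eqI[OF this fin] show ?thesis by blast
    qed
    then obtain v where v: "\<And>m. cp (real m) S = cp (real m) (h (flow (v m) x))" by metis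
    have "flow (v m) x \<in> C" for m using x by simp
    from h_subseq[OF this] obtain y u and q :: "nat \<Rightarrow> nat" where
      q: "y \<in> C" "strict_mono q" "conv (\<lambda>i. h (flow (v (q i)) x)) (h y) u" .
    have "conv (\<lambda>i. h (flow (v (q i)) x)) S (\<lambda>_. 0)"
      unfolding conv_def
    proof (intro conjI allI)
      fix r :: real
      obtain m :: nat where m: "r \<le> real m" using real_arch_simple by blast
      have "cp r (h (flow (v (q i)) x)) = cp r (tr 0 S)" if "i \<ge> m" for i
      proof -
        have "r \<le> real (q i)" using m that seq_suble[OF q(2), of i] by linarith
        from cp_mono[OF v this] show ?thesis by simp
      qed
      then show "\<forall>\<^sub>F i in sequentially. cp r (h (flow (v (q i)) x)) = cp r (tr 0 S)"
        unfolding eventually_sequentially by blast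
    qed simp
    from tiling_LIMSEQ_unique[OF conv_imp_tendsto[OF this] conv_imp_tendsto[OF q(3)]]
    show "S \<in> \<Omega>'" using q(1) by blast
  qed
qed

lemma tiling_space_h: "tiling_space \<Omega>'"
proof -
  obtain x where x: "x \<in> C" using C_nonempty by blast
  show ?thesis
    unfolding tiling_space_def using flc_h[OF x] repetitive_h[OF x] hull_h[OF x] by blast
qed

section \<open>The substitution rule on labelled tiles\<close>

text \<open>Any point whose labelled tiling contains \<open>u\<close> may be used;
  \<open>label_tile_sup_tile\<close> shows that the choice does not matter.\<close>

definition omega' where
  "omega' u = label_tile (F (SOME x. x \<in> C \<and> u \<in> tiles (h x))) ` sup_tile n (unlabel u)"

text \<open>Equal labels mean that \<open>psi x\<close> and \<open>psi y\<close> are near along the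
  order-\<open>K\<close> supertile of \<open>t\<close>. The collar of \<open>t\<close> forces
  agreement there on radius \<open>R3\<close>, so \<open>F\<close> preserves this nearness. The
  resulting region is the image of \<open>t\<close> under \<open>L ^^ (n + K)\<close>, and it
  contains the order-\<open>K\<close> supertile of every tile \<open>s\<close> in the
  order-\<open>n\<close> supertile of \<open>t\<close>.\<close>

lemma label_tile_sup_tile:
  assumes x: "x \<in> C" "y \<in> C" and t: "t \<in> tiles (p x)" "t \<in> tiles (p y)" "label_tile x t = label_tile y t"
    and s: "s \<in> sup_tile n t"
  shows "label_tile (F x) s = label_tile (F y) s"
proof -
  have bt: "ball_tile t" by (rule tiles_ball_tile[OF t(1)])
  have "linked K (psi x) t (psi y) t"
    using label_tile_eq_iff[OF x t(1), of 0] t(2,3) by simp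
  then obtain v where v: "t = translate_tile v t"
    "collar (tiles (base K (psi y))) t = translate v (collar (tiles (base K (psi x))) t)"
    "\<forall>w\<in>(L ^^ K) ` fst t. near (flow (- w) (flow ((L ^^ K) v) (psi x))) (flow (- w) (psi y))"
    unfolding linked_def by blast
  have "translate_tile v t = translate_tile 0 t" using v(1) by simp
  then have v0: "v = 0" by (simp only: translate_tile_eq_iff[OF bt])
  have col: "collar (tiles (p x)) t = collar (tiles (p y)) t" using v(2) v0 x by simp
  have nearF: "near (flow (- (L ^^ n) w) (psi (F x))) (flow (- (L ^^ n) w) (psi (F y)))"
    if w: "w \<in> (L ^^ K) ` fst t" for w
  proof -
    have 1: "near (flow (- w) (psi x)) (flow (- w) (psi y))"
      using v(3)[rule_format, OF w] v0 by (simp add: Lk_0 flow_0)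
    have "cp R3 (tr (- w) ((\<sigma> ^^ K) (p x))) = cp R3 (tr (- w) ((\<sigma> ^^ K) (p y)))"
      by (rule cp_sigma_pow_collar[OF _ _ t(1,2) col w K(2)]) (use x in simp_all)
    then have "cp R3 (p (flow (- w) (psi x))) = cp R3 (p (flow (- w) (psi y)))"
      using x by (simp add: psi_def p_F_pow K_def)
    from F_near[OF 1 this] show ?thesis using x by (simp add: F_flow psi_F Lk_minus)
  qed
  have su: "s \<in> tiles (p (F x))" "s \<in> tiles (p (F y))"
    using s sup_tile_subset[OF p_mem[OF x(1)] t(1), of n] sup_tile_subset[OF p_mem[OF x(2)] t(2), of n] x
    by (auto simp: p_F)
  have "linked K (psi (F x)) s (psi (F y)) (translate_tile 0 s)"
    unfolding linked_def
  proof (intro exI[of _ 0] conjI ballI)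
    show "collar (tiles (base K (psi (F y)))) (translate_tile 0 s) = translate 0 (collar (tiles (base K (psi (F x)))) s)"
      using collar_sigma_pow[OF p_mem[OF x(1)] p_mem[OF x(2)] t(1,2) col s] x by (simp add: p_F)
    fix w assume "w \<in> (L ^^ K) ` fst (translate_tile 0 s)"
    then obtain a where a: "a \<in> fst s" "w = (L ^^ K) a" by auto
    have "fst s \<subseteq> (L ^^ n) ` fst t" by (rule sup_tile_sub[OF p_mem[OF x(1)] t(1) s])
    then obtain b where b: "b \<in> fst t" "a = (L ^^ n) b" using a(1) by blast
    have "w = (L ^^ n) ((L ^^ K) b)" unfolding a(2) b(2) by (metis add.commute funpow_add o_apply)
    then show "near (flow (- w) (flow ((L ^^ K) 0) (psi (F x)))) (flow (- w) (psi (F y)))"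
      using nearF[of "(L ^^ K) b"] b(1) by (simp add: Lk_0 flow_0)
  qed simp
  then show ?thesis using label_tile_eq_iff[of "F x" "F y" s 0] x su by simp
qed

lemma omega'_label_tile:
  assumes x: "x \<in> C" and t: "t \<in> tiles (p x)"
  shows "omega' (label_tile x t) = label_tile (F x) ` sup_tile n t"
proof -
  define y where "y = (SOME y. y \<in> C \<and> label_tile x t \<in> tiles (h y))"
  have "\<exists>y. y \<in> C \<and> label_tile x t \<in> tiles (h y)" using x t by (intro exI[of _ x]) (simp add: tiles_h)
  from someI_ex[OF this, folded y_def] have y: "y \<in> C" "label_tile x t \<in> tiles (h y)" by simp_all
  then obtain s where s: "s \<in> tiles (p y)" "label_tile x t = label_tile y s" unfolding tiles_h by blast
  have "unlabel (label_tile x t) = unlabel (label_tile y s)" using s(2) by simp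
  then have "s = t" by simp
  have "omega' (label_tile x t) = label_tile (F y) ` sup_tile n t" unfolding omega'_def y_def by simp
  also have "\<dots> = label_tile (F x) ` sup_tile n t"
    using label_tile_sup_tile[OF x y(1) t] s \<open>s = t\<close> by (intro image_cong) simp_all
  finally show ?thesis .
qed

lemma tiles_of_space_h: "u \<in> tiles_of_space \<Omega>' \<longleftrightarrow> (\<exists>x\<in>C. \<exists>t\<in>tiles (p x). u = label_tile x t)"
  unfolding tiles_of_space_def by (auto simp: tiles_h)

lemma sup_tile_F: "x \<in> C \<Longrightarrow> t \<in> tiles (p x) \<Longrightarrow> sup_tile (n * k) t \<subseteq> tiles (p ((F ^^ k) x))"
  using sup_tile_subset[of "p x" t "n * k"] by (simp add: p_F_pow)

lemma rule_omega': "inflate_and_subdivide_rule (L ^^ n) (tiles_of_space \<Omega>') omega'"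
  unfolding inflate_and_subdivide_rule_def
proof (intro conjI ballI allI)
  have "lam ^ n > 1" using lam(1) n by (intro one_less_power) simp_all
  then show "inflation (L ^^ n)" unfolding inflation_def using linear_Lk norm_Lk by blast
  fix u assume "u \<in> tiles_of_space \<Omega>'"
  then obtain x t where x: "x \<in> C" and t: "t \<in> tiles (p x)" and u: "u = label_tile x t"
    unfolding tiles_of_space_h by blast
  have sub: "omega' u \<subseteq> tiles (h (F x))"
    unfolding u omega'_label_tile[OF x t] tiles_h using sup_tile_F[OF x t, of 1] by (auto simp: image_iff)
  show "is_patch (omega' u)"
    unfolding is_patch_def
  proof (intro conjI ballI)
    show "finite (omega' u)" unfolding u omega'_label_tile[OF x t] using x t by (intro finite_imageI finite_sup_tile) simp_all
    show "ball_tile s" if "s \<in> omega' u" for s using that sub tiles_ball_tile by blast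
    show "disjoint_interiors (omega' u)"
      using is_tiling_tiles[of "h (F x)"] sub unfolding is_tiling_def disjoint_interiors_def
      by (meson pairwise_subset)
  qed
  have "support (omega' u) = support (sup_tile n t)" unfolding u omega'_label_tile[OF x t] by (simp add: support_def)
  then show "support (omega' u) = (L ^^ n) ` fst u"
    using support_sup_tile[OF p_mem[OF x] t, of n] by (simp add: u)
  fix v
  have t': "translate_tile v t \<in> tiles (p (flow v x))" using x t by simp
  have "omega' (translate_tile v u) = omega' (label_tile (flow v x) (translate_tile v t))"
    unfolding u label_tile_flow[OF x t] ..
  also have "\<dots> = label_tile (F (flow v x)) ` sup_tile n (translate_tile v t)"
    using x by (intro omega'_label_tile t') simp
  also have "\<dots> = label_tile (flow ((L ^^ n) v) (F x)) ` translate_tile ((L ^^ n) v) ` sup_tile n t"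
    using x sup_tile_translate[OF p_mem[OF x] t, of n v] by (simp add: F_flow translate_def)
  also have "\<dots> = translate ((L ^^ n) v) (label_tile (F x) ` sup_tile n t)"
  proof -
    have "label_tile (flow ((L ^^ n) v) (F x)) (translate_tile ((L ^^ n) v) s) = translate_tile ((L ^^ n) v) (label_tile (F x) s)"
      if "s \<in> sup_tile n t" for s
      using that sup_tile_F[OF x t, of 1] x by (intro label_tile_flow) auto
    then show ?thesis by (simp add: translate_def image_image)
  qed
  finally show "omega' (translate_tile v u) = translate ((L ^^ n) v) (omega' u)"
    by (simp add: u omega'_label_tile[OF x t])
qed

lemma subdivide_pow_label_tile:
  assumes x: "x \<in> C" and t: "t \<in> tiles (p x)"
  shows "(subdivide omega' ^^ k) {label_tile x t} = label_tile ((F ^^ k) x) ` sup_tile (n * k) t"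
proof (induction k)
  case 0
  then show ?case by (simp add: sup_tile_0)
next
  case (Suc k)
  have "(subdivide omega' ^^ Suc k) {label_tile x t} = subdivide omega' (label_tile ((F ^^ k) x) ` sup_tile (n * k) t)"
    using Suc by simp
  also have "\<dots> = (\<Union>s\<in>sup_tile (n * k) t. omega' (label_tile ((F ^^ k) x) s))"
    by (simp add: subdivide_def)
  also have "\<dots> = (\<Union>s\<in>sup_tile (n * k) t. label_tile (F ((F ^^ k) x)) ` sup_tile n s)"
    using sup_tile_F[OF x t, of k] x by (intro SUP_cong refl omega'_label_tile) auto
  also have "\<dots> = label_tile ((F ^^ Suc k) x) ` (\<Union>s\<in>sup_tile (n * k) t. sup_tile n s)"
    by (simp add: image_UN)
  also have "(\<Union>s\<in>sup_tile (n * k) t. sup_tile n s) = sup_tile (n * Suc k) t"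
    by (simp add: subdivide_pow_UN[symmetric] sup_tile_def[of "n * k"] sup_tile_def[of "n * Suc k"]
        sup_tile_def[of "n + n * k"] funpow_add)
  finally show ?case .
qed

lemma tiles_sigma':
  assumes x: "x \<in> C"
  shows "tiles (sigma' (h x)) = subdivide omega' (tiles (h x))"
proof -
  have "tiles (sigma' (h x)) = label_tile (F x) ` (\<Union>t\<in>tiles (p x). sup_tile n t)"
    using x by (simp add: sigma'_h tiles_h p_F tiles_sigma_pow_UN)
  also have "\<dots> = (\<Union>t\<in>tiles (p x). omega' (label_tile x t))"
    using omega'_label_tile[OF x] by (simp add: image_UN)
  also have "\<dots> = subdivide omega' (tiles (h x))" by (simp add: subdivide_def tiles_h)
  finally show ?thesis .
qed

lemma F'_pow_mem [simp]: "x \<in> C \<Longrightarrow> (F' ^^ k) x \<in> C"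
  by (induction k) simp_all

lemma F_F'_pow: "x \<in> C \<Longrightarrow> (F ^^ k) ((F' ^^ k) x) = x"
proof (induction k arbitrary: x)
  case (Suc k)
  have "(F ^^ Suc k) ((F' ^^ Suc k) x) = (F ^^ k) (F (F' ((F' ^^ k) x)))" by (simp add: funpow_swap1)
  then show ?case using Suc by simp
qed simp

text \<open>A tile of inradius \<open>\<rho>\<close>, inflated often enough, contains a ball of
  radius \<open>r\<close> and thus a copy of \<open>P\<close>; the tiles of that copy then belong to
  its supertile.\<close>

lemma patch_in_supertile:
  assumes x: "x \<in> C" and P: "P \<subseteq> tiles (h x)" "finite P"
  shows "\<exists>u\<in>tiles_of_space \<Omega>'. \<exists>k v. translate v P \<subseteq> (subdivide omega' ^^ k) {u}"
proof -
  obtain r where r: "r > 0" "\<forall>z. \<exists>v. translate v P \<subseteq> tiles (h x) \<and> support (translate v P) \<subseteq> ball z r"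
    using repetitive_h[OF x] P unfolding repetitive_def by blast
  obtain \<rho> where \<rho>: "\<rho> > 0" "\<forall>T\<in>\<Omega>. \<forall>t\<in>tiles T. \<exists>a. ball a \<rho> \<subseteq> fst t" using tile_inradius by blast
  obtain k where k: "r / \<rho> < lam ^ k" using real_arch_pow[OF lam(1)] by blast
  have "lam ^ k \<le> lam ^ (n * k)" using n lam(1) by (intro power_increasing) simp_all
  then have "r / \<rho> < lam ^ (n * k)" using k by linarith
  then have rk: "r < lam ^ (n * k) * \<rho>" using \<rho>(1) by (simp add: field_simps)
  \<comment> \<open>Writing \<open>x\<close> as the image of \<open>y\<close> under
    \<open>F ^^ k\<close> cuts its tiling into supertiles of order \<open>n * k\<close> of tiles of
    \<open>p y\<close>.\<close>
  define y where "y = (F' ^^ k) x"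
  have y: "y \<in> C" "(F ^^ k) y = x" using x by (simp_all add: y_def F_F'_pow)
  obtain t where t: "t \<in> tiles (p y)" using tiles_cover by blast
  obtain a where a: "ball a \<rho> \<subseteq> fst t" using \<rho>(2) y(1) t by (meson p_mem)
  let ?z = "(L ^^ (n * k)) a"
  obtain v where v: "translate v P \<subseteq> tiles (h x)" "support (translate v P) \<subseteq> ball ?z r" using r(2) by blast
  have ball: "ball ?z r \<subseteq> (L ^^ (n * k)) ` fst t"
  proof
    fix b assume b: "b \<in> ball ?z r"
    obtain b' where b': "b = (L ^^ (n * k)) b'" using bij_Lk[of "n * k"] by (metis bij_pointE)
    have "lam ^ (n * k) * norm (a - b') \<le> norm ((L ^^ (n * k)) (a - b'))" by (rule norm_Lk)
    also have "\<dots> < r" using b by (simp add: b' Lk_diff dist_norm)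
    finally have "lam ^ (n * k) * norm (a - b') < lam ^ (n * k) * \<rho>" using rk by linarith
    then have "norm (a - b') < \<rho>" using lam_pow_ge_1[of "n * k"] by (simp add: mult_less_cancel_left_pos)
    then show "b \<in> (L ^^ (n * k)) ` fst t" unfolding b' using a by (intro imageI) (auto simp: dist_norm)
  qed
  have "translate v P \<subseteq> (subdivide omega' ^^ k) {label_tile y t}"
  proof
    fix u assume u: "u \<in> translate v P"
    then obtain s where s: "s \<in> tiles (p x)" "u = label_tile x s" using v(1) unfolding tiles_h by blast
    have "fst u \<subseteq> ball ?z r" using u v(2) unfolding support_def by blast
    then have su: "fst s \<subseteq> (L ^^ (n * k)) ` fst t" using ball s(2) by auto
    have "p x = (\<sigma> ^^ (n * k)) (p y)" using p_F_pow[OF y(1), of k] y(2) by simp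
    then obtain t' where t': "t' \<in> tiles (p y)" "s \<in> sup_tile (n * k) t'"
      using s(1) tiles_sigma_pow_UN[OF p_mem[OF y(1)], of "n * k"] by auto
    have "t' = t" by (rule sup_tile_unique[OF p_mem[OF y(1)] t'(1) t t'(2) su])
    then show "u \<in> (subdivide omega' ^^ k) {label_tile y t}"
      unfolding subdivide_pow_label_tile[OF y(1) t] y(2) s(2) using t'(2) by blast
  qed
  moreover have "label_tile y t \<in> tiles_of_space \<Omega>'" unfolding tiles_of_space_h using y(1) t by blast
  ultimately show ?thesis by blast
qed

text \<open>For the inclusion not covered by \<open>patch_in_supertile\<close>: an iterated
  supertile is a patch of some \<open>h ((F ^^ k) x)\<close>, and the patches of all labelled
  tilings occur in one fixed \<open>h x0\<close>, whose hull is the whole space.\<close>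

lemma generated_omega': "generated_by omega' \<Omega>'"
proof -
  obtain x0 where x0: "x0 \<in> C" using C_nonempty by blast
  have "S \<in> \<Omega>' \<longleftrightarrow> (\<forall>P. P \<subseteq> tiles S \<and> finite P \<longrightarrow>
      (\<exists>u\<in>tiles_of_space \<Omega>'. \<exists>k v. translate v P \<subseteq> (subdivide omega' ^^ k) {u}))" for S
  proof
    assume "S \<in> \<Omega>'"
    then obtain x where "x \<in> C" "S = h x" by blast
    then show "\<forall>P. P \<subseteq> tiles S \<and> finite P \<longrightarrow>
      (\<exists>u\<in>tiles_of_space \<Omega>'. \<exists>k v. translate v P \<subseteq> (subdivide omega' ^^ k) {u})"
      using patch_in_supertile by blast
  next
    assume S: "\<forall>P. P \<subseteq> tiles S \<and> finite P \<longrightarrow>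
      (\<exists>u\<in>tiles_of_space \<Omega>'. \<exists>k v. translate v P \<subseteq> (subdivide omega' ^^ k) {u})"
    have "\<exists>v. translate v P \<subseteq> tiles (h x0)" if P: "P \<subseteq> tiles S" "finite P" for P
    proof -
      obtain u k v where u: "u \<in> tiles_of_space \<Omega>'" "translate v P \<subseteq> (subdivide omega' ^^ k) {u}"
        using S P by blast
      obtain x t where x: "x \<in> C" and t: "t \<in> tiles (p x)" and ut: "u = label_tile x t"
        using u(1) unfolding tiles_of_space_h by blast
      have "translate v P \<subseteq> tiles (h ((F ^^ k) x))"
        using u(2) sup_tile_F[OF x t, of k] unfolding ut subdivide_pow_label_tile[OF x t] tiles_h by blast
      from patch_in_orbit[OF F_pow_mem[OF x] x0 this] P(2)
      obtain w where "translate w (translate v P) \<subseteq> tiles (h x0)" by auto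
      then show ?thesis by auto
    qed
    then show "S \<in> \<Omega>'" unfolding hull_h[OF x0] tiling_hull_def by blast
  qed
  then show ?thesis unfolding generated_by_def by blast
qed

lemma substitution_tiling_space_h: "substitution_tiling_space (L ^^ n) \<Omega>' sigma'"
  unfolding substitution_tiling_space_def
proof (intro conjI exI[of _ omega'])
  show "\<forall>T\<in>\<Omega>'. tiles (sigma' T) = subdivide omega' (tiles T)" using tiles_sigma' by blast
qed (rule tiling_space_h rule_omega' generated_omega' homeomorphism_sigma')+

end

theorem theorem1p3:
  fixes L :: "'a::euclidean_space \<Rightarrow> 'a"
    and \<Omega> :: "('a, 'l) tiling set"
    and \<sigma> :: "('a, 'l) tiling \<Rightarrow> ('a, 'l) tiling"
    and C :: "'c::topological_space set"
    and p :: "'c \<Rightarrow> ('a, 'l) tiling"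
  assumes "substitution_tiling_space L \<Omega> \<sigma>"
    and "finite_regular_cover C p \<Omega>"
  shows "\<exists>n>0. \<exists>\<sigma>C :: 'c \<Rightarrow> 'c.
    (\<exists>(\<Omega>' :: ('a, 'l \<times> ('a, 'l) collar_type \<times> ('c \<Rightarrow> 'c)) tiling set) \<sigma>' h h'.
       substitution_tiling_space (L ^^ n) \<Omega>' \<sigma>' \<and>
       homeomorphism C \<Omega>' h h' \<and>
       (\<forall>x\<in>C. adds_labels (deck_transformations C p) (p x) (h x)) \<and>
       (\<forall>x\<in>C. \<sigma>C x \<in> C \<and> h (\<sigma>C x) = \<sigma>' (h x))) \<and>
    (\<forall>x\<in>C. p (\<sigma>C x) = (\<sigma> ^^ n) (p x))"
proof -
  obtain T0 where T0: "finite_local_complexity T0" "repetitive T0" "\<Omega> = tiling_hull T0"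
    using assms(1) unfolding substitution_tiling_space_def tiling_space_def by blast
  obtain \<omega> where \<omega>: "inflate_and_subdivide_rule L (tiles_of_space \<Omega>) \<omega>"
    "\<forall>T\<in>\<Omega>. tiles (\<sigma> T) = subdivide \<omega> (tiles T)"
    using assms(1) unfolding substitution_tiling_space_def by blast
  obtain \<sigma>i where \<sigma>i: "homeomorphism \<Omega> \<Omega> \<sigma> \<sigma>i"
    using assms(1) unfolding substitution_tiling_space_def by blast
  interpret substitution_cover T0 \<Omega> L \<sigma> \<sigma>i \<omega> C p
    by unfold_locales (use T0 \<omega> \<sigma>i assms(2) in simp_all)
  obtain n F F' where F: "n > 0" "\<forall>x\<in>C. F x \<in> C \<and> F' x \<in> C \<and> F' (F x) = x \<and> F (F' x) = x"
    "\<forall>x\<in>C. p (F x) = (\<sigma> ^^ n) (p x)" "\<forall>x\<in>C. \<forall>v. F (flow v x) = flow ((L ^^ n) v) (F x)"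
    "\<forall>X x. x \<in> C \<longrightarrow> (\<forall>n. X n \<in> C) \<longrightarrow> X \<longlonglongrightarrow> x \<longrightarrow> (\<lambda>n. F (X n)) \<longlonglongrightarrow> F x"
    "\<forall>X x. x \<in> C \<longrightarrow> (\<forall>n. X n \<in> C) \<longrightarrow> X \<longlonglongrightarrow> x \<longrightarrow> (\<lambda>n. F' (X n)) \<longlonglongrightarrow> F' x"
    by (rule lift_exists)
  interpret lifted_substitution T0 \<Omega> L \<sigma> \<sigma>i \<omega> C p n F F'
    by unfold_locales (use F in simp_all)
  have "(\<forall>x\<in>C. F x \<in> C \<and> h (F x) = sigma' (h x))" by (simp add: sigma'_h)
  moreover have "\<forall>x\<in>C. adds_labels (deck_transformations C p) (p x) (h x)"
    using adds_labels_h by blast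
  ultimately show ?thesis
    using substitution_tiling_space_h homeomorphism_h F(1,3) by blast
qed

end
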